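(* Let $\Omega\subset\mathbb{R}^N$ be an open bounded domain, $j\in\{1,\dots,N\}$, $u_0\in C(\overline{\Omega})$ and $g=u_0|_{\partial\Omega}$. Let $u$ be the viscosity solution of \[ u_t-\lambda_j(D^2u)=0 \text{ in }\Omega\times(0,\infty),\quad u=g\text{ on }\partial\Omega\times(0,\infty),\quad u(\cdot,0)=u_0\text{ in }\Omega, \] and $z$ the viscosity solution of $\lambda_j(D^2z)=0$ in $\Omega$, $z=g$ on $\partial\Omega$. Then there exist constants $\mu>0$ depending only on $\Omega$ and $C>0$ depending on $u_0$ such that \[ \|u(\cdot,t)-z\|_{L^\infty(\Omega)}\le Ce^{-\mu t}\quad\text{for all }t>0. \]
   Context: $\lambda_j(A)$ denotes the $j$-th smallest eigenvalue of a symmetric $N\times N$ matrix $A$ ($\lambda_1\le\dots\le\lambda_N$), equivalently $\lambda_j(A)=\inf_{\dim S=j}\sup_{v\in S,|v|=1}\langle Av,v\rangle$. Solutions are understood in the viscosity sense (continuous up to the boundary, boundary and initial data attained pointwise; test functions touching from below give $\phi_t-\lambda_j(D^2\phi)\ge0$, from above $\le0$, and in the elliptic case $-\lambda_j(D^2\phi)\ge 0$ resp. $\le0$ with sign conventions of $\lambda_j(D^2z)=0$). For $j=1$ (resp. $j=N$) $z$ is the convex (resp. concave) envelope of $g$ in $\Omega$. *)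

theory Defs
  imports "HOL-Analysis.Analysis"
begin

text \<open>j-th smallest eigenvalue via the Courant--Fischer min-max formula
  lambda_j(A) = inf over subspaces S of dimension j of sup over unit v in S of <Av,v>.\<close>
definition eig_j :: "nat \<Rightarrow> real^'n^'n \<Rightarrow> real" where
  "eig_j j A = Inf ((\<lambda>S. Sup ((\<lambda>v. (A *v v) \<bullet> v) ` {v \<in> S. norm v = 1}))
                     ` {S. subspace S \<and> dim S = j})"

definition C2_fun :: "('a::euclidean_space \<Rightarrow> real) \<Rightarrow> ('a \<Rightarrow> 'a) \<Rightarrow> ('a \<Rightarrow> 'a \<Rightarrow> 'a) \<Rightarrow> bool" where
  "C2_fun f f' f'' \<longleftrightarrow>
     (\<forall>x. (f has_derivative (\<lambda>h. f' x \<bullet> h)) (at x)) \<and>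
     (\<forall>x. (f' has_derivative f'' x) (at x)) \<and>
     (\<forall>h. continuous_on UNIV (\<lambda>x. f'' x h))"

definition hess_mat :: "(real^'n \<Rightarrow> real^'n \<Rightarrow> real^'n) \<Rightarrow> real^'n \<Rightarrow> real^'n^'n" where
  "hess_mat f'' x = (\<chi> i k. f'' x (axis k 1) $ i)"

definition hess_x :: "((real^'n) \<times> real \<Rightarrow> (real^'n) \<times> real \<Rightarrow> (real^'n) \<times> real)
                      \<Rightarrow> (real^'n) \<times> real \<Rightarrow> real^'n^'n" where
  "hess_x f'' p = (\<chi> i k. fst (f'' p (axis k 1, 0)) $ i)"

definition visc_sol_par :: "nat \<Rightarrow> (real^'n) set \<Rightarrow> (real^'n \<Rightarrow> real) \<Rightarrow> (real^'n \<Rightarrow> real)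
                             \<Rightarrow> (real^'n \<Rightarrow> real \<Rightarrow> real) \<Rightarrow> bool" where
  "visc_sol_par j \<Omega> g u0 u \<longleftrightarrow>
     continuous_on (closure \<Omega> \<times> {0..}) (\<lambda>p. u (fst p) (snd p)) \<and>
     (\<forall>x\<in>frontier \<Omega>. \<forall>t>0. u x t = g x) \<and>
     (\<forall>x\<in>\<Omega>. u x 0 = u0 x) \<and>
     (\<forall>x0\<in>\<Omega>. \<forall>t0>0. \<forall>\<phi> \<phi>' \<phi>''. C2_fun \<phi> \<phi>' \<phi>'' \<longrightarrow>
        ((\<exists>e>0. \<forall>p\<in>ball (x0,t0) e. u (fst p) (snd p) - \<phi> p \<ge> u x0 t0 - \<phi> (x0,t0))
           \<longrightarrow> snd (\<phi>' (x0,t0)) - eig_j j (hess_x \<phi>'' (x0,t0)) \<ge> 0) \<and>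
        ((\<exists>e>0. \<forall>p\<in>ball (x0,t0) e. u (fst p) (snd p) - \<phi> p \<le> u x0 t0 - \<phi> (x0,t0))
           \<longrightarrow> snd (\<phi>' (x0,t0)) - eig_j j (hess_x \<phi>'' (x0,t0)) \<le> 0))"

definition visc_sol_ell :: "nat \<Rightarrow> (real^'n) set \<Rightarrow> (real^'n \<Rightarrow> real) \<Rightarrow> (real^'n \<Rightarrow> real) \<Rightarrow> bool" where
  "visc_sol_ell j \<Omega> g z \<longleftrightarrow>
     continuous_on (closure \<Omega>) z \<and>
     (\<forall>x\<in>frontier \<Omega>. z x = g x) \<and>
     (\<forall>x0\<in>\<Omega>. \<forall>\<phi> \<phi>' \<phi>''. C2_fun \<phi> \<phi>' \<phi>'' \<longrightarrow>
        ((\<exists>e>0. \<forall>x\<in>ball x0 e. z x - \<phi> x \<ge> z x0 - \<phi> x0)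
           \<longrightarrow> - eig_j j (hess_mat \<phi>'' x0) \<ge> 0) \<and>
        ((\<exists>e>0. \<forall>x\<in>ball x0 e. z x - \<phi> x \<le> z x0 - \<phi> x0)
           \<longrightarrow> - eig_j j (hess_mat \<phi>'' x0) \<le> 0))"

end

theory Submission
  imports Defs
begin

text \<open>Only \<open>\<lambda>\<^sub>j(A) \<le> \<lambda>\<^sub>j(B) + c\<close> for \<open>A \<le> B + c\<close> is used of the eigenvalue. With
  \<open>\<psi>(x) = Q - \<bar>x\<bar>\<^sup>2 \<ge> 1\<close> on \<open>\<Omega>\<close> and \<open>\<mu> = 1/Q\<close>, the functions \<open>z \<plusminus> M exp(-\<mu>t) \<psi>\<close> are strict
  super- and subsolutions of the evolution equation, so the theorem is a comparison principle. Time is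
  eliminated by maximising over it: \<open>sup\<^sub>t (u(x,t) - M exp(-\<mu>t) \<psi>(x))\<close> is a strict subsolution of
  the elliptic equation.

  Sup-convolution turns the comparison into a statement about semiconvex functions \<open>f\<close>, \<open>g\<close> whose sum
  has a maximum: there must be points nearby where \<open>f\<close> and \<open>g\<close> are touched from above by quadratics
  with almost opposite Hessians. Instead of Alexandrov's theorem a compactness argument is used. The set of
  contact points of \<open>f + g\<close> with slightly tilted planes has positive measure, hence blowing up at a density
  point yields limits \<open>U\<close>, \<open>V\<close> that are semiconvex with \<open>U + V\<close> concave. Such limits form a class closed under
  translation, rescaling, addition of affine functions and pointwise limits. A limit that
  maximises the second difference in a given direction can be improved to one whose second differences are
  invariant under translation in that direction; after all coordinate directions \<open>U\<close> is quadratic.\<close>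

section \<open>Convex functions and pointwise limits\<close>

text \<open>Both solutions are merely continuous, so their difference satisfies no equation and
  second order information has to be extracted through test functions. The operator sees neither the
  point nor the gradient nor the value: the two touching quadratics may sit at different points with
  unrelated slopes, and only their Hessians, opposite up to a small multiple of the identity, are
  compared. A single maximum point of the sum need not carry second order information; tilting by
  all small slopes is what produces a contact set of positive measure. The error is absorbed by a
  quantitative gap: the barrier \<open>A t * (Q - x \<bullet> x)\<close> shifts the Hessian by
  \<open>2 * A t\<close> but the time derivative by at most \<open>A t\<close>.\<close>

definition sdiff :: "('a::real_vector \<Rightarrow> real) \<Rightarrow> 'a \<Rightarrow> 'a \<Rightarrow> real" where
  "sdiff f x h = f (x + h) + f (x - h) - 2 * f x"

definition semiconvex :: "real \<Rightarrow> ('a::real_inner \<Rightarrow> real) \<Rightarrow> bool" where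
  "semiconvex L f \<longleftrightarrow> convex_on UNIV (\<lambda>x. f x + L / 2 * (x \<bullet> x))"

section \<open>Subgradients and Lipschitz estimates for convex functions\<close>

text \<open>The point of the graph is separated from the strict epigraph. The normal
  \<open>(p, q)\<close> has \<open>q > 0\<close>, since for \<open>q = 0\<close> the function
  \<open>p \<bullet> y\<close> would be bounded below on the whole space; dividing by
  \<open>q\<close> gives the slope.\<close>

lemma convex_subgradient:
  fixes F :: "'a::euclidean_space \<Rightarrow> real"
  assumes F: "convex_on UNIV F"
  shows "\<exists>p. \<forall>y. F y \<ge> F x + p \<bullet> (y - x)"
proof -
  let ?T = "{z :: 'a \<times> real. F (fst z) < snd z}"
  have cT: "convex ?T"
  proof (rule convexI, clarsimp)
    fix a b and r s u v :: real
    assume *: "F a < r" "F b < s" "0 \<le> u" "0 \<le> v" "u + v = 1"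
    have "F (u *\<^sub>R a + v *\<^sub>R b) \<le> u * F a + v * F b"
      using F * by (auto simp: convex_on_def)
    also have "\<dots> < u * r + v * s"
    proof (cases "u = 0")
      case True then show ?thesis using * by simp
    next
      case False
      then have "u * F a < u * r" "v * F b \<le> v * s" using * by (auto intro: mult_left_mono)
      then show ?thesis by linarith
    qed
    finally show "F (u *\<^sub>R a + v *\<^sub>R b) < u * r + v * s" .
  qed
  have "(x, F x + 1) \<in> ?T" by simp
  then have "?T \<noteq> {}" by blast
  then obtain a b where ab: "a \<noteq> 0" "\<forall>z\<in>{(x, F x)}. a \<bullet> z \<le> b" "\<forall>z\<in>?T. a \<bullet> z \<ge> b"
    using separating_hyperplane_sets[of "{(x, F x)}" ?T] cT by auto
  obtain p q where a: "a = (p, q)" by (cases a)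
  have 1: "p \<bullet> x + q * F x \<le> p \<bullet> y + q * r" if "F y < r" for y r
    using ab that unfolding a by (force simp: inner_Pair)
  \<comment> \<open>Separation holds strictly above the graph; the height is lowered to
    \<open>F y\<close>. The denominator \<open>\<bar>q\<bar> + 1\<close> works before anything is
    known about \<open>q\<close>.\<close>
  have 2: "p \<bullet> x + q * F x \<le> p \<bullet> y + q * F y" for y
  proof (rule field_le_epsilon)
    fix e :: real assume "e > 0"
    have "q * (e / (\<bar>q\<bar> + 1)) \<le> e"
    proof -
      have "q * e \<le> \<bar>q\<bar> * e" using \<open>e > 0\<close> by (intro mult_right_mono) auto
      also have "\<dots> \<le> (\<bar>q\<bar> + 1) * e" using \<open>e > 0\<close> by simp
      finally have "q * e / (\<bar>q\<bar> + 1) \<le> e" by (simp add: pos_divide_le_eq mult.commute)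
      then show ?thesis by simp
    qed
    moreover have "p \<bullet> x + q * F x \<le> p \<bullet> y + q * (F y + e / (\<bar>q\<bar> + 1))"
    proof (rule 1)
      have "0 < \<bar>q\<bar> + 1" by linarith
      then show "F y < F y + e / (\<bar>q\<bar> + 1)" using \<open>e > 0\<close> by simp
    qed
    ultimately show "p \<bullet> x + q * F x \<le> p \<bullet> y + q * F y + e"
      by (simp add: algebra_simps)
  qed
  have "q \<ge> 0" using 1[of x "F x + 1"] by (simp add: algebra_simps)
  have "q \<noteq> 0"
  proof
    assume "q = 0"
    then have "p \<bullet> x \<le> p \<bullet> (x - p)" using 2[of "x - p"] by simp
    then have "p \<bullet> p \<le> 0" by (simp add: inner_diff_right)
    then have "p = 0" by (metis inner_gt_zero_iff not_le)
    then show False using ab(1) a \<open>q = 0\<close> by (simp add: zero_prod_def)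
  qed
  with \<open>q \<ge> 0\<close> have "q > 0" by simp
  show ?thesis
  proof (intro exI allI)
    fix y
    have "q * F x + p \<bullet> x - p \<bullet> y \<le> q * F y" using 2[of y] by simp
    then have "(q * F x + p \<bullet> x - p \<bullet> y) / q \<le> F y" using \<open>q > 0\<close> by (simp add: field_simps)
    moreover have "(q * F x + p \<bullet> x - p \<bullet> y) / q = F x + (- (1/q) *\<^sub>R p) \<bullet> (y - x)"
      using \<open>q > 0\<close> by (simp add: field_simps inner_diff_right)
    ultimately show "F x + (- (1/q) *\<^sub>R p) \<bullet> (y - x) \<le> F y" by simp
  qed
qed

lemma semiconvex_subgradient:
  fixes f :: "'a::euclidean_space \<Rightarrow> real"
  assumes "semiconvex L f"
  shows "\<exists>p. \<forall>h. f (x + h) \<ge> f x + p \<bullet> h - L / 2 * (h \<bullet> h)"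
proof -
  obtain q where q: "\<And>y. f y + L / 2 * (y \<bullet> y) \<ge> f x + L / 2 * (x \<bullet> x) + q \<bullet> (y - x)"
    using convex_subgradient[OF assms[unfolded semiconvex_def], of x] by blast
  show ?thesis
  proof (intro exI allI)
    fix h
    show "f x + (q - L *\<^sub>R x) \<bullet> h - L / 2 * (h \<bullet> h) \<le> f (x + h)"
      using q[of "x + h"] by (simp add: inner_simps algebra_simps inner_commute)
  qed
qed

lemma semiconvex_sdiff_ge:
  fixes f :: "'a::euclidean_space \<Rightarrow> real"
  assumes "semiconvex L f"
  shows "sdiff f x h \<ge> - L * (h \<bullet> h)"
proof -
  obtain p where p: "\<And>h. f (x + h) \<ge> f x + p \<bullet> h - L / 2 * (h \<bullet> h)"
    using semiconvex_subgradient[OF assms, of x] by blast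
  show ?thesis using p[of h] p[of "-h"] by (simp add: sdiff_def)
qed

text \<open>The segment from \<open>x\<close> to \<open>y\<close> is prolonged beyond
  \<open>y\<close> by length one to a point \<open>z\<close> of the larger ball. Convexity bounds
  the slope from \<open>x\<close> to \<open>y\<close> by the slope from \<open>y\<close> to
  \<open>z\<close>, which is at most \<open>2 * B\<close>.\<close>

lemma convex_Lipschitz_on_cball:
  fixes F :: "'a::euclidean_space \<Rightarrow> real"
  assumes F: "convex_on UNIV F" and B: "\<And>x. norm x \<le> R + 1 \<Longrightarrow> \<bar>F x\<bar> \<le> B"
    and x: "norm x \<le> R" and y: "norm y \<le> R"
  shows "\<bar>F x - F y\<bar> \<le> 2 * B * norm (x - y)"
proof -
  have B0: "B \<ge> 0" using B[of x] x by linarith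
  have *: "F y - F x \<le> 2 * B * norm (y - x)" if "norm x \<le> R" "norm y \<le> R" for x y
  proof (cases "x = y")
    case False
    define d where "d = norm (y - x)"
    have d: "d > 0" using False by (simp add: d_def)
    define z where "z = y + (1/d) *\<^sub>R (y - x)"
    have "norm ((1/d) *\<^sub>R (y - x)) = 1" using d by (simp add: d_def[symmetric])
    then have nz: "norm z \<le> R + 1" unfolding z_def using that norm_triangle_ineq[of y "(1/d) *\<^sub>R (y - x)"] by linarith
    have z1: "(1 + d) *\<^sub>R y = x + d *\<^sub>R z"
      unfolding z_def using d by (simp add: algebra_simps)
    have "y = (1/(1+d)) *\<^sub>R ((1 + d) *\<^sub>R y)" using d by simp
    then have "y = (1/(1+d)) *\<^sub>R x + (d/(1+d)) *\<^sub>R z"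
      unfolding z1 by (simp add: scaleR_add_right)
    moreover have "F ((1/(1+d)) *\<^sub>R x + (d/(1+d)) *\<^sub>R z) \<le> 1/(1+d) * F x + d/(1+d) * F z"
    proof -
      have "1/(1+d) = 1 - d/(1+d)" using d by (simp add: field_simps)
      then show ?thesis using convex_onD[OF F, of "d/(1+d)" x z] d by simp
    qed
    ultimately have "F y \<le> (F x + d * F z) / (1 + d)" using d by (simp add: add_divide_distrib)
    then have "F y * (1 + d) \<le> F x + d * F z" using d by (simp add: field_simps)
    then have "F y - F x \<le> d * (F z - F y)" by (simp add: algebra_simps)
    also have "\<dots> \<le> d * (2 * B)" using B[OF nz] B[of y] that d by (intro mult_left_mono) auto
    finally show ?thesis by (simp add: d_def mult.commute)
  qed simp
  show ?thesis using *[OF x y] *[OF y x] by (simp add: norm_minus_commute abs_le_iff)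
qed

text \<open>The values at the vertices of a cube bound \<open>G\<close> above, reflection in the
  origin bounds it below; so all admissible \<open>G\<close> share one Lipschitz constant and a
  finite net suffices. This upgrades the pointwise convergence of blow-ups to uniform closeness on a
  ball.\<close>

lemma convex_close_on_finite_imp_uniformly_close:
  fixes F :: "'a::euclidean_space \<Rightarrow> real"
  assumes F: "convex_on UNIV F" and R: "R > 0" and \<eta>: "\<eta> > 0"
  shows "\<exists>E \<delta>. finite E \<and> \<delta> > 0 \<and> (\<forall>G. convex_on UNIV G \<longrightarrow> (\<forall>x\<in>E. \<bar>G x - F x\<bar> < \<delta>) \<longrightarrow>
            (\<forall>x. norm x \<le> R \<longrightarrow> \<bar>G x - F x\<bar> < \<eta>))"
proof -
  define Q where "Q = cbox (0 - (\<Sum>i\<in>Basis. (R+1) *\<^sub>R i)) (0 + (\<Sum>i\<in>Basis. (R+1) *\<^sub>R i::'a))"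
  obtain S where S: "finite S" "Q = convex hull S"
    using cube_convex_hull[of "R+1" "0::'a"] R unfolding Q_def by auto
  have inQ: "x \<in> Q" if "norm x \<le> R + 1" for x :: 'a
  proof -
    have "\<bar>x \<bullet> i\<bar> \<le> R + 1" if "i \<in> Basis" for i
      using Basis_le_norm[OF that, of x] \<open>norm x \<le> R + 1\<close> by linarith
    then show ?thesis unfolding Q_def mem_box by (simp add: abs_le_iff minus_le_iff)
  qed
  have contF: "continuous_on UNIV F" by (rule convex_on_continuous[OF open_UNIV F])
  have "compact (F ` (cball 0 (R+1) \<union> S \<union> {0}))"
    using S(1) contF by (intro compact_continuous_image compact_Un) (auto intro: continuous_on_subset finite_imp_compact)
  then obtain B0 where B0: "\<And>x. x \<in> cball 0 (R+1) \<union> S \<union> {0} \<Longrightarrow> \<bar>F x\<bar> \<le> B0"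
    unfolding compact_eq_bounded_closed bounded_iff by (auto simp del: Un_iff)
  have B00: "B0 \<ge> 0" using B0[of 0] by auto
  \<comment> \<open>The lower bound is \<open>G y \<ge> 2 * G 0 - G (- y)\<close>, at worst
    \<open>- 3 * (B0 + 1)\<close>. The radius \<open>r\<close> makes the Lipschitz error
    \<open>2 * B * r\<close> equal to \<open>\<eta> / 8\<close> for each of \<open>F\<close> and
    \<open>G\<close>.\<close>
  define B where "B = 3 * (B0 + 1)"
  have B: "B > 0" using B00 by (simp add: B_def)
  define r where "r = \<eta> / (16 * B)"
  have r: "r > 0" using B \<eta> by (simp add: r_def)
  have "cball 0 R \<subseteq> (\<Union>c\<in>cball (0::'a) R. ball c r)" using r by force
  then obtain N where N: "finite (N::'a set)" "N \<subseteq> cball 0 R" "cball 0 R \<subseteq> (\<Union>x\<in>N. ball x r)"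
    by (rule compactE_image[of "cball 0 R" "cball 0 R" "\<lambda>x::'a. ball x r", rotated 2]) auto
  show ?thesis
  proof (intro exI conjI allI impI)
    show "finite (S \<union> {0} \<union> N)" using S N by auto
    show "min 1 (\<eta>/4) > 0" using \<eta> by auto
    fix G :: "'a \<Rightarrow> real" and x :: 'a
    assume G: "convex_on UNIV G" and cl: "\<forall>x\<in>S \<union> {0} \<union> N. \<bar>G x - F x\<bar> < min 1 (\<eta> / 4)" and x: "norm x \<le> R"
    have up: "G y \<le> B0 + 1" if "y \<in> Q" for y
    proof -
      have "\<forall>s\<in>S. G s \<le> B0 + 1"
      proof
        fix s assume "s \<in> S"
        then have "\<bar>F s\<bar> \<le> B0" "\<bar>G s - F s\<bar> < min 1 (\<eta> / 4)" using B0[of s] cl by simp_all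
        then show "G s \<le> B0 + 1" by linarith
      qed
      moreover have "convex_on (convex hull S) G" using G convex_on_subset by blast
      ultimately show ?thesis using convex_on_convex_hull_bound[of S G "B0+1"] that S(2) by blast
    qed
    have GB: "\<bar>G y\<bar> \<le> B" if "norm y \<le> R + 1" for y
    proof -
      have "G y \<le> B0 + 1" "G (-y) \<le> B0 + 1" using up inQ that by auto
      moreover have "G 0 \<ge> - B0 - 1" using cl B0[of 0] by auto
      moreover have "2 * G 0 \<le> G y + G (-y)"
      proof -
        have "G ((1/2) *\<^sub>R y + (1/2) *\<^sub>R (-y)) \<le> 1/2 * G y + 1/2 * G (-y)"
          using convex_onD[OF G, of "1/2" y "-y"] by simp
        then show ?thesis by simp
      qed
      ultimately show ?thesis unfolding B_def using B00 by auto
    qed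
    have FB: "\<bar>F y\<bar> \<le> B" if "norm y \<le> R + 1" for y
      using B0[of y] that B00 by (simp add: B_def)
    have "x \<in> (\<Union>c\<in>N. ball c r)" using N(3) x by (auto simp: subset_iff)
    then obtain n where n: "n \<in> N" "dist n x < r" by auto
    have nn: "norm n \<le> R" using n N by auto
    have "2 * B * norm (x - n) \<le> 2 * B * r" using n B by (intro mult_left_mono) (auto simp: dist_norm norm_minus_commute)
    also have "\<dots> = \<eta> / 8" using B by (simp add: r_def)
    finally have *: "2 * B * norm (x - n) \<le> \<eta> / 8" .
    have "\<bar>G x - G n\<bar> \<le> \<eta> / 8" "\<bar>F x - F n\<bar> \<le> \<eta> / 8"
      using convex_Lipschitz_on_cball[OF G GB x nn] convex_Lipschitz_on_cball[OF F FB x nn] * by linarith+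
    moreover have "\<bar>G n - F n\<bar> < \<eta> / 4" using cl n by auto
    ultimately show "\<bar>G x - F x\<bar> < \<eta>" using \<eta> by linarith
  qed
qed

section \<open>Cluster points for pointwise convergence\<close>

text \<open>Tychonoff's theorem for the product of the intervals from \<open>- B x\<close> to
  \<open>B x\<close>. An uncountable product need not be sequentially compact, so convergence is
  along a finer filter instead of a subsequence.\<close>

lemma pointwise_bounded_cluster:
  fixes f :: "'i \<Rightarrow> 'a \<Rightarrow> real"
  assumes "F \<noteq> bot" and bd: "\<And>x. \<exists>B. \<forall>i. \<bar>f i x\<bar> \<le> B"
  shows "\<exists>G g. G \<noteq> bot \<and> G \<le> F \<and> (\<forall>x. ((\<lambda>i. f i x) \<longlongrightarrow> g x) G)"
proof -
  obtain B where B: "\<And>i x. \<bar>f i x\<bar> \<le> B x" using bd by metis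
  let ?K = "PiE UNIV (\<lambda>x. {- B x..B x})"
  have "compactin (product_topology (\<lambda>_. euclidean) UNIV) ?K"
    by (subst compactin_PiE) auto
  then have "compact ?K" by (simp add: euclidean_product_topology)
  moreover have "eventually (\<lambda>g. g \<in> ?K) (filtermap f F)"
    unfolding eventually_filtermap using B by (intro always_eventually) (simp add: abs_le_iff minus_le_iff PiE_def Pi_def)
  moreover have "filtermap f F \<noteq> bot" using assms by (simp add: filtermap_bot_iff)
  ultimately obtain g where g: "inf (nhds g) (filtermap f F) \<noteq> bot"
    unfolding compact_filter by blast
  let ?G = "inf F (filtercomap f (nhds g))"
  have "?G \<noteq> bot"
  proof
    assume "?G = bot"
    then have "eventually (\<lambda>_. False) ?G" by simp
    then obtain P Q where P: "eventually P F" and Q: "eventually Q (nhds g)" and PQ: "\<And>i. P i \<Longrightarrow> Q (f i) \<Longrightarrow> False"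
      unfolding eventually_inf eventually_filtercomap by blast
    have "eventually (\<lambda>h. \<not> Q h) (filtermap f F)"
      unfolding eventually_filtermap by (rule eventually_mono[OF P]) (use PQ in blast)
    then have "eventually (\<lambda>_. False) (inf (nhds g) (filtermap f F))"
      using Q unfolding eventually_inf by blast
    then show False using g by (simp add: trivial_limit_def)
  qed
  moreover have "((\<lambda>i. f i x) \<longlongrightarrow> g x) ?G" for x
  proof -
    have "filterlim f (nhds g) ?G"
      by (meson filterlim_filtercomap filterlim_iff inf_le2 filterlim_mono order_refl)
    moreover have "open {h::'a \<Rightarrow> real. h x \<in> S}" if "open S" for S
      using product_topology_basis'[of "{()}" "\<lambda>_. S" "\<lambda>_. x"] that by simp
    ultimately have "eventually (\<lambda>i. f i x \<in> S) ?G" if "open S" "g x \<in> S" for S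
    proof -
      have "eventually (\<lambda>i. f i \<in> {h. h x \<in> S}) ?G"
        using \<open>filterlim f (nhds g) ?G\<close> that \<open>open S \<Longrightarrow> open {h. h x \<in> S}\<close>
        by (intro topological_tendstoD) auto
      then show ?thesis by simp
    qed
    then show ?thesis by (rule topological_tendstoI)
  qed
  ultimately show ?thesis by (intro exI[of _ ?G] exI[of _ g]) auto
qed

section \<open>Quadratic functions characterised by second differences\<close>

lemma additive_continuous_imp_linear:
  fixes f :: "'a::euclidean_space \<Rightarrow> real"
  assumes add: "\<And>x y. f (x + y) = f x + f y" and cont: "continuous_on UNIV f"
  shows "linear f"
proof (rule linearI)
  show "f (x + y) = f x + f y" for x y by (rule add)
  fix r x
  have f0: "f 0 = 0" using add[of 0 0] by simp
  have neg: "f (- y) = - f y" for y using add[of y "-y"] f0 by simp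
  have nat: "f (real n *\<^sub>R y) = real n * f y" for n y
    by (induction n) (auto simp: f0 add algebra_simps)
  have int: "f (real_of_int k *\<^sub>R y) = real_of_int k * f y" for k y
  proof (cases "k \<ge> 0")
    case True then show ?thesis using nat[of "nat k" y] by simp
  next
    case False then show ?thesis using nat[of "nat (-k)" y] neg[of "real_of_int k *\<^sub>R y"] by simp
  qed
  have rat: "q \<in> \<rat> \<Longrightarrow> f (q *\<^sub>R x) = q * f x" for q
  proof (induction rule: Rats_cases')
    case (1 a b)
    have "real_of_int b *\<^sub>R (q *\<^sub>R x) = real_of_int a *\<^sub>R x" using 1 by simp
    then have "real_of_int b * f (q *\<^sub>R x) = real_of_int a * f x" by (metis int)
    also have "\<dots> = real_of_int b * (q * f x)" using 1 by simp
    finally have "real_of_int b * f (q *\<^sub>R x) = real_of_int b * (q * f x)" .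
    moreover have "real_of_int b \<noteq> 0" using 1 by simp
    ultimately show ?case by (metis mult_left_cancel)
  qed
  have "closed {q. f (q *\<^sub>R x) = q * f x}"
  proof (rule closed_Collect_eq)
    show "continuous_on UNIV (\<lambda>q. f (q *\<^sub>R x))"
      by (rule continuous_on_compose2[OF cont]) (auto intro!: continuous_intros)
  qed (intro continuous_intros)
  moreover have "\<rat> \<subseteq> {q. f (q *\<^sub>R x) = q * f x}" using rat by blast
  ultimately have "closure \<rat> \<subseteq> {q. f (q *\<^sub>R x) = q * f x}" by (rule closure_minimal[rotated])
  then show "f (r *\<^sub>R x) = r *\<^sub>R f x" unfolding Rats_closure_real by auto
qed

text \<open>The four points are the vertices of a parallelogram with centre
  \<open>z + (1/2) *\<^sub>R (x + y)\<close>, and the two second differences belong to its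
  diagonals.\<close>

lemma mixed_difference_eq:
  fixes U :: "'a::real_vector \<Rightarrow> real"
  shows "U (z + x + y) - U (z + x) - U (z + y) + U z =
    sdiff U (z + (1/2) *\<^sub>R (x + y)) ((1/2) *\<^sub>R (x + y)) - sdiff U (z + (1/2) *\<^sub>R (x + y)) ((1/2) *\<^sub>R (x - y))"
proof -
  have half: "(1/2) *\<^sub>R v + (1/2) *\<^sub>R v = v" for v :: 'a
    using scaleR_half_double[of v] by (simp add: scaleR_add_right)
  have "z + (1/2) *\<^sub>R (x + y) + (1/2) *\<^sub>R (x + y) = z + ((1/2) *\<^sub>R (x + y) + (1/2) *\<^sub>R (x + y))"
    "z + (1/2) *\<^sub>R (x + y) + (1/2) *\<^sub>R (x - y) = z + ((1/2) *\<^sub>R x + (1/2) *\<^sub>R x)"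
    "z + (1/2) *\<^sub>R (x + y) - (1/2) *\<^sub>R (x - y) = z + ((1/2) *\<^sub>R y + (1/2) *\<^sub>R y)"
    by (simp_all add: scaleR_add_right scaleR_diff_right)
  then have [simp]: "z + (1/2) *\<^sub>R (x + y) + (1/2) *\<^sub>R (x + y) = z + x + y"
    "z + (1/2) *\<^sub>R (x + y) + (1/2) *\<^sub>R (x - y) = z + x"
    "z + (1/2) *\<^sub>R (x + y) - (1/2) *\<^sub>R (x - y) = z + y"
    by (simp_all only: half add.assoc)
  show ?thesis unfolding sdiff_def by simp
qed

text \<open>By polarisation the mixed difference \<open>b x y\<close> does not depend on the base
  point, hence it is additive in each argument and, by continuity, bilinear. What is left of
  \<open>U\<close> after removing \<open>U 0\<close> and \<open>1/2 * b x x\<close> is additive,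
  hence linear.\<close>

lemma quadratic_if_sdiff_invariant:
  fixes U :: "'a::euclidean_space \<Rightarrow> real"
  assumes cont: "continuous_on UNIV U" and inv: "\<And>x h. sdiff U x h = sdiff U 0 h"
  shows "\<exists>a p T. linear T \<and> (\<forall>x y. T x \<bullet> y = x \<bullet> T y) \<and> (\<forall>x. U x = a + p \<bullet> x + 1/2 * (T x \<bullet> x))"
proof -
  define b where "b x y = U (x + y) - U x - U y + U 0" for x y
  have m: "U (z + x + y) - U (z + x) - U (z + y) + U z = b x y" for z x y
    using mixed_difference_eq[of U z x y] mixed_difference_eq[of U 0 x y]
      inv[of "z + (1/2) *\<^sub>R (x + y)"] inv[of "(1/2) *\<^sub>R (x + y)"]
    unfolding b_def by simp
  have sym: "b x y = b y x" for x y by (simp add: b_def add.commute)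
  \<comment> \<open>The mixed differences with base points \<open>x'\<close> and \<open>0\<close>
    telescope.\<close>
  have add: "b (x + x') y = b x y + b x' y" for x x' y
    using m[of x' x y] unfolding b_def by (simp add: algebra_simps)
  have lin1: "linear (\<lambda>x. b x y)" for y
  proof (rule additive_continuous_imp_linear)
    have "continuous_on UNIV (\<lambda>x. U (x + y))"
      by (rule continuous_on_compose2[OF cont]) (auto intro!: continuous_intros)
    then show "continuous_on UNIV (\<lambda>x. b x y)" unfolding b_def using cont by (intro continuous_intros)
  qed (rule add)
  have lin2: "linear (b x)" for x
  proof -
    have "b x = (\<lambda>y. b y x)" using sym by auto
    then show ?thesis using lin1[of x] by simp
  qed
  define T where "T x = (\<Sum>i\<in>Basis. b x i *\<^sub>R i)" for x
  have T: "T x \<bullet> y = b x y" for x y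
  proof -
    have "b x y = b x (\<Sum>i\<in>Basis. (y \<bullet> i) *\<^sub>R i)" by (simp add: euclidean_representation)
    also have "\<dots> = (\<Sum>i\<in>Basis. (y \<bullet> i) * b x i)"
      by (simp only: linear_sum[OF lin2] linear_cmul[OF lin2] real_scaleR_def)
    also have "\<dots> = T x \<bullet> y"
      unfolding T_def by (simp add: inner_sum_left inner_commute[of y] mult.commute)
    finally show ?thesis by simp
  qed
  have T': "y \<bullet> T x = b x y" for x y using T by (simp add: inner_commute)
  have linT: "linear T"
  proof (rule linearI)
    show "T (x + y) = T x + T y" for x y
    proof (rule euclidean_eqI)
      show "T (x + y) \<bullet> i = (T x + T y) \<bullet> i" for i by (simp only: inner_add_left T add)
    qed
    show "T (r *\<^sub>R x) = r *\<^sub>R T x" for r x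
    proof (rule euclidean_eqI)
      show "T (r *\<^sub>R x) \<bullet> i = (r *\<^sub>R T x) \<bullet> i" for i
        by (simp only: inner_scaleR_left T linear_cmul[OF lin1] real_scaleR_def)
    qed
  qed
  define R where "R x = U x - U 0 - 1/2 * b x x" for x
  have linR: "linear R"
  proof (rule additive_continuous_imp_linear)
    show "R (x + y) = R x + R y" for x y
    proof -
      have "b (x + y) (x + y) = b x x + 2 * b x y + b y y"
        using add[of x y "x + y"] sym[of x "x + y"] sym[of y "x + y"] add[of x y x] add[of x y y] sym[of y x] by linarith
      moreover have "b x y = U (x + y) - U x - U y + U 0" by (simp add: b_def)
      ultimately show ?thesis unfolding R_def by linarith
    qed
    have "continuous_on UNIV (\<lambda>x. T x \<bullet> x)"
      by (intro continuous_intros linear_continuous_on linear_linear[THEN iffD2] linT)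
    then have "continuous_on UNIV (\<lambda>x. U x - U 0 - 1/2 * (T x \<bullet> x))" using cont
      by (intro continuous_on_diff continuous_on_mult continuous_on_const) auto
    moreover have "R = (\<lambda>x. U x - U 0 - 1/2 * (T x \<bullet> x))" by (rule ext) (simp only: R_def T)
    ultimately show "continuous_on UNIV R" by simp
  qed
  define p where "p = (\<Sum>i\<in>Basis. R i *\<^sub>R i)"
  have p: "R x = p \<bullet> x" for x
  proof -
    have "R x = R (\<Sum>i\<in>Basis. (x \<bullet> i) *\<^sub>R i)" by (simp add: euclidean_representation)
    also have "\<dots> = (\<Sum>i\<in>Basis. (x \<bullet> i) * R i)"
      by (simp only: linear_sum[OF linR] linear_cmul[OF linR] real_scaleR_def)
    also have "\<dots> = p \<bullet> x"
      unfolding p_def by (simp add: inner_sum_left inner_commute[of x] mult.commute)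
    finally show ?thesis by simp
  qed
  have "T x \<bullet> y = x \<bullet> T y" for x y unfolding T T' by (rule sym)
  moreover have "U x = U 0 + p \<bullet> x + 1/2 * (T x \<bullet> x)" for x
    unfolding T p[symmetric] R_def by simp
  ultimately show ?thesis using linT by blast
qed

section \<open>Convexity in one real variable\<close>

text \<open>If the graph rose above a chord, the difference \<open>k\<close> from that chord would
  have a positive interior maximum, which midpoint convexity excludes.\<close>

lemma midpoint_convex_imp_convex:
  fixes c :: "real \<Rightarrow> real"
  assumes cont: "continuous_on UNIV c" and mid: "\<And>t s. sdiff c t s \<ge> 0"
  shows "convex_on UNIV c"
proof (rule convex_onI)
  fix u x y :: real assume u: "0 < u" "u < 1"
  define k where "k s = c (x + s * (y - x)) - c x - s * (c y - c x)" for s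
  show "c ((1 - u) *\<^sub>R x + u *\<^sub>R y) \<le> (1 - u) * c x + u * c y"
  proof (rule ccontr)
    assume "\<not> ?thesis"
    then have ku: "k u > 0" unfolding k_def by (simp add: algebra_simps)
    have contk: "continuous_on UNIV k" unfolding k_def
      by (intro continuous_intros continuous_on_compose2[OF cont]) auto
    obtain s1 where s1: "s1 \<in> {0..1}" "\<And>s. s \<in> {0..1} \<Longrightarrow> k s \<le> k s1"
      using continuous_attains_sup[of "{0..1}" k] continuous_on_subset[OF contk, of "{0..1}"] by auto
    \<comment> \<open>The leftmost maximiser \<open>s0\<close> is taken so that the value at
      \<open>s0 - h\<close> is strictly smaller.\<close>
    have "compact ({0..1} \<inter> {s. k s = k s1})"
      using contk by (intro compact_Int_closed closed_Collect_eq continuous_intros) auto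
    moreover have "s1 \<in> {0..1} \<inter> {s. k s = k s1}" using s1 by simp
    ultimately obtain s0 where s0: "s0 \<in> {0..1}" "k s0 = k s1"
      and s0': "\<And>s. s \<in> {0..1} \<Longrightarrow> k s = k s1 \<Longrightarrow> s0 \<le> s"
      using compact_attains_inf[of "{0..1} \<inter> {s. k s = k s1}"] by blast
    have "k s1 > 0" using s1(2)[of u] ku u by simp
    then have "s0 \<noteq> 0" "s0 \<noteq> 1" using s0 by (auto simp: k_def)
    then have s01: "0 < s0" "s0 < 1" using s0 by auto
    define h where "h = min s0 (1 - s0)"
    have h: "h > 0" "s0 - h \<in> {0..1}" "s0 + h \<in> {0..1}" using s01 by (auto simp: h_def)
    have "k (s0 - h) \<noteq> k s1" using s0'[of "s0 - h"] h by auto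
    then have "k (s0 - h) < k s1" using s1(2)[of "s0 - h"] h by simp
    moreover have "k (s0 + h) \<le> k s1" using s1(2) h by simp
    moreover have "k (s0 + h) + k (s0 - h) \<ge> 2 * k s0"
      using mid[of "x + s0 * (y - x)" "h * (y - x)"] unfolding k_def sdiff_def by (simp add: algebra_simps)
    ultimately show False using s0 by simp
  qed
qed auto

text \<open>Both \<open>t + s\<close> and \<open>t - s\<close> are convex combinations of
  \<open>t + s'\<close> and \<open>t - s'\<close>, with mirrored weights; the two inequalities add
  up to the claim.\<close>

lemma convex_sdiff_mono:
  fixes c :: "real \<Rightarrow> real"
  assumes c: "convex_on UNIV c" and s: "0 \<le> s" "s \<le> s'"
  shows "sdiff c t s \<le> sdiff c t s'"
proof (cases "s' = 0")
  case False
  then have s': "s' > 0" using s by simp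
  define l where "l = (1 + s / s') / 2"
  have l: "0 \<le> l" "l \<le> 1" using s s' by (auto simp: l_def field_simps)
  have 1: "t + s = (1 - l) *\<^sub>R (t - s') + l *\<^sub>R (t + s')" "t - s = (1 - l) *\<^sub>R (t + s') + l *\<^sub>R (t - s')"
    using s' by (simp_all add: l_def field_simps)
  have "c (t + s) \<le> (1 - l) * c (t - s') + l * c (t + s')" "c (t - s) \<le> (1 - l) * c (t + s') + l * c (t - s')"
    unfolding 1 by (rule convex_onD[OF c]; use l in simp)+
  then show ?thesis unfolding sdiff_def by (simp add: algebra_simps)
qed (use s in simp)

section \<open>Extremal blow-ups are quadratic\<close>

text \<open>All the changes of variables preserve bounds on second differences of the form
  \<open>L * (h \<bullet> h)\<close>. Limits are along arbitrary filters, to match the cluster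
  points that compactness of a product provides.\<close>

definition blowup_closed :: "(('a::euclidean_space \<Rightarrow> real) \<times> ('a \<Rightarrow> real)) set \<Rightarrow> bool" where
  "blowup_closed X \<longleftrightarrow>
    (\<forall>U V a b a' b'. (U, V) \<in> X \<longrightarrow> ((\<lambda>h. U h + a + b \<bullet> h), (\<lambda>h. V h + a' + b' \<bullet> h)) \<in> X) \<and>
    (\<forall>U V y. (U, V) \<in> X \<longrightarrow> ((\<lambda>h. U (h + y)), (\<lambda>h. V (h + y))) \<in> X) \<and>
    (\<forall>U V r. (U, V) \<in> X \<longrightarrow> 0 < r \<longrightarrow> ((\<lambda>h. U (r *\<^sub>R h) / r\<^sup>2), (\<lambda>h. V (r *\<^sub>R h) / r\<^sup>2)) \<in> X) \<and>
    (\<forall>(F :: nat filter) u v U V. F \<noteq> bot \<longrightarrow> (\<forall>n. (u n, v n) \<in> X) \<longrightarrow> (\<forall>x. ((\<lambda>n. u n x) \<longlongrightarrow> U x) F) \<longrightarrow>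
        (\<forall>x. ((\<lambda>n. v n x) \<longlongrightarrow> V x) F) \<longrightarrow> (U, V) \<in> X)"

definition controlled :: "real \<Rightarrow> (('a::euclidean_space \<Rightarrow> real) \<times> ('a \<Rightarrow> real)) set \<Rightarrow> bool" where
  "controlled L X \<longleftrightarrow> (\<forall>U V. (U, V) \<in> X \<longrightarrow>
     semiconvex L U \<and> semiconvex L V \<and> concave_on UNIV (\<lambda>x. U x + V x))"

lemma sdiff_add_affine:
  fixes U :: "'a::real_inner \<Rightarrow> real"
  shows "sdiff (\<lambda>h. U h + a + b \<bullet> h) x h = sdiff U x h"
  by (simp add: sdiff_def inner_simps)

lemma sdiff_shift:
  fixes U :: "'a::real_vector \<Rightarrow> real"
  shows "sdiff (\<lambda>h. U (h + y)) x h = sdiff U (x + y) h"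
  by (simp add: sdiff_def algebra_simps)

lemma sdiff_rescale:
  fixes U :: "'a::real_vector \<Rightarrow> real"
  shows "sdiff (\<lambda>h. U (r *\<^sub>R h) / c) x h = sdiff U (r *\<^sub>R x) (r *\<^sub>R h) / c"
  by (simp add: sdiff_def scaleR_add_right scaleR_diff_right add_divide_distrib diff_divide_distrib)

lemma sdiff_minus_right:
  fixes U :: "'a::real_vector \<Rightarrow> real"
  shows "sdiff U x (- h) = sdiff U x h"
  by (simp add: sdiff_def)

lemma convex_sdiff_nonneg:
  fixes F :: "'a::real_vector \<Rightarrow> real"
  assumes "convex_on UNIV F"
  shows "sdiff F x h \<ge> 0"
proof -
  have "F ((1 - 1/2) *\<^sub>R (x + h) + (1/2) *\<^sub>R (x - h)) \<le> (1 - 1/2) * F (x + h) + (1/2) * F (x - h)"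
    by (rule convex_onD[OF assms]) auto
  moreover have "(1 - 1/2) *\<^sub>R (x + h) + (1/2) *\<^sub>R (x - h) = x"
  proof -
    have "(1 - 1/2) *\<^sub>R (x + h) + (1/2) *\<^sub>R (x - h) = (1/2) *\<^sub>R x + (1/2) *\<^sub>R x"
      by (simp add: scaleR_add_right scaleR_diff_right)
    also have "\<dots> = x" by (simp flip: scaleR_left_distrib)
    finally show ?thesis .
  qed
  ultimately show ?thesis by (simp add: sdiff_def)
qed

text \<open>Concavity of the sum gives \<open>sdiff U x h \<le> - sdiff V x h\<close>, so the
  semiconvexity of each function bounds the other one from above.\<close>

lemma controlled_sdiff_bounds:
  assumes "controlled L X" "(U, V) \<in> X"
  shows "\<bar>sdiff U x h\<bar> \<le> L * (h \<bullet> h)" "\<bar>sdiff V x h\<bar> \<le> L * (h \<bullet> h)"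
proof -
  have "sdiff (\<lambda>x. - (U x + V x)) x h \<ge> 0"
    using assms unfolding controlled_def concave_on_def by (intro convex_sdiff_nonneg) blast
  then have "sdiff U x h + sdiff V x h \<le> 0" by (simp add: sdiff_def)
  moreover have "semiconvex L U" "semiconvex L V" using assms unfolding controlled_def by blast+
  then have "sdiff U x h \<ge> - L * (h \<bullet> h)" "sdiff V x h \<ge> - L * (h \<bullet> h)"
    by (simp_all only: semiconvex_sdiff_ge)
  ultimately show "\<bar>sdiff U x h\<bar> \<le> L * (h \<bullet> h)" "\<bar>sdiff V x h\<bar> \<le> L * (h \<bullet> h)" by auto
qed

lemma semiconvex_imp_continuous:
  fixes U :: "'a::euclidean_space \<Rightarrow> real"
  assumes "semiconvex L U"
  shows "continuous_on UNIV U"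
proof -
  have "continuous_on UNIV (\<lambda>x. U x + L / 2 * (x \<bullet> x))"
    using assms unfolding semiconvex_def by (intro convex_on_continuous) auto
  then have "continuous_on UNIV (\<lambda>x. (U x + L / 2 * (x \<bullet> x)) - L / 2 * (x \<bullet> x))"
    by (rule continuous_on_diff) (intro continuous_intros)
  then show ?thesis by simp
qed

text \<open>After subtraction of the value and a subgradient at the origin, semiconvexity gives the
  lower bound \<open>- L / 2 * (h \<bullet> h)\<close>. The upper bound adds the bound on the second
  difference to the lower bound at \<open>- h\<close>, which makes \<open>3 * L / 2\<close>.\<close>

lemma affine_normalisation:
  fixes U :: "'a::euclidean_space \<Rightarrow> real"
  assumes "semiconvex L U" "\<And>h. sdiff U 0 h \<le> L * (h \<bullet> h)"
  shows "\<exists>a b. \<forall>h. \<bar>U h + a + b \<bullet> h\<bar> \<le> 3 * L / 2 * (h \<bullet> h)"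
proof -
  obtain p where p: "\<And>h. U (0 + h) \<ge> U 0 + p \<bullet> h - L / 2 * (h \<bullet> h)"
    using semiconvex_subgradient[OF assms(1), of 0] by blast
  show ?thesis
  proof (intro exI allI)
    fix h :: 'a
    define d where "d = L * (h \<bullet> h)"
    have "sdiff U 0 h \<ge> - d" using semiconvex_sdiff_ge[OF assms(1), where x = 0 and h = h] by (simp add: d_def)
    moreover have "sdiff U 0 h \<le> d" using assms(2)[of h] by (simp add: d_def)
    moreover have "U h \<ge> U 0 + p \<bullet> h - d / 2" "U (- h) \<ge> U 0 - p \<bullet> h - d / 2"
      using p[of h] p[of "- h"] by (simp_all add: d_def)
    ultimately have "\<bar>U h + (- U 0) + (- p) \<bullet> h\<bar> \<le> 3 / 2 * d"
      unfolding sdiff_def add_0 diff_0 inner_minus_left by linarith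
    then show "\<bar>U h + (- U 0) + (- p) \<bullet> h\<bar> \<le> 3 * L / 2 * (h \<bullet> h)"
      by (simp add: d_def)
  qed
qed

text \<open>Second differences do not see affine functions, so members may be normalised to be
  pointwise bounded. The filter is refined once for the first components and once more for the
  second ones.\<close>

lemma blowup_cluster:
  fixes u v :: "nat \<Rightarrow> 'a::euclidean_space \<Rightarrow> real"
  assumes cl: "blowup_closed X" and ct: "controlled L X" and uv: "\<And>n. (u n, v n) \<in> X"
  shows "\<exists>G U V. G \<noteq> bot \<and> G \<le> sequentially \<and> (U, V) \<in> X \<and>
           (\<forall>x h. ((\<lambda>n. sdiff (u n) x h) \<longlongrightarrow> sdiff U x h) G)"
proof -
  have "\<exists>a b. \<forall>h. \<bar>u n h + a + b \<bullet> h\<bar> \<le> 3 * L / 2 * (h \<bullet> h)" for n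
  proof (rule affine_normalisation)
    show "semiconvex L (u n)" using ct uv[of n] unfolding controlled_def by blast
    show "sdiff (u n) 0 h \<le> L * (h \<bullet> h)" for h
      using controlled_sdiff_bounds(1)[OF ct uv[of n], of 0 h] by linarith
  qed
  then obtain a b where ab: "\<And>n h. \<bar>u n h + a n + b n \<bullet> h\<bar> \<le> 3 * L / 2 * (h \<bullet> h)" by metis
  have "\<exists>a b. \<forall>h. \<bar>v n h + a + b \<bullet> h\<bar> \<le> 3 * L / 2 * (h \<bullet> h)" for n
  proof (rule affine_normalisation)
    show "semiconvex L (v n)" using ct uv[of n] unfolding controlled_def by blast
    show "sdiff (v n) 0 h \<le> L * (h \<bullet> h)" for h
      using controlled_sdiff_bounds(2)[OF ct uv[of n], of 0 h] by linarith
  qed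
  then obtain a' b' where ab': "\<And>n h. \<bar>v n h + a' n + b' n \<bullet> h\<bar> \<le> 3 * L / 2 * (h \<bullet> h)" by metis
  define u' where "u' n = (\<lambda>h. u n h + a n + b n \<bullet> h)" for n
  define v' where "v' n = (\<lambda>h. v n h + a' n + b' n \<bullet> h)" for n
  have in_X: "(u' n, v' n) \<in> X" for n
    using cl uv[of n] unfolding blowup_closed_def u'_def v'_def by blast
  have "\<exists>B. \<forall>n. \<bar>u' n x\<bar> \<le> B" "\<exists>B. \<forall>n. \<bar>v' n x\<bar> \<le> B" for x
    using ab ab' unfolding u'_def v'_def by blast+
  note bd = this
  obtain G1 U where G1: "G1 \<noteq> bot" "G1 \<le> sequentially" "\<And>x. ((\<lambda>n. u' n x) \<longlongrightarrow> U x) G1"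
    using pointwise_bounded_cluster[of sequentially u', OF _ bd(1)] by auto
  obtain G V where G: "G \<noteq> bot" "G \<le> G1" "\<And>x. ((\<lambda>n. v' n x) \<longlongrightarrow> V x) G"
    using pointwise_bounded_cluster[of G1 v', OF G1(1) bd(2)] by auto
  have U: "((\<lambda>n. u' n x) \<longlongrightarrow> U x) G" for x by (rule tendsto_mono[OF G(2) G1(3)])
  have "(U, V) \<in> X" using cl in_X G U unfolding blowup_closed_def by meson
  moreover have "((\<lambda>n. sdiff (u n) x h) \<longlongrightarrow> sdiff U x h) G" for x h
  proof -
    have "((\<lambda>n. sdiff (u' n) x h) \<longlongrightarrow> sdiff U x h) G" unfolding sdiff_def by (intro tendsto_intros U)
    then show ?thesis unfolding u'_def sdiff_add_affine .
  qed
  ultimately show ?thesis using G(1) order_trans[OF G(2) G1(2)] by blast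
qed

text \<open>Maximise the second difference in direction \<open>e\<close>. Scale invariance of the class bounds it by
  \<open>M s\<^sup>2\<close> at every point and scale; zooming out yields a member attaining this bound along
  the whole axis, and translating along the axis to infinity one attaining it everywhere.\<close>

lemma blowup_invariant_direction:
  fixes X :: "(('a::euclidean_space \<Rightarrow> real) \<times> ('a \<Rightarrow> real)) set"
  assumes cl: "blowup_closed X" and ct: "controlled L X" and ne: "X \<noteq> {}" and e: "norm e = 1"
  shows "\<exists>U V. (U, V) \<in> X \<and> (\<forall>x t h. sdiff U (x + t *\<^sub>R e) h = sdiff U x h)"
proof -
  have ee: "e \<bullet> e = 1" using e by (simp add: dot_square_norm)
  define S where "S = {sdiff U 0 e |U V. (U, V) \<in> X}"
  define M where "M = Sup S"
  have Sbd: "s \<le> L" if "s \<in> S" for s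
    using that controlled_sdiff_bounds(1)[OF ct, of _ _ 0 e] ee unfolding S_def by (auto simp: abs_le_iff)
  have Sne: "S \<noteq> {}" using ne unfolding S_def by auto
  have up: "sdiff U x (s *\<^sub>R e) \<le> M * s\<^sup>2" if UV: "(U, V) \<in> X" for U V x s
  proof -
    have pos: "sdiff U x (s *\<^sub>R e) \<le> M * s\<^sup>2" if "s > 0" for s
    proof -
      let ?U = "\<lambda>h. U (h + x)" and ?V = "\<lambda>h. V (h + x)"
      have "(?U, ?V) \<in> X" using cl UV unfolding blowup_closed_def by blast
      then have "((\<lambda>h. ?U (s *\<^sub>R h) / s\<^sup>2), (\<lambda>h. ?V (s *\<^sub>R h) / s\<^sup>2)) \<in> X"
        using cl that unfolding blowup_closed_def by blast
      then have "sdiff (\<lambda>h. ?U (s *\<^sub>R h) / s\<^sup>2) 0 e \<in> S" unfolding S_def by blast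
      then have "sdiff (\<lambda>h. ?U (s *\<^sub>R h) / s\<^sup>2) 0 e \<le> M"
        unfolding M_def by (rule cSup_upper) (use Sbd in \<open>auto simp: bdd_above_def\<close>)
      moreover have "sdiff (\<lambda>h. ?U (s *\<^sub>R h) / s\<^sup>2) 0 e = sdiff U x (s *\<^sub>R e) / s\<^sup>2"
        using sdiff_rescale[of ?U s "s\<^sup>2" 0 e] sdiff_shift[of U x 0 "s *\<^sub>R e"] by simp
      ultimately have "sdiff U x (s *\<^sub>R e) / s\<^sup>2 \<le> M" by simp
      then show ?thesis using that by (simp add: field_simps)
    qed
    consider "s > 0" | "s = 0" | "s < 0" by linarith
    then show ?thesis
    proof cases
      case 3
      then show ?thesis using pos[of "-s"] sdiff_minus_right[of U x "s *\<^sub>R e"] by simp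
    qed (use pos in \<open>auto simp: sdiff_def\<close>)
  qed
  \<comment> \<open>The deficit of \<open>U\<close> on the line through \<open>x\<close> against the
    extremal parabola. By \<open>up\<close> its second differences are nonnegative, so it is convex;
    convexity carries near-equality from large steps to small ones.\<close>
  define c where "c U x t = M / 2 * t\<^sup>2 - U (x + t *\<^sub>R e)" for U :: "'a \<Rightarrow> real" and x t
  have sc: "sdiff (c U x) t s = M * s\<^sup>2 - sdiff U (x + t *\<^sub>R e) (s *\<^sub>R e)" for U x t s
    unfolding c_def sdiff_def by (simp add: algebra_simps power2_eq_square)
  have convc: "convex_on UNIV (c U x)" if UV: "(U, V) \<in> X" for U V x
  proof (rule midpoint_convex_imp_convex)
    have "continuous_on UNIV U" using ct UV unfolding controlled_def by (blast intro: semiconvex_imp_continuous)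
    then have "continuous_on UNIV (\<lambda>t. U (x + t *\<^sub>R e))"
      by (rule continuous_on_compose2) (auto intro!: continuous_intros)
    then show "continuous_on UNIV (c U x)" unfolding c_def by (intro continuous_intros)
    show "0 \<le> sdiff (c U x) t s" for t s unfolding sc using up[OF UV] by simp
  qed
  \<comment> \<open>The error is cubic because the rescaling below multiplies it by
    \<open>(real (Suc n))\<^sup>2\<close>, so that \<open>1 / real (Suc n)\<close> remains.\<close>
  have "\<exists>U V. (U, V) \<in> X \<and> sdiff U 0 e > M - 1 / real (Suc n) ^ 3" for n
  proof -
    have "M - 1 / real (Suc n) ^ 3 < Sup S" unfolding M_def by simp
    then obtain s where "s \<in> S" "M - 1 / real (Suc n) ^ 3 < s" using less_cSupE[OF _ Sne] by blast
    then show ?thesis unfolding S_def by auto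
  qed
  then obtain u v where uv: "\<And>n. (u n, v n) \<in> X" "\<And>n. sdiff (u n) 0 e > M - 1 / real (Suc n) ^ 3" by metis
  define r where "r n = 1 / real (Suc n)" for n
  have r: "r n > 0" for n by (simp add: r_def)
  define u' where "u' n = (\<lambda>h. u n (r n *\<^sub>R h) / (r n)\<^sup>2)" for n
  define v' where "v' n = (\<lambda>h. v n (r n *\<^sub>R h) / (r n)\<^sup>2)" for n
  have uv': "(u' n, v' n) \<in> X" for n
    using cl uv(1)[of n] r[of n] unfolding blowup_closed_def u'_def v'_def by blast
  have big: "sdiff (u' n) 0 (real (Suc n) *\<^sub>R e) \<ge> M * (real (Suc n))\<^sup>2 - 1 / real (Suc n)" for n
  proof -
    have "sdiff (u' n) 0 (real (Suc n) *\<^sub>R e) = sdiff (u n) 0 e * (real (Suc n))\<^sup>2"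
      unfolding u'_def sdiff_rescale by (simp add: r_def power_divide)
    also have "\<dots> \<ge> (M - 1 / real (Suc n) ^ 3) * (real (Suc n))\<^sup>2"
      using uv(2)[of n] by (intro mult_right_mono) auto
    also have "(M - 1 / real (Suc n) ^ 3) * (real (Suc n))\<^sup>2 = M * (real (Suc n))\<^sup>2 - 1 / real (Suc n)"
      by (simp add: left_diff_distrib power2_eq_square power3_eq_cube)
    finally show ?thesis .
  qed
  \<comment> \<open>Second differences of the convex deficit grow with the step, so its smallness at
    step \<open>real (Suc n)\<close> is inherited by every shorter step.\<close>
  have near: "sdiff (u' n) 0 (s *\<^sub>R e) \<ge> M * s\<^sup>2 - 1 / real (Suc n)" if "0 \<le> s" "s \<le> real (Suc n)" for n s
    using convex_sdiff_mono[OF convc[OF uv'[of n], of 0] that, of 0] big[of n] unfolding sc by simp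
  obtain G U V where G: "G \<noteq> bot" "G \<le> sequentially" and UV: "(U, V) \<in> X"
    and lim: "\<And>x h. ((\<lambda>n. sdiff (u' n) x h) \<longlongrightarrow> sdiff U x h) G"
    using blowup_cluster[of X L u' v', OF cl ct uv'] by blast
  have axis: "sdiff U 0 (s *\<^sub>R e) = M * s\<^sup>2" if "0 \<le> s" for s
  proof (rule antisym[OF up[OF UV]])
    have "((\<lambda>n. M * s\<^sup>2 - 1 / real (Suc n)) \<longlongrightarrow> M * s\<^sup>2 - 0) G"
      by (rule tendsto_mono[OF G(2)]) (intro tendsto_intros LIMSEQ_Suc[OF lim_1_over_n])
    moreover have "eventually (\<lambda>n. s \<le> real (Suc n)) sequentially"
      using eventually_ge_at_top[of "nat \<lceil>s\<rceil>"] by eventually_elim linarith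
    then have "eventually (\<lambda>n. M * s\<^sup>2 - 1 / real (Suc n) \<le> sdiff (u' n) 0 (s *\<^sub>R e)) G"
      using near[OF that] by (intro filter_leD[OF G(2)]) (auto elim: eventually_mono)
    ultimately show "M * s\<^sup>2 \<le> sdiff U 0 (s *\<^sub>R e)"
      using tendsto_le[OF G(1) lim] by fastforce
  qed
  obtain p where p: "\<And>t. c U 0 t \<ge> c U 0 0 + p \<bullet> (t - 0)"
    using convex_subgradient[OF convc[OF UV, of 0], of 0] by blast
  \<comment> \<open>The deficit lies above its supporting line at \<open>t\<close> and at
    \<open>- t\<close>; a vanishing second difference forces equality at both.\<close>
  have lin: "c U 0 t = c U 0 0 + p * t" if "t \<ge> 0" for t
  proof -
    have "sdiff (c U 0) 0 t = 0" unfolding sc using axis[OF that] by simp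
    then show ?thesis using p[of t] p[of "-t"] by (simp add: sdiff_def)
  qed
  have mixed: "\<bar>U (z + x + y) - U (z + x) - U (z + y) + U z\<bar> \<le> L / 2 * (x \<bullet> x + y \<bullet> y)" for x y z
  proof -
    have *: "\<bar>sdiff U w ((1/2) *\<^sub>R k)\<bar> \<le> L / 4 * (k \<bullet> k)" for w k
      using controlled_sdiff_bounds(1)[OF ct UV, of w "(1/2) *\<^sub>R k"] by simp
    have "\<bar>U (z + x + y) - U (z + x) - U (z + y) + U z\<bar> \<le> L / 4 * ((x + y) \<bullet> (x + y)) + L / 4 * ((x - y) \<bullet> (x - y))"
      unfolding mixed_difference_eq
      using *[of "z + (1/2) *\<^sub>R (x + y)" "x + y"] *[of "z + (1/2) *\<^sub>R (x + y)" "x - y"]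
      by linarith
    also have "\<dots> = L / 2 * (x \<bullet> x + y \<bullet> y)" by (simp add: inner_simps algebra_simps inner_commute)
    finally show ?thesis .
  qed
  \<comment> \<open>Along the line through \<open>x\<close> the slopes \<open>a\<close> of the
    convex deficit over unit steps increase. By \<open>mixed\<close> they stay within a bounded
    distance of the slope \<open>p\<close> on the axis, so they converge, and their increments, the
    defects from \<open>M\<close>, tend to zero.\<close>
  have flat: "(\<lambda>n. sdiff U (x + real (Suc n) *\<^sub>R e) e) \<longlonglongrightarrow> M" for x
  proof -
    define a where "a n = c U x (real (Suc n)) - c U x (real n)" for n
    have a_step: "a (Suc n) - a n = M - sdiff U (x + real (Suc n) *\<^sub>R e) e" for n
    proof -
      have "a (Suc n) - a n = sdiff (c U x) (real (Suc n)) 1"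
        unfolding a_def sdiff_def by (simp add: algebra_simps)
      then show ?thesis unfolding sc by simp
    qed
    have "incseq a"
    proof (rule incseq_SucI)
      show "a n \<le> a (Suc n)" for n
        using up[OF UV, of "x + real (Suc n) *\<^sub>R e" 1] a_step[of n] by simp
    qed
    moreover have "a n \<le> p + L / 2 * (x \<bullet> x + 1)" for n
    proof -
      have "c U x (real (Suc n)) - c U x (real n) - (c U 0 (real (Suc n)) - c U 0 (real n)) \<le> L / 2 * (x \<bullet> x + 1)"
      proof -
        let ?y = "real n *\<^sub>R e"
        have "c U x (real (Suc n)) - c U x (real n) - (c U 0 (real (Suc n)) - c U 0 (real n))
            = - (U (?y + x + e) - U (?y + x) - U (?y + e) + U ?y)"
          unfolding c_def by (simp add: algebra_simps)
        then show ?thesis using mixed[of ?y x e] unfolding ee by linarith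
      qed
      moreover have "c U 0 (real (Suc n)) - c U 0 (real n) = p"
        using lin[of "real n"] lin[of "real (Suc n)"] by (simp add: algebra_simps)
      ultimately show ?thesis unfolding a_def by linarith
    qed
    ultimately obtain l where "a \<longlonglongrightarrow> l" using incseq_convergent by blast
    then have "(\<lambda>n. M - (a (Suc n) - a n)) \<longlonglongrightarrow> M - (l - l)"
      by (intro tendsto_intros LIMSEQ_Suc)
    then show ?thesis unfolding a_step by simp
  qed
  define w where "w n = (\<lambda>h. U (h + real (Suc n) *\<^sub>R e))" for n
  define w' where "w' n = (\<lambda>h. V (h + real (Suc n) *\<^sub>R e))" for n
  have ww': "(w n, w' n) \<in> X" for n using cl UV unfolding blowup_closed_def w_def w'_def by blast
  obtain G2 U2 V2 where G2: "G2 \<noteq> bot" "G2 \<le> sequentially" and UV2: "(U2, V2) \<in> X"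
    and lim2: "\<And>x h. ((\<lambda>n. sdiff (w n) x h) \<longlongrightarrow> sdiff U2 x h) G2"
    using blowup_cluster[of X L w w', OF cl ct ww'] by blast
  have full: "sdiff U2 x e = M" for x
  proof (rule tendsto_unique[OF G2(1) lim2])
    show "((\<lambda>n. sdiff (w n) x e) \<longlongrightarrow> M) G2"
      using tendsto_mono[OF G2(2) flat[of x]] unfolding w_def sdiff_shift .
  qed
  have full_s: "sdiff U2 x (s *\<^sub>R e) = M * s\<^sup>2" if "\<bar>s\<bar> \<le> 1" for x s
  proof -
    have *: "sdiff U2 x (s *\<^sub>R e) = M * s\<^sup>2" if "0 \<le> s" "s \<le> 1" for s
    proof (rule antisym[OF up[OF UV2]])
      have "sdiff (c U2 x) 0 1 = 0" unfolding sc using full by simp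
      then show "M * s\<^sup>2 \<le> sdiff U2 x (s *\<^sub>R e)"
        using convex_sdiff_mono[OF convc[OF UV2, of x] that, of 0] unfolding sc by simp
    qed
    show ?thesis
    proof (cases "s \<ge> 0")
      case False
      then show ?thesis using *[of "-s"] that sdiff_minus_right[of U2 x "s *\<^sub>R e"] by simp
    qed (use * that in auto)
  qed
  \<comment> \<open>Second differences in the directions \<open>h\<close> and
    \<open>s *\<^sub>R e\<close> commute, and the latter are the same constant everywhere. Hence
    \<open>q\<close> has zero second difference in \<open>n\<close>; being affine in
    \<open>n\<close> and bounded, it is constant.\<close>
  have short: "sdiff U2 (x + s *\<^sub>R e) h = sdiff U2 x h" if s: "\<bar>s\<bar> \<le> 1" for x s h
  proof -
    define q where "q n = sdiff U2 (x + (real n * s) *\<^sub>R e) h" for n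
    have rec: "q (Suc (Suc n)) - 2 * q (Suc n) + q n = 0" for n
    proof -
      define k where "k = s *\<^sub>R e"
      let ?y = "x + (real (Suc n) * s) *\<^sub>R e"
      have "real (Suc (Suc n)) * s = real (Suc n) * s + s" "real n * s = real (Suc n) * s - s"
        by (simp_all add: algebra_simps)
      then have "x + (real (Suc (Suc n)) * s) *\<^sub>R e = ?y + k" "x + (real n * s) *\<^sub>R e = ?y - k"
        unfolding k_def by (simp_all only: scaleR_left_distrib scaleR_left_diff_distrib) simp_all
      then have "q (Suc (Suc n)) - 2 * q (Suc n) + q n =
          sdiff U2 (?y + h) k + sdiff U2 (?y - h) k - 2 * sdiff U2 ?y k"
        unfolding q_def sdiff_def by (simp add: add.commute add.left_commute diff_add_eq add_diff_eq diff_diff_eq)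
      then show ?thesis unfolding k_def full_s[OF s] by simp
    qed
    have "q n = q 0 + real n * (q 1 - q 0) \<and> q (Suc n) = q 0 + real (Suc n) * (q 1 - q 0)" for n
    proof (induction n)
      case (Suc n)
      then show ?case using rec[of n] by (simp add: algebra_simps)
    qed simp
    then have q: "real n * (q 1 - q 0) = q n - q 0" for n by (metis add_diff_cancel_left')
    have qb: "\<bar>q n\<bar> \<le> L * (h \<bullet> h)" for n unfolding q_def by (rule controlled_sdiff_bounds(1)[OF ct UV2])
    have "q 1 - q 0 = 0"
    proof (rule ccontr)
      assume "q 1 - q 0 \<noteq> 0"
      then obtain n where "2 * (L * (h \<bullet> h)) < real n * \<bar>q 1 - q 0\<bar>"
        using reals_Archimedean3[of "\<bar>q 1 - q 0\<bar>"] by (auto simp: zero_less_abs_iff)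
      also have "\<dots> = \<bar>q n - q 0\<bar>" using q[of n] by (metis abs_mult abs_of_nat)
      also have "\<dots> \<le> 2 * (L * (h \<bullet> h))" using qb[of n] qb[of 0] by linarith
      finally show False by simp
    qed
    then show ?thesis unfolding q_def by simp
  qed
  have "sdiff U2 (x + t *\<^sub>R e) h = sdiff U2 x h" for x t h
  proof -
    define n where "n = nat \<lceil>\<bar>t\<bar>\<rceil> + 1"
    have n: "n > 0" "\<bar>t\<bar> \<le> real n" unfolding n_def by linarith+
    have *: "sdiff U2 (x + (real k * (t / real n)) *\<^sub>R e) h = sdiff U2 x h" for k
    proof (induction k)
      case (Suc k)
      have "x + (real (Suc k) * (t / real n)) *\<^sub>R e = (x + (real k * (t / real n)) *\<^sub>R e) + (t / real n) *\<^sub>R e"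
        by (simp add: algebra_simps add_divide_distrib)
      moreover have "\<bar>t / real n\<bar> \<le> 1" using n by (simp add: field_simps)
      ultimately show ?case using short[of "t / real n" "x + (real k * (t / real n)) *\<^sub>R e" h] Suc
        by (simp only:)
    qed simp
    show ?thesis using *[of n] n by simp
  qed
  then show ?thesis using UV2 by blast
qed

text \<open>Pairs already invariant in some coordinate directions form a class \<open>Y\<close> that
  is again closed and controlled, so extremality can be exploited inside \<open>Y\<close> for the
  next direction without losing the previous ones.\<close>

lemma blowup_quadratic:
  fixes X :: "(('a::euclidean_space \<Rightarrow> real) \<times> ('a \<Rightarrow> real)) set"
  assumes cl: "blowup_closed X" and ct: "controlled L X" and ne: "X \<noteq> {}"
  shows "\<exists>U V a p T. (U, V) \<in> X \<and> linear T \<and> (\<forall>x y. T x \<bullet> y = x \<bullet> T y) \<and>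
           (\<forall>x. U x = a + p \<bullet> x + 1/2 * (T x \<bullet> x))"
proof -
  have "\<exists>U V. (U, V) \<in> X \<and> (\<forall>e\<in>S. \<forall>x t h. sdiff U (x + t *\<^sub>R e) h = sdiff U x h)"
    if "finite S" "S \<subseteq> Basis" for S
    using that
  proof (induction S rule: finite_induct)
    case empty
    then show ?case using ne by auto
  next
    case (insert e S)
    define Y where "Y = {(U, V) \<in> X. \<forall>e\<in>S. \<forall>x t h. sdiff U (x + t *\<^sub>R e) h = sdiff U x h}"
    have "Y \<noteq> {}" using insert unfolding Y_def by blast
    moreover have "controlled L Y" using ct unfolding controlled_def Y_def by blast
    moreover have "blowup_closed Y"
      unfolding blowup_closed_def
    proof (intro conjI allI impI)
      fix U V :: "'a \<Rightarrow> real" and a b a' b' assume "(U, V) \<in> Y"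
      then show "((\<lambda>h. U h + a + b \<bullet> h), (\<lambda>h. V h + a' + b' \<bullet> h)) \<in> Y"
        using cl unfolding Y_def blowup_closed_def by (simp add: sdiff_add_affine)
    next
      fix U V :: "'a \<Rightarrow> real" and y assume UV: "(U, V) \<in> Y"
      have "sdiff U (x + t *\<^sub>R e + y) h = sdiff U (x + y) h" if "e \<in> S" for e x t h
      proof -
        have "x + t *\<^sub>R e + y = (x + y) + t *\<^sub>R e" by simp
        moreover have "sdiff U ((x + y) + t *\<^sub>R e) h = sdiff U (x + y) h"
          using UV that unfolding Y_def by blast
        ultimately show ?thesis by (simp only:)
      qed
      moreover have "((\<lambda>h. U (h + y)), (\<lambda>h. V (h + y))) \<in> X"
        using UV cl unfolding Y_def blowup_closed_def by blast
      ultimately show "((\<lambda>h. U (h + y)), (\<lambda>h. V (h + y))) \<in> Y"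
        unfolding Y_def by (simp add: sdiff_shift)
    next
      fix U V :: "'a \<Rightarrow> real" and r :: real assume UV: "(U, V) \<in> Y" and r: "0 < r"
      have "sdiff U (r *\<^sub>R x + (r * t) *\<^sub>R e) h = sdiff U (r *\<^sub>R x) h" if "e \<in> S" for e x t h
        using UV that unfolding Y_def by blast
      moreover have "((\<lambda>h. U (r *\<^sub>R h) / r\<^sup>2), (\<lambda>h. V (r *\<^sub>R h) / r\<^sup>2)) \<in> X"
        using UV cl r unfolding Y_def blowup_closed_def by blast
      ultimately show "((\<lambda>h. U (r *\<^sub>R h) / r\<^sup>2), (\<lambda>h. V (r *\<^sub>R h) / r\<^sup>2)) \<in> Y"
        unfolding Y_def by (simp add: sdiff_rescale scaleR_add_right)
    next
      fix F :: "nat filter" and u v :: "nat \<Rightarrow> 'a \<Rightarrow> real" and U V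
      assume F: "F \<noteq> bot" and uv: "\<forall>n. (u n, v n) \<in> Y"
        and U: "\<forall>x. ((\<lambda>n. u n x) \<longlongrightarrow> U x) F" and V: "\<forall>x. ((\<lambda>n. v n x) \<longlongrightarrow> V x) F"
      have "\<forall>n. (u n, v n) \<in> X" using uv unfolding Y_def by blast
      then have "(U, V) \<in> X" using cl F U V unfolding blowup_closed_def by meson
      moreover have "sdiff U (x + t *\<^sub>R e) h = sdiff U x h" if "e \<in> S" for e x t h
      proof (rule tendsto_unique[OF F])
        show "((\<lambda>n. sdiff (u n) x h) \<longlongrightarrow> sdiff U x h) F"
          unfolding sdiff_def by (intro tendsto_intros U[rule_format])
        have "sdiff (u n) (x + t *\<^sub>R e) h = sdiff (u n) x h" for n using uv that unfolding Y_def by blast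
        moreover have "((\<lambda>n. sdiff (u n) (x + t *\<^sub>R e) h) \<longlongrightarrow> sdiff U (x + t *\<^sub>R e) h) F"
          unfolding sdiff_def by (intro tendsto_intros U[rule_format])
        ultimately show "((\<lambda>n. sdiff (u n) x h) \<longlongrightarrow> sdiff U (x + t *\<^sub>R e) h) F" by simp
      qed
      ultimately show "(U, V) \<in> Y" unfolding Y_def by simp
    qed
    ultimately obtain U V where "(U, V) \<in> Y" "\<forall>x t h. sdiff U (x + t *\<^sub>R e) h = sdiff U x h"
      using blowup_invariant_direction[of Y L e] insert.prems by (auto simp: norm_Basis)
    then show ?case unfolding Y_def by auto
  qed
  from this[OF finite_Basis order_refl] obtain U V where UV: "(U, V) \<in> X"
    and inv: "\<And>e x t h. e \<in> Basis \<Longrightarrow> sdiff U (x + t *\<^sub>R e) h = sdiff U x h" by blast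
  have "sdiff U x h = sdiff U 0 h" for x h
  proof -
    have "sdiff U (\<Sum>i\<in>S. (x \<bullet> i) *\<^sub>R i) h = sdiff U 0 h" if "finite S" "S \<subseteq> Basis" for S
      using that
    proof (induction S rule: finite_induct)
      case (insert e S)
      then show ?case using inv[of e "\<Sum>i\<in>S. (x \<bullet> i) *\<^sub>R i" "x \<bullet> e" h] by (simp add: add.commute)
    qed simp
    from this[OF finite_Basis order_refl] show ?thesis by (simp add: euclidean_representation)
  qed
  moreover have "continuous_on UNIV U"
    using ct UV unfolding controlled_def by (blast intro: semiconvex_imp_continuous)
  ultimately show ?thesis using UV quadratic_if_sdiff_invariant[of U] by blast
qed

section \<open>Blow-ups of semiconvex functions\<close>

text \<open>The identity for \<open>(1 - t)|x|^2 + t|y|^2 - |(1 - t)x + ty|^2\<close> removes the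
  added paraboloid. In this form the condition passes directly to affine perturbations, dilations
  and pointwise limits.\<close>

lemma semiconvex_iff:
  fixes f :: "'a::euclidean_space \<Rightarrow> real"
  shows "semiconvex L f \<longleftrightarrow> (\<forall>x y t. 0 \<le> t \<longrightarrow> t \<le> 1 \<longrightarrow>
    f ((1 - t) *\<^sub>R x + t *\<^sub>R y) \<le> (1 - t) * f x + t * f y + L / 2 * (t * (1 - t) * ((x - y) \<bullet> (x - y))))"
proof -
  let ?F = "\<lambda>x. f x + L / 2 * (x \<bullet> x)"
  have *: "(1 - t) * (x \<bullet> x) + t * (y \<bullet> y) - ((1 - t) *\<^sub>R x + t *\<^sub>R y) \<bullet> ((1 - t) *\<^sub>R x + t *\<^sub>R y)
      = t * (1 - t) * ((x - y) \<bullet> (x - y))" for x y :: 'a and t :: real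
    by (simp add: inner_simps inner_commute algebra_simps)
  have eq: "(1 - t) * ?F x + t * ?F y - ?F ((1 - t) *\<^sub>R x + t *\<^sub>R y) =
      (1 - t) * f x + t * f y + L / 2 * (t * (1 - t) * ((x - y) \<bullet> (x - y))) - f ((1 - t) *\<^sub>R x + t *\<^sub>R y)" for x y t
  proof -
    have "(1 - t) * (p + L / 2 * A) + t * (q + L / 2 * B) - (r + L / 2 * C) =
      (1 - t) * p + t * q + L / 2 * ((1 - t) * A + t * B - C) - r" for p q r A B C
      by (simp add: field_simps)
    then show ?thesis unfolding *[symmetric] .
  qed
  show ?thesis
  proof
    assume "semiconvex L f"
    then have F: "convex_on UNIV ?F" unfolding semiconvex_def .
    show "\<forall>x y t. 0 \<le> t \<longrightarrow> t \<le> 1 \<longrightarrow>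
      f ((1 - t) *\<^sub>R x + t *\<^sub>R y) \<le> (1 - t) * f x + t * f y + L / 2 * (t * (1 - t) * ((x - y) \<bullet> (x - y)))"
    proof (intro allI impI)
      fix x y :: 'a and t :: real assume "0 \<le> t" "t \<le> 1"
      then show "f ((1 - t) *\<^sub>R x + t *\<^sub>R y) \<le> (1 - t) * f x + t * f y + L / 2 * (t * (1 - t) * ((x - y) \<bullet> (x - y)))"
        using convex_onD[OF F, of t x y] eq[of t x y] by simp
    qed
  next
    assume r: "\<forall>x y t. 0 \<le> t \<longrightarrow> t \<le> 1 \<longrightarrow>
      f ((1 - t) *\<^sub>R x + t *\<^sub>R y) \<le> (1 - t) * f x + t * f y + L / 2 * (t * (1 - t) * ((x - y) \<bullet> (x - y)))"
    show "semiconvex L f" unfolding semiconvex_def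
    proof (rule convex_onI)
      fix x y :: 'a and t :: real assume "0 < t" "t < 1"
      then show "?F ((1 - t) *\<^sub>R x + t *\<^sub>R y) \<le> (1 - t) * ?F x + t * ?F y"
        using r[rule_format, of t x y] eq[of t x y] by simp
    qed simp
  qed
qed

lemma semiconvex_add_affine:
  fixes f :: "'a::euclidean_space \<Rightarrow> real"
  assumes "semiconvex L f"
  shows "semiconvex L (\<lambda>h. f h + a + b \<bullet> h)"
  unfolding semiconvex_iff
proof (intro allI impI)
  fix x y :: 'a and t :: real assume "0 \<le> t" "t \<le> 1"
  then have "f ((1 - t) *\<^sub>R x + t *\<^sub>R y) \<le> (1 - t) * f x + t * f y + L / 2 * (t * (1 - t) * ((x - y) \<bullet> (x - y)))"
    using assms unfolding semiconvex_iff by blast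
  moreover have "a + b \<bullet> ((1 - t) *\<^sub>R x + t *\<^sub>R y) = (1 - t) * (a + b \<bullet> x) + t * (a + b \<bullet> y)"
    by (simp add: inner_simps algebra_simps)
  ultimately show "f ((1 - t) *\<^sub>R x + t *\<^sub>R y) + a + b \<bullet> ((1 - t) *\<^sub>R x + t *\<^sub>R y) \<le>
      (1 - t) * (f x + a + b \<bullet> x) + t * (f y + a + b \<bullet> y) + L / 2 * (t * (1 - t) * ((x - y) \<bullet> (x - y)))"
    by (simp add: algebra_simps)
qed

lemma semiconvex_rescale:
  fixes f :: "'a::euclidean_space \<Rightarrow> real"
  assumes "semiconvex L f" and r: "r > 0"
  shows "semiconvex L (\<lambda>h. f (c + r *\<^sub>R h) / r\<^sup>2)"
  unfolding semiconvex_iff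
proof (intro allI impI)
  fix x y :: 'a and t :: real assume "0 \<le> t" "t \<le> 1"
  then have "f ((1 - t) *\<^sub>R (c + r *\<^sub>R x) + t *\<^sub>R (c + r *\<^sub>R y)) \<le> (1 - t) * f (c + r *\<^sub>R x) + t * f (c + r *\<^sub>R y)
      + L / 2 * (t * (1 - t) * (((c + r *\<^sub>R x) - (c + r *\<^sub>R y)) \<bullet> ((c + r *\<^sub>R x) - (c + r *\<^sub>R y))))"
    using assms unfolding semiconvex_iff by blast
  moreover have "(1 - t) *\<^sub>R (c + r *\<^sub>R x) + t *\<^sub>R (c + r *\<^sub>R y) = c + r *\<^sub>R ((1 - t) *\<^sub>R x + t *\<^sub>R y)"
    by (simp add: algebra_simps)
  moreover have "((c + r *\<^sub>R x) - (c + r *\<^sub>R y)) \<bullet> ((c + r *\<^sub>R x) - (c + r *\<^sub>R y)) = r\<^sup>2 * ((x - y) \<bullet> (x - y))"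
  proof -
    have "(c + r *\<^sub>R x) - (c + r *\<^sub>R y) = r *\<^sub>R (x - y)" by (simp add: algebra_simps)
    then show ?thesis by (simp add: power2_eq_square)
  qed
  ultimately have "f (c + r *\<^sub>R ((1 - t) *\<^sub>R x + t *\<^sub>R y)) / r\<^sup>2 \<le> ((1 - t) * f (c + r *\<^sub>R x) + t * f (c + r *\<^sub>R y)
      + L / 2 * (t * (1 - t) * (r\<^sup>2 * ((x - y) \<bullet> (x - y))))) / r\<^sup>2"
    by (simp add: divide_right_mono)
  then show "f (c + r *\<^sub>R ((1 - t) *\<^sub>R x + t *\<^sub>R y)) / r\<^sup>2 \<le>
      (1 - t) * (f (c + r *\<^sub>R x) / r\<^sup>2) + t * (f (c + r *\<^sub>R y) / r\<^sup>2) + L / 2 * (t * (1 - t) * ((x - y) \<bullet> (x - y)))"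
    using r by (simp add: add_divide_distrib)
qed

lemma semiconvex_limit:
  fixes u :: "'i \<Rightarrow> 'a::euclidean_space \<Rightarrow> real"
  assumes F: "F \<noteq> bot" and u: "\<And>i. semiconvex L (u i)" and lim: "\<And>x. ((\<lambda>i. u i x) \<longlongrightarrow> U x) F"
  shows "semiconvex L U"
  unfolding semiconvex_iff
proof (intro allI impI)
  fix x y :: 'a and t :: real assume t: "0 \<le> t" "t \<le> 1"
  show "U ((1 - t) *\<^sub>R x + t *\<^sub>R y) \<le> (1 - t) * U x + t * U y + L / 2 * (t * (1 - t) * ((x - y) \<bullet> (x - y)))"
  proof (rule tendsto_le[OF F _ lim])
    show "((\<lambda>i. (1 - t) * u i x + t * u i y + L / 2 * (t * (1 - t) * ((x - y) \<bullet> (x - y)))) \<longlongrightarrow>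
        (1 - t) * U x + t * U y + L / 2 * (t * (1 - t) * ((x - y) \<bullet> (x - y)))) F"
      by (intro tendsto_intros lim)
    show "eventually (\<lambda>i. u i ((1 - t) *\<^sub>R x + t *\<^sub>R y) \<le>
        (1 - t) * u i x + t * u i y + L / 2 * (t * (1 - t) * ((x - y) \<bullet> (x - y)))) F"
      using u t unfolding semiconvex_iff by (intro always_eventually) blast
  qed
qed

lemma concave_iff_semiconvex:
  fixes f :: "'a::euclidean_space \<Rightarrow> real"
  shows "concave_on UNIV f \<longleftrightarrow> semiconvex 0 (\<lambda>x. - f x)"
  by (simp add: concave_on_def semiconvex_def)

text \<open>Lebesgue density at a single point of \<open>K\<close>; the copies are centred at points of \<open>K\<close> close
  to the centres of one-sided cubes at that point.\<close>

lemma compact_positive_measure_blowup_dense: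
  fixes K :: "'a::euclidean_space set"
  assumes K: "compact K" and pos: "\<not> negligible K"
  shows "\<exists>(c :: nat \<Rightarrow> 'a) r. (\<forall>n. c n \<in> K \<and> r n > 0) \<and> r \<longlonglongrightarrow> 0 \<and>
    (\<forall>y \<delta>. \<delta> > 0 \<longrightarrow> eventually (\<lambda>n. \<exists>k\<in>K. norm (k - (c n + r n *\<^sub>R y)) \<le> \<delta> * r n) sequentially)"
proof -
  have Km: "K \<in> lmeasurable" by (rule lmeasurable_compact[OF K])
  have Kb: "K \<inter> cbox a b \<in> lmeasurable" for a b using K by (intro lmeasurable_compact compact_Int_closed) auto
  obtain N where N: "negligible N" and dens: "\<And>x e. \<lbrakk>x \<notin> N; 0 < e\<rbrakk> \<Longrightarrow>
      \<exists>d>0. \<forall>h. 0 < h \<and> h < d \<longrightarrow>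
        norm (integral (cbox x (x + h *\<^sub>R One)) (indicat_real K) /\<^sub>R h ^ DIM('a) - indicat_real K x) < e"
    using integrable_ccontinuous_explicit[of "indicat_real K"] Kb by (auto simp: integrable_on_indicator)
  have "\<not> K \<subseteq> N" using N pos negligible_subset by blast
  then obtain x where x: "x \<in> K" "x \<notin> N" by blast
  define m where "m n = real n + 2" for n :: nat
  have m: "m n \<ge> 2" for n by (simp add: m_def)
  \<comment> \<open>The tolerated loss of measure is exactly the volume of a subcube of side
    \<open>h / (m n)\<^sup>2\<close>, so no such subcube can miss \<open>K\<close>.\<close>
  have "\<exists>d>0. \<forall>h. 0 < h \<and> h < d \<longrightarrow> measure lebesgue (K \<inter> cbox x (x + h *\<^sub>R One)) >
      (1 - (1 / (m n)\<^sup>2) ^ DIM('a)) * h ^ DIM('a)" for n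
  proof -
    have "0 < (1 / (m n)\<^sup>2) ^ DIM('a)" using m[of n] by simp
    from dens[OF x(2) this] obtain d where d: "d > 0" and *: "\<And>h. 0 < h \<and> h < d \<Longrightarrow>
        norm (integral (cbox x (x + h *\<^sub>R One)) (indicat_real K) /\<^sub>R h ^ DIM('a) - 1) < (1 / (m n)\<^sup>2) ^ DIM('a)"
      using x(1) by auto
    have "measure lebesgue (K \<inter> cbox x (x + h *\<^sub>R One)) > (1 - (1 / (m n)\<^sup>2) ^ DIM('a)) * h ^ DIM('a)"
      if "0 < h \<and> h < d" for h
    proof -
      have "integral (cbox x (x + h *\<^sub>R One)) (indicat_real K) = measure lebesgue (K \<inter> cbox x (x + h *\<^sub>R One))"
        by (rule integral_indicator[OF Kb])
      then have "\<bar>measure lebesgue (K \<inter> cbox x (x + h *\<^sub>R One)) / h ^ DIM('a) - 1\<bar> < (1 / (m n)\<^sup>2) ^ DIM('a)"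
        using *[OF that] by (simp add: divide_inverse mult.commute)
      then have "1 - (1 / (m n)\<^sup>2) ^ DIM('a) < measure lebesgue (K \<inter> cbox x (x + h *\<^sub>R One)) / h ^ DIM('a)" by linarith
      then show ?thesis using that by (simp add: pos_less_divide_eq)
    qed
    then show ?thesis using d by blast
  qed
  then obtain d where d: "\<And>n. d n > 0" and dK: "\<And>n h. 0 < h \<Longrightarrow> h < d n \<Longrightarrow>
      measure lebesgue (K \<inter> cbox x (x + h *\<^sub>R One)) > (1 - (1 / (m n)\<^sup>2) ^ DIM('a)) * h ^ DIM('a)"
    by metis
  define h where "h n = min (d n / 2) 1" for n
  have h: "0 < h n" "h n < d n" "h n \<le> 1" for n using d[of n] by (auto simp: h_def)
  define s where "s n = h n / (m n)\<^sup>2" for n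
  have s: "s n > 0" for n using h[of n] m[of n] by (simp add: s_def)
  have hit: "\<exists>k\<in>K. norm (k - w) \<le> s n * DIM('a)"
    if w: "\<And>i. i \<in> Basis \<Longrightarrow> x \<bullet> i \<le> w \<bullet> i \<and> w \<bullet> i + s n \<le> x \<bullet> i + h n" for n w
  proof -
    let ?Q = "cbox x (x + h n *\<^sub>R One)" and ?P = "cbox w (w + s n *\<^sub>R One)"
    have "K \<inter> ?P \<noteq> {}"
    proof
      assume em: "K \<inter> ?P = {}"
      have PQ: "?P \<subseteq> ?Q"
      proof
        fix z assume "z \<in> ?P"
        then have "w \<bullet> i \<le> z \<bullet> i \<and> z \<bullet> i \<le> w \<bullet> i + s n" if "i \<in> Basis" for i
          using that by (simp add: mem_box inner_simps)
        then show "z \<in> ?Q" using w by (fastforce simp: mem_box inner_simps)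
      qed
      have "measure lebesgue (K \<inter> ?Q) + measure lebesgue ?P = measure lebesgue ((K \<inter> ?Q) \<union> ?P)"
      proof -
        have "(K \<inter> ?Q) \<inter> ?P = {}" using em by blast
        then show ?thesis using measure_Un3[of "K \<inter> ?Q" lebesgue ?P] Kb by simp
      qed
      also have "\<dots> \<le> measure lebesgue ?Q"
        using PQ Kb by (intro measure_mono_fmeasurable) (auto simp: fmeasurableD)
      finally have "measure lebesgue (K \<inter> ?Q) + s n ^ DIM('a) \<le> h n ^ DIM('a)"
        using content_cbox_plus[of w "s n"] content_cbox_plus[of x "h n"] s[of n] h[of n] by simp
      moreover have "s n ^ DIM('a) = (1 / (m n)\<^sup>2) ^ DIM('a) * h n ^ DIM('a)"
        by (simp add: s_def power_divide)
      ultimately show False using dK[OF h(1,2), of n] by (simp add: algebra_simps)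
    qed
    then obtain k where k: "k \<in> K" "k \<in> ?P" by blast
    have "norm (k - w) \<le> (\<Sum>i\<in>Basis. \<bar>(k - w) \<bullet> i\<bar>)" by (rule norm_le_l1)
    also have "\<dots> \<le> (\<Sum>i\<in>(Basis::'a set). s n)"
      using k(2) by (intro sum_mono) (auto simp: mem_box inner_simps abs_le_iff)
    finally show ?thesis using k(1) by (auto simp: mult.commute)
  qed
  define ctr where "ctr n = x + (h n / 2) *\<^sub>R One" for n
  have s4: "s n \<le> h n / 4" for n
  proof -
    have "4 \<le> (m n)\<^sup>2" using power_mono[OF m[of n], of 2] by simp
    then show ?thesis unfolding s_def using h(1)[of n] m[of n] by (intro divide_left_mono) auto
  qed
  have "\<exists>k\<in>K. norm (k - ctr n) \<le> s n * DIM('a)" for n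
  proof (rule hit)
    fix i :: 'a assume "i \<in> Basis"
    then show "x \<bullet> i \<le> ctr n \<bullet> i \<and> ctr n \<bullet> i + s n \<le> x \<bullet> i + h n"
      using h[of n] s4[of n] by (simp add: ctr_def inner_simps)
  qed
  then obtain c where c: "\<And>n. c n \<in> K" "\<And>n. norm (c n - ctr n) \<le> s n * DIM('a)" by metis
  \<comment> \<open>An intermediate scale: the resolution is \<open>s n = r n / m n\<close> and the
    cube has side \<open>h n = m n * r n\<close>. Seen at scale \<open>r n\<close>, the gaps of
    \<open>K\<close> shrink to zero while the cube grows to the whole space.\<close>
  define r where "r n = h n / m n" for n
  have r: "r n > 0" for n using h[of n] m[of n] by (simp add: r_def)
  have sr: "s n = r n / m n" for n by (simp add: s_def r_def power2_eq_square)
  have minf: "filterlim m at_top sequentially"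
    by (rule filterlim_at_top_mono[OF filterlim_real_sequentially]) (simp add: m_def)
  have "r \<longlonglongrightarrow> 0"
  proof (rule tendsto_sandwich[of "\<lambda>_. 0" _ _ "\<lambda>n. 1 / m n"])
    show "(\<lambda>n. 1 / m n) \<longlonglongrightarrow> 0" using tendsto_inverse_0_at_top[OF minf] by (simp add: inverse_eq_divide)
    show "eventually (\<lambda>n. 0 \<le> r n) sequentially" using r by (simp add: less_imp_le)
    show "eventually (\<lambda>n. r n \<le> 1 / m n) sequentially"
      unfolding r_def using h m by (intro always_eventually allI divide_right_mono) (auto intro: order_trans[of 0 2])
  qed simp
  moreover have "eventually (\<lambda>n. \<exists>k\<in>K. norm (k - (c n + r n *\<^sub>R y)) \<le> \<delta> * r n) sequentially" if "\<delta> > 0" for y \<delta>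
  proof -
    let ?D = "real DIM('a)"
    have "eventually (\<lambda>n. m n \<ge> max (?D / \<delta>) (8 * norm y + 8 * ?D)) sequentially"
      using minf unfolding filterlim_at_top by blast
    then show ?thesis
    proof eventually_elim
      case (elim n)
      then have mD: "m n \<ge> ?D / \<delta>" and my: "m n \<ge> 8 * norm y + 8 * ?D" by auto
      have mn: "m n > 0" using m[of n] by linarith
      have hr: "h n = m n * r n" using mn by (simp add: r_def)
      have "\<exists>k\<in>K. norm (k - (c n + r n *\<^sub>R y)) \<le> s n * ?D"
      proof (rule hit)
        fix i :: 'a assume i: "i \<in> Basis"
        have 1: "\<bar>(c n - ctr n) \<bullet> i\<bar> \<le> s n * ?D" using Basis_le_norm[OF i, of "c n - ctr n"] c(2)[of n] by linarith
        have "s n * ?D \<le> r n * ?D" unfolding sr using m[of n] r[of n] by (intro mult_right_mono) (auto simp: field_simps)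
        moreover have "r n * ?D + r n * norm y \<le> h n / 8"
        proof -
          have "r n * (8 * norm y + 8 * ?D) \<le> r n * m n" using my r[of n] by (intro mult_left_mono) auto
          then show ?thesis unfolding hr by (simp add: algebra_simps)
        qed
        moreover have "\<bar>(r n *\<^sub>R y) \<bullet> i\<bar> \<le> r n * norm y"
          using Basis_le_norm[OF i, of "r n *\<^sub>R y"] r[of n] by simp
        moreover have "ctr n \<bullet> i = x \<bullet> i + h n / 2" using i by (simp add: ctr_def inner_simps)
        ultimately show "x \<bullet> i \<le> (c n + r n *\<^sub>R y) \<bullet> i \<and> (c n + r n *\<^sub>R y) \<bullet> i + s n \<le> x \<bullet> i + h n"
          using 1 s4[of n] h(1)[of n] unfolding inner_diff_left inner_add_left by linarith
      qed
      moreover have "s n * ?D \<le> \<delta> * r n"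
      proof -
        have "?D \<le> m n * \<delta>" using mD that by (simp add: pos_divide_le_eq)
        then have "?D * r n \<le> m n * \<delta> * r n" using r[of n] by (intro mult_right_mono) auto
        then show ?thesis unfolding sr using mn by (simp add: field_simps)
      qed
      ultimately show ?case by force
    qed
  qed
  ultimately show ?thesis using c(1) r by blast
qed

section \<open>Blow-up limits of a pair of functions\<close>

text \<open>Closure in the topology of pointwise convergence, spelled out by finite sets
  \<open>E\<close> of test points. Both functions share the centre and the scale but have their own
  affine parts. Centres lie only near \<open>K\<close>, which makes room for translations.\<close>

definition blowups :: "('a::euclidean_space \<Rightarrow> real) \<Rightarrow> ('a \<Rightarrow> real) \<Rightarrow> 'a set \<Rightarrow> (('a \<Rightarrow> real) \<times> ('a \<Rightarrow> real)) set" where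
  "blowups f g K = {(U, V). \<forall>E \<eta>. finite E \<longrightarrow> 0 < \<eta> \<longrightarrow>
     (\<exists>c r a b a' b'. 0 < r \<and> r < \<eta> \<and> (\<exists>k\<in>K. dist c k < \<eta>) \<and>
        (\<forall>h\<in>E. \<bar>f (c + r *\<^sub>R h) / r\<^sup>2 - a - b \<bullet> h - U h\<bar> < \<eta> \<and>
               \<bar>g (c + r *\<^sub>R h) / r\<^sup>2 - a' - b' \<bullet> h - V h\<bar> < \<eta>))}"

lemma blowupsE:
  assumes "(U, V) \<in> blowups f g K" "finite E" "0 < \<eta>"
  obtains c r a b a' b' k where "0 < r" "r < \<eta>" "k \<in> K" "dist c k < \<eta>"
    "\<And>h. h \<in> E \<Longrightarrow> \<bar>f (c + r *\<^sub>R h) / r\<^sup>2 - a - b \<bullet> h - U h\<bar> < \<eta>"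
    "\<And>h. h \<in> E \<Longrightarrow> \<bar>g (c + r *\<^sub>R h) / r\<^sup>2 - a' - b' \<bullet> h - V h\<bar> < \<eta>"
proof -
  have "\<exists>c r a b a' b'. 0 < r \<and> r < \<eta> \<and> (\<exists>k\<in>K. dist c k < \<eta>) \<and>
        (\<forall>h\<in>E. \<bar>f (c + r *\<^sub>R h) / r\<^sup>2 - a - b \<bullet> h - U h\<bar> < \<eta> \<and>
               \<bar>g (c + r *\<^sub>R h) / r\<^sup>2 - a' - b' \<bullet> h - V h\<bar> < \<eta>)"
    using assms unfolding blowups_def by blast
  then show thesis using that by blast
qed

lemma blowups_add_affine:
  assumes "(U, V) \<in> blowups f g K"
  shows "((\<lambda>h. U h + a + b \<bullet> h), (\<lambda>h. V h + a' + b' \<bullet> h)) \<in> blowups f g K"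
  unfolding blowups_def
proof (clarify)
  fix E :: "'a set" and \<eta> :: real assume "finite E" "0 < \<eta>"
  with assms obtain c r \<alpha> \<beta> \<alpha>' \<beta>' k where *: "0 < r" "r < \<eta>" "k \<in> K" "dist c k < \<eta>"
    "\<And>h. h \<in> E \<Longrightarrow> \<bar>f (c + r *\<^sub>R h) / r\<^sup>2 - \<alpha> - \<beta> \<bullet> h - U h\<bar> < \<eta>"
    "\<And>h. h \<in> E \<Longrightarrow> \<bar>g (c + r *\<^sub>R h) / r\<^sup>2 - \<alpha>' - \<beta>' \<bullet> h - V h\<bar> < \<eta>" by (rule blowupsE) blast
  show "\<exists>c r \<alpha> \<beta> \<alpha>' \<beta>'. 0 < r \<and> r < \<eta> \<and> (\<exists>k\<in>K. dist c k < \<eta>) \<and>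
      (\<forall>h\<in>E. \<bar>f (c + r *\<^sub>R h) / r\<^sup>2 - \<alpha> - \<beta> \<bullet> h - (U h + a + b \<bullet> h)\<bar> < \<eta> \<and>
             \<bar>g (c + r *\<^sub>R h) / r\<^sup>2 - \<alpha>' - \<beta>' \<bullet> h - (V h + a' + b' \<bullet> h)\<bar> < \<eta>)"
  proof (rule exI[of _ c], rule exI[of _ r], rule exI[of _ "\<alpha> - a"], rule exI[of _ "\<beta> - b"],
      rule exI[of _ "\<alpha>' - a'"], rule exI[of _ "\<beta>' - b'"], intro conjI ballI)
    fix h assume h: "h \<in> E"
    show "\<bar>f (c + r *\<^sub>R h) / r\<^sup>2 - (\<alpha> - a) - (\<beta> - b) \<bullet> h - (U h + a + b \<bullet> h)\<bar> < \<eta>"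
      using *(5)[OF h] by (simp add: inner_diff_left algebra_simps)
    show "\<bar>g (c + r *\<^sub>R h) / r\<^sup>2 - (\<alpha>' - a') - (\<beta>' - b') \<bullet> h - (V h + a' + b' \<bullet> h)\<bar> < \<eta>"
      using *(6)[OF h] by (simp add: inner_diff_left algebra_simps)
  qed (use * in auto)
qed

lemma blowups_shift:
  assumes "(U, V) \<in> blowups f g K"
  shows "((\<lambda>h. U (h + y)), (\<lambda>h. V (h + y))) \<in> blowups f g K"
  unfolding blowups_def
proof (clarify)
  fix E :: "'a set" and \<eta> :: real assume E: "finite E" and \<eta>: "0 < \<eta>"
  \<comment> \<open>The new centre \<open>c + r *\<^sub>R y\<close> has distance less than
    \<open>\<eta>' + \<eta>' * norm y\<close> from \<open>K\<close>, and this is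
    \<open>\<eta>\<close>.\<close>
  define \<eta>' where "\<eta>' = \<eta> / (1 + norm y)"
  have ny: "1 + norm y > 0" using norm_ge_zero[of y] by linarith
  have \<eta>': "0 < \<eta>'" using \<eta> ny by (simp add: \<eta>'_def)
  have sum\<eta>: "\<eta>' + \<eta>' * norm y = \<eta>" 
  proof -
    have "\<eta>' + \<eta>' * norm y = \<eta>' * (1 + norm y)" by (simp add: algebra_simps)
    then show ?thesis using ny unfolding \<eta>'_def by simp
  qed
  have le: "\<eta>' \<le> \<eta>" using sum\<eta> \<eta>' mult_nonneg_nonneg[of \<eta>' "norm y"] norm_ge_zero[of y] by linarith
  have "finite ((\<lambda>h. h + y) ` E)" using E by simp
  from blowupsE[OF assms this \<eta>'] obtain c r a b a' b' k where *: "0 < r" "r < \<eta>'" "k \<in> K" "dist c k < \<eta>'"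
    "\<And>h. h \<in> (\<lambda>h. h + y) ` E \<Longrightarrow> \<bar>f (c + r *\<^sub>R h) / r\<^sup>2 - a - b \<bullet> h - U h\<bar> < \<eta>'"
    "\<And>h. h \<in> (\<lambda>h. h + y) ` E \<Longrightarrow> \<bar>g (c + r *\<^sub>R h) / r\<^sup>2 - a' - b' \<bullet> h - V h\<bar> < \<eta>'" by metis
  show "\<exists>c r a b a' b'. 0 < r \<and> r < \<eta> \<and> (\<exists>k\<in>K. dist c k < \<eta>) \<and>
      (\<forall>h\<in>E. \<bar>f (c + r *\<^sub>R h) / r\<^sup>2 - a - b \<bullet> h - U (h + y)\<bar> < \<eta> \<and>
             \<bar>g (c + r *\<^sub>R h) / r\<^sup>2 - a' - b' \<bullet> h - V (h + y)\<bar> < \<eta>)"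
  proof (rule exI[of _ "c + r *\<^sub>R y"], rule exI[of _ r], rule exI[of _ "a + b \<bullet> y"], rule exI[of _ b],
      rule exI[of _ "a' + b' \<bullet> y"], rule exI[of _ b'], intro conjI ballI)
    have "dist (c + r *\<^sub>R y) k \<le> dist c k + norm (r *\<^sub>R y)"
      unfolding dist_norm using norm_triangle_ineq[of "c - k" "r *\<^sub>R y"] by (simp add: algebra_simps)
    also have "\<dots> < \<eta>' + \<eta>' * norm y" using * by (intro add_less_le_mono) (auto intro: mult_right_mono)
    finally show "\<exists>k\<in>K. dist (c + r *\<^sub>R y) k < \<eta>" using *(3) sum\<eta> by auto
    fix h assume h: "h \<in> E"
    have e: "c + r *\<^sub>R y + r *\<^sub>R h = c + r *\<^sub>R (h + y)" by (simp add: algebra_simps)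
    show "\<bar>f (c + r *\<^sub>R y + r *\<^sub>R h) / r\<^sup>2 - (a + b \<bullet> y) - b \<bullet> h - U (h + y)\<bar> < \<eta>"
      unfolding e using *(5)[OF imageI[OF h]] le by (simp add: inner_add_right algebra_simps)
    show "\<bar>g (c + r *\<^sub>R y + r *\<^sub>R h) / r\<^sup>2 - (a' + b' \<bullet> y) - b' \<bullet> h - V (h + y)\<bar> < \<eta>"
      unfolding e using *(6)[OF imageI[OF h]] le by (simp add: inner_add_right algebra_simps)
  qed (use * le in auto)
qed

lemma blowups_rescale:
  assumes "(U, V) \<in> blowups f g K" and \<rho>: "0 < \<rho>"
  shows "((\<lambda>h. U (\<rho> *\<^sub>R h) / \<rho>\<^sup>2), (\<lambda>h. V (\<rho> *\<^sub>R h) / \<rho>\<^sup>2)) \<in> blowups f g K"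
  unfolding blowups_def
proof (clarify)
  fix E :: "'a set" and \<eta> :: real assume E: "finite E" and \<eta>: "0 < \<eta>"
  \<comment> \<open>The scale becomes \<open>r * \<rho>\<close> and the errors are divided by
    \<open>\<rho>\<^sup>2\<close>; the three entries keep distance, scale and errors below
    \<open>\<eta>\<close>.\<close>
  define \<eta>' where "\<eta>' = min \<eta> (min (\<eta> / \<rho>) (\<eta> * \<rho>\<^sup>2))"
  have \<eta>': "0 < \<eta>'" "\<eta>' \<le> \<eta>" "\<eta>' \<le> \<eta> / \<rho>" "\<eta>' \<le> \<eta> * \<rho>\<^sup>2" using \<eta> \<rho> by (auto simp: \<eta>'_def)
  have "finite ((\<lambda>h. \<rho> *\<^sub>R h) ` E)" using E by simp
  from blowupsE[OF assms(1) this \<eta>'(1)] obtain c r a b a' b' k where *: "0 < r" "r < \<eta>'" "k \<in> K" "dist c k < \<eta>'"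
    "\<And>h. h \<in> (\<lambda>h. \<rho> *\<^sub>R h) ` E \<Longrightarrow> \<bar>f (c + r *\<^sub>R h) / r\<^sup>2 - a - b \<bullet> h - U h\<bar> < \<eta>'"
    "\<And>h. h \<in> (\<lambda>h. \<rho> *\<^sub>R h) ` E \<Longrightarrow> \<bar>g (c + r *\<^sub>R h) / r\<^sup>2 - a' - b' \<bullet> h - V h\<bar> < \<eta>'" by metis
  have scale: "\<bar>A / (r * \<rho>)\<^sup>2 - \<alpha> / \<rho>\<^sup>2 - ((1/\<rho>) *\<^sub>R \<beta>) \<bullet> h - B / \<rho>\<^sup>2\<bar> < \<eta>"
    if "\<bar>A / r\<^sup>2 - \<alpha> - \<beta> \<bullet> (\<rho> *\<^sub>R h) - B\<bar> < \<eta>'" for A \<alpha> B :: real and \<beta> h :: 'a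
  proof -
    have "A / (r * \<rho>)\<^sup>2 - \<alpha> / \<rho>\<^sup>2 - ((1/\<rho>) *\<^sub>R \<beta>) \<bullet> h - B / \<rho>\<^sup>2 = (A / r\<^sup>2 - \<alpha> - \<beta> \<bullet> (\<rho> *\<^sub>R h) - B) / \<rho>\<^sup>2"
      using \<rho> by (simp add: diff_divide_distrib power_mult_distrib power2_eq_square)
    moreover have "\<bar>(A / r\<^sup>2 - \<alpha> - \<beta> \<bullet> (\<rho> *\<^sub>R h) - B) / \<rho>\<^sup>2\<bar> < \<eta>"
    proof -
      have "\<bar>A / r\<^sup>2 - \<alpha> - \<beta> \<bullet> (\<rho> *\<^sub>R h) - B\<bar> < \<eta> * \<rho>\<^sup>2" using that \<eta>'(4) by linarith
      then show ?thesis using \<rho> by (simp add: abs_divide pos_divide_less_eq)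
    qed
    ultimately show ?thesis by simp
  qed
  show "\<exists>c r a b a' b'. 0 < r \<and> r < \<eta> \<and> (\<exists>k\<in>K. dist c k < \<eta>) \<and>
      (\<forall>h\<in>E. \<bar>f (c + r *\<^sub>R h) / r\<^sup>2 - a - b \<bullet> h - U (\<rho> *\<^sub>R h) / \<rho>\<^sup>2\<bar> < \<eta> \<and>
             \<bar>g (c + r *\<^sub>R h) / r\<^sup>2 - a' - b' \<bullet> h - V (\<rho> *\<^sub>R h) / \<rho>\<^sup>2\<bar> < \<eta>)"
  proof (rule exI[of _ c], rule exI[of _ "r * \<rho>"], rule exI[of _ "a / \<rho>\<^sup>2"], rule exI[of _ "(1/\<rho>) *\<^sub>R b"],
      rule exI[of _ "a' / \<rho>\<^sup>2"], rule exI[of _ "(1/\<rho>) *\<^sub>R b'"], intro conjI ballI)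
    show "0 < r * \<rho>" using * \<rho> by simp
    have "r < \<eta> / \<rho>" using * \<eta>' by linarith
    then show "r * \<rho> < \<eta>" using \<rho> by (simp add: pos_less_divide_eq)
    show "\<exists>k\<in>K. dist c k < \<eta>" using * \<eta>' by force
    fix h assume h: "h \<in> E"
    show "\<bar>f (c + (r * \<rho>) *\<^sub>R h) / (r * \<rho>)\<^sup>2 - a / \<rho>\<^sup>2 - ((1/\<rho>) *\<^sub>R b) \<bullet> h - U (\<rho> *\<^sub>R h) / \<rho>\<^sup>2\<bar> < \<eta>"
      by (rule scale) (use *(5)[OF imageI[OF h]] in simp)
    show "\<bar>g (c + (r * \<rho>) *\<^sub>R h) / (r * \<rho>)\<^sup>2 - a' / \<rho>\<^sup>2 - ((1/\<rho>) *\<^sub>R b') \<bullet> h - V (\<rho> *\<^sub>R h) / \<rho>\<^sup>2\<bar> < \<eta>"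
      by (rule scale) (use *(6)[OF imageI[OF h]] in simp)
  qed
qed

lemma blowups_limit:
  fixes u v :: "'i \<Rightarrow> 'a::euclidean_space \<Rightarrow> real"
  assumes F: "F \<noteq> bot" and uv: "\<And>n. (u n, v n) \<in> blowups f g K"
    and U: "\<And>x. ((\<lambda>n. u n x) \<longlongrightarrow> U x) F" and V: "\<And>x. ((\<lambda>n. v n x) \<longlongrightarrow> V x) F"
  shows "(U, V) \<in> blowups f g K"
  unfolding blowups_def
proof (clarify)
  fix E :: "'a set" and \<eta> :: real assume E: "finite E" and \<eta>: "0 < \<eta>"
  have "eventually (\<lambda>n. \<forall>h\<in>E. dist (u n h) (U h) < \<eta> / 2) F"
    using U \<eta> E by (intro eventually_ball_finite ballI tendstoD) auto
  moreover have "eventually (\<lambda>n. \<forall>h\<in>E. dist (v n h) (V h) < \<eta> / 2) F"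
    using V \<eta> E by (intro eventually_ball_finite ballI tendstoD) auto
  ultimately have "eventually (\<lambda>n. (\<forall>h\<in>E. dist (u n h) (U h) < \<eta> / 2) \<and> (\<forall>h\<in>E. dist (v n h) (V h) < \<eta> / 2)) F"
    by (rule eventually_conj)
  then obtain n where n: "\<And>h. h \<in> E \<Longrightarrow> \<bar>u n h - U h\<bar> < \<eta> / 2" "\<And>h. h \<in> E \<Longrightarrow> \<bar>v n h - V h\<bar> < \<eta> / 2"
    using eventually_happens'[OF F] unfolding dist_real_def by blast
  have "\<eta> / 2 > 0" using \<eta> by simp
  from blowupsE[OF uv[of n] E this] obtain c r a b a' b' k where *: "0 < r" "r < \<eta> / 2" "k \<in> K" "dist c k < \<eta> / 2"
    "\<And>h. h \<in> E \<Longrightarrow> \<bar>f (c + r *\<^sub>R h) / r\<^sup>2 - a - b \<bullet> h - u n h\<bar> < \<eta> / 2"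
    "\<And>h. h \<in> E \<Longrightarrow> \<bar>g (c + r *\<^sub>R h) / r\<^sup>2 - a' - b' \<bullet> h - v n h\<bar> < \<eta> / 2" by metis
  show "\<exists>c r a b a' b'. 0 < r \<and> r < \<eta> \<and> (\<exists>k\<in>K. dist c k < \<eta>) \<and>
      (\<forall>h\<in>E. \<bar>f (c + r *\<^sub>R h) / r\<^sup>2 - a - b \<bullet> h - U h\<bar> < \<eta> \<and>
             \<bar>g (c + r *\<^sub>R h) / r\<^sup>2 - a' - b' \<bullet> h - V h\<bar> < \<eta>)"
  proof (rule exI[of _ c], rule exI[of _ r], rule exI[of _ a], rule exI[of _ b],
      rule exI[of _ a'], rule exI[of _ b'], intro conjI ballI)
    fix h assume h: "h \<in> E"
    show "\<bar>f (c + r *\<^sub>R h) / r\<^sup>2 - a - b \<bullet> h - U h\<bar> < \<eta>" using *(5)[OF h] n(1)[OF h] by linarith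
    show "\<bar>g (c + r *\<^sub>R h) / r\<^sup>2 - a' - b' \<bullet> h - V h\<bar> < \<eta>" using *(6)[OF h] n(2)[OF h] by linarith
  next
    show "\<exists>k\<in>K. dist c k < \<eta>" using * \<eta> by force
  qed (use * in auto)
qed

text \<open>A centre in \<open>blowups\<close> may be far from \<open>K\<close> when measured in
  units of \<open>r\<close>, so concavity of the sum is imposed as a condition here; that some
  member satisfies it is shown separately.\<close>

definition tame_blowups :: "real \<Rightarrow> ('a::euclidean_space \<Rightarrow> real) \<Rightarrow> ('a \<Rightarrow> real) \<Rightarrow> 'a set \<Rightarrow> (('a \<Rightarrow> real) \<times> ('a \<Rightarrow> real)) set" where
  "tame_blowups L f g K = {(U, V) \<in> blowups f g K.
     semiconvex L U \<and> semiconvex L V \<and> concave_on UNIV (\<lambda>x. U x + V x)}"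

lemma controlled_tame_blowups: "controlled L (tame_blowups L f g K)"
  unfolding controlled_def tame_blowups_def by blast

lemma blowup_closed_tame_blowups: "blowup_closed (tame_blowups L f g K)"
  unfolding blowup_closed_def
proof (intro conjI allI impI)
  fix U V :: "'a \<Rightarrow> real" and a b a' b' assume "(U, V) \<in> tame_blowups L f g K"
  then have *: "(U, V) \<in> blowups f g K" "semiconvex L U" "semiconvex L V" "semiconvex 0 (\<lambda>x. - (U x + V x))"
    unfolding tame_blowups_def concave_iff_semiconvex by blast+
  have "(\<lambda>x. - (U x + a + b \<bullet> x + (V x + a' + b' \<bullet> x))) = (\<lambda>x. - (U x + V x) + (- a - a') + (- b - b') \<bullet> x)"
    by (auto simp: inner_diff_left)
  then have "semiconvex 0 (\<lambda>x. - (U x + a + b \<bullet> x + (V x + a' + b' \<bullet> x)))"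
    using semiconvex_add_affine[OF *(4), of "- a - a'" "- b - b'"] by simp
  then show "((\<lambda>h. U h + a + b \<bullet> h), (\<lambda>h. V h + a' + b' \<bullet> h)) \<in> tame_blowups L f g K"
    using blowups_add_affine[OF *(1)] semiconvex_add_affine[OF *(2)] semiconvex_add_affine[OF *(3)]
    unfolding tame_blowups_def concave_iff_semiconvex by blast
next
  fix U V :: "'a \<Rightarrow> real" and y assume "(U, V) \<in> tame_blowups L f g K"
  then have *: "(U, V) \<in> blowups f g K" "semiconvex L U" "semiconvex L V" "semiconvex 0 (\<lambda>x. - (U x + V x))"
    unfolding tame_blowups_def concave_iff_semiconvex by blast+
  have "semiconvex M (\<lambda>h. w (h + y))" if "semiconvex M w" for M and w :: "'a \<Rightarrow> real"
    using semiconvex_rescale[OF that, of 1 y] by (simp add: add.commute)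
  from this[OF *(2)] this[OF *(3)] this[OF *(4)]
  show "((\<lambda>h. U (h + y)), (\<lambda>h. V (h + y))) \<in> tame_blowups L f g K"
    using blowups_shift[OF *(1)] unfolding tame_blowups_def concave_iff_semiconvex by blast
next
  fix U V :: "'a \<Rightarrow> real" and r :: real assume "(U, V) \<in> tame_blowups L f g K" and r: "0 < r"
  then have *: "(U, V) \<in> blowups f g K" "semiconvex L U" "semiconvex L V" "semiconvex 0 (\<lambda>x. - (U x + V x))"
    unfolding tame_blowups_def concave_iff_semiconvex by blast+
  have s: "semiconvex M (\<lambda>h. w (r *\<^sub>R h) / r\<^sup>2)" if "semiconvex M w" for M and w :: "'a \<Rightarrow> real"
    using semiconvex_rescale[OF that r, of 0] by simp
  have "(\<lambda>h. - (U (r *\<^sub>R h) / r\<^sup>2 + V (r *\<^sub>R h) / r\<^sup>2)) = (\<lambda>h. - (U (r *\<^sub>R h) + V (r *\<^sub>R h)) / r\<^sup>2)"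
    by (simp add: add_divide_distrib diff_divide_distrib)
  then have "semiconvex 0 (\<lambda>h. - (U (r *\<^sub>R h) / r\<^sup>2 + V (r *\<^sub>R h) / r\<^sup>2))" using s[OF *(4)] by simp
  then show "((\<lambda>h. U (r *\<^sub>R h) / r\<^sup>2), (\<lambda>h. V (r *\<^sub>R h) / r\<^sup>2)) \<in> tame_blowups L f g K"
    using blowups_rescale[OF *(1) r] s[OF *(2)] s[OF *(3)]
    unfolding tame_blowups_def concave_iff_semiconvex by blast
next
  fix F :: "nat filter" and u v :: "nat \<Rightarrow> 'a \<Rightarrow> real" and U V
  assume F: "F \<noteq> bot" and uv: "\<forall>n. (u n, v n) \<in> tame_blowups L f g K"
    and U: "\<forall>x. ((\<lambda>n. u n x) \<longlongrightarrow> U x) F" and V: "\<forall>x. ((\<lambda>n. v n x) \<longlongrightarrow> V x) F"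
  have *: "(u n, v n) \<in> blowups f g K" "semiconvex L (u n)" "semiconvex L (v n)" "semiconvex 0 (\<lambda>x. - (u n x + v n x))" for n
    using uv unfolding tame_blowups_def concave_iff_semiconvex by blast+
  have "(U, V) \<in> blowups f g K"
  proof (rule blowups_limit[where u = u and v = v and F = F])
    show "(u n, v n) \<in> blowups f g K" for n by (rule *(1))
  qed (use F U V in auto)
  moreover have "semiconvex L U" by (rule semiconvex_limit[OF F *(2)]) (use U in auto)
  moreover have "semiconvex L V" by (rule semiconvex_limit[OF F *(3)]) (use V in auto)
  moreover have "semiconvex 0 (\<lambda>x. - (U x + V x))"
  proof (rule semiconvex_limit[where u = "\<lambda>n x. - (u n x + v n x)" and F = F])
    show "semiconvex 0 (\<lambda>x. - (u n x + v n x))" for n by (rule *(4))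
    show "((\<lambda>n. - (u n x + v n x)) \<longlongrightarrow> - (U x + V x)) F" for x
      by (intro tendsto_intros U[rule_format] V[rule_format])
  qed (rule F)
  ultimately show "(U, V) \<in> tame_blowups L f g K" unfolding tame_blowups_def concave_iff_semiconvex by blast
qed

section \<open>Existence of a blow-up with concave sum\<close>

text \<open>The convex function \<open>u h + L / 2 * (h \<bullet> h)\<close> is bounded by
  \<open>2 * L * (R + 1)\<^sup>2\<close> on the ball of radius \<open>R + 1\<close>, which gives the
  first summand; the paraboloid accounts for \<open>L * R\<close>. The constant is the same for all
  normalised blow-ups.\<close>

lemma semiconvex_Lipschitz:
  fixes u :: "'a::euclidean_space \<Rightarrow> real"
  assumes u: "semiconvex L u" and L: "L \<ge> 0" and bd: "\<And>h. \<bar>u h\<bar> \<le> 3 * L / 2 * (h \<bullet> h)"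
    and R: "R \<ge> 0" and x: "norm x \<le> R" and y: "norm y \<le> R"
  shows "\<bar>u x - u y\<bar> \<le> (4 * L * (R + 1)\<^sup>2 + L * R) * norm (x - y)"
proof -
  let ?F = "\<lambda>h. u h + L / 2 * (h \<bullet> h)"
  have "\<bar>?F h\<bar> \<le> 2 * L * (R + 1)\<^sup>2" if "norm h \<le> R + 1" for h
  proof -
    have "0 \<le> L * (h \<bullet> h)" using L by simp
    moreover have "\<bar>u h\<bar> \<le> 3 / 2 * (L * (h \<bullet> h))" using bd[of h] by simp
    ultimately have "\<bar>u h + 1 / 2 * (L * (h \<bullet> h))\<bar> \<le> 2 * (L * (h \<bullet> h))" by linarith
    then have "\<bar>?F h\<bar> \<le> 2 * L * (h \<bullet> h)" by simp
    also have "\<dots> \<le> 2 * L * (R + 1)\<^sup>2" using that L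
      by (intro mult_left_mono) (auto simp: dot_square_norm power_mono)
    finally show ?thesis .
  qed
  from convex_Lipschitz_on_cball[OF u[unfolded semiconvex_def] this x y]
  have 1: "\<bar>?F x - ?F y\<bar> \<le> 4 * L * (R + 1)\<^sup>2 * norm (x - y)" by simp
  have "\<bar>x \<bullet> x - y \<bullet> y\<bar> = \<bar>(x - y) \<bullet> (x + y)\<bar>" by (simp add: inner_simps inner_commute)
  also have "\<dots> \<le> norm (x - y) * norm (x + y)" by (rule Cauchy_Schwarz_ineq2)
  also have "\<dots> \<le> norm (x - y) * (2 * R)" using norm_triangle_ineq[of x y] x y by (intro mult_left_mono) auto
  finally have "L / 2 * \<bar>x \<bullet> x - y \<bullet> y\<bar> \<le> L / 2 * (norm (x - y) * (2 * R))" using L by (intro mult_left_mono) auto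
  then have 2: "\<bar>L / 2 * (x \<bullet> x) - L / 2 * (y \<bullet> y)\<bar> \<le> L * R * norm (x - y)"
    using L unfolding right_diff_distrib[symmetric] abs_mult by (simp add: mult.commute mult.left_commute)
  show ?thesis using 1 2 by (simp add: algebra_simps) 
qed

text \<open>Centres in \<open>K\<close> allow normalisation and a cluster point. In the rescaled
  picture contact points become dense: some \<open>z + e\<close> with small \<open>e\<close> is one,
  and the plane touching there gives the concavity inequality for \<open>x + e\<close>,
  \<open>y + e\<close>, \<open>z + e\<close>. Uniform Lipschitz bounds then remove the
  shift.\<close>

lemma tame_blowups_nonempty:
  fixes f g :: "'a::euclidean_space \<Rightarrow> real"
  assumes f: "semiconvex L f" and g: "semiconvex L g" and L: "L \<ge> 0" and K: "compact K" "\<not> negligible K"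
    and contact: "\<And>k. k \<in> K \<Longrightarrow> \<exists>p. \<forall>x. f x + g x \<le> f k + g k + p \<bullet> (x - k)"
  shows "tame_blowups L f g K \<noteq> {}"
proof -
  obtain c :: "nat \<Rightarrow> 'a" and r where cr: "\<And>n. c n \<in> K" "\<And>n. r n > 0" "r \<longlonglongrightarrow> 0"
    and dense: "\<And>y \<delta>. \<delta> > 0 \<Longrightarrow> eventually (\<lambda>n. \<exists>k\<in>K. norm (k - (c n + r n *\<^sub>R y)) \<le> \<delta> * r n) sequentially"
    using compact_positive_measure_blowup_dense[OF K] by blast
  define fn where "fn n h = f (c n + r n *\<^sub>R h) / (r n)\<^sup>2" for n h
  define gn where "gn n h = g (c n + r n *\<^sub>R h) / (r n)\<^sup>2" for n h
  have scf: "semiconvex L (fn n)" and scg: "semiconvex L (gn n)" for n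
    unfolding fn_def gn_def using semiconvex_rescale[OF f cr(2)] semiconvex_rescale[OF g cr(2)] .
  have contact': "sdiff f k h + sdiff g k h \<le> 0" if k: "k \<in> K" for k h
  proof -
    obtain p where p: "\<And>x. f x + g x \<le> f k + g k + p \<bullet> (x - k)" using contact[OF k] by blast
    show ?thesis using p[of "k + h"] p[of "k - h"] by (simp add: sdiff_def)
  qed
  have sdfn: "sdiff (fn n) 0 h = sdiff f (c n) (r n *\<^sub>R h) / (r n)\<^sup>2"
    and sdgn: "sdiff (gn n) 0 h = sdiff g (c n) (r n *\<^sub>R h) / (r n)\<^sup>2" for n h
    unfolding fn_def gn_def sdiff_def by (simp_all add: add_divide_distrib diff_divide_distrib)
  have sum0: "sdiff (fn n) 0 h + sdiff (gn n) 0 h \<le> 0" for n h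
  proof -
    have "(sdiff f (c n) (r n *\<^sub>R h) + sdiff g (c n) (r n *\<^sub>R h)) / (r n)\<^sup>2 \<le> 0"
      using contact'[OF cr(1)[of n], of "r n *\<^sub>R h"] by (simp add: divide_nonpos_nonneg)
    then show ?thesis unfolding sdfn sdgn by (simp add: add_divide_distrib)
  qed
  have "sdiff (fn n) 0 h \<le> L * (h \<bullet> h)" "sdiff (gn n) 0 h \<le> L * (h \<bullet> h)" for n h
    using sum0[of n h] semiconvex_sdiff_ge[OF scf[of n], where x = 0 and h = h]
      semiconvex_sdiff_ge[OF scg[of n], where x = 0 and h = h] by simp_all
  then have "\<exists>a b. \<forall>h. \<bar>fn n h + a + b \<bullet> h\<bar> \<le> 3 * L / 2 * (h \<bullet> h)"
    "\<exists>a b. \<forall>h. \<bar>gn n h + a + b \<bullet> h\<bar> \<le> 3 * L / 2 * (h \<bullet> h)" for n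
    using affine_normalisation[OF scf] affine_normalisation[OF scg] by blast+
  then obtain a b a' b' where bf: "\<And>n h. \<bar>fn n h + a n + b n \<bullet> h\<bar> \<le> 3 * L / 2 * (h \<bullet> h)"
    and bg: "\<And>n h. \<bar>gn n h + a' n + b' n \<bullet> h\<bar> \<le> 3 * L / 2 * (h \<bullet> h)" by metis
  define u where "u n = (\<lambda>h. fn n h + a n + b n \<bullet> h)" for n
  define v where "v n = (\<lambda>h. gn n h + a' n + b' n \<bullet> h)" for n
  have bu: "\<bar>u n h\<bar> \<le> 3 * L / 2 * (h \<bullet> h)" and bv: "\<bar>v n h\<bar> \<le> 3 * L / 2 * (h \<bullet> h)" for n h
    unfolding u_def v_def by (rule bf bg)+
  have scu: "semiconvex L (u n)" and scv: "semiconvex L (v n)" for n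
    unfolding u_def v_def by (rule semiconvex_add_affine[OF scf] semiconvex_add_affine[OF scg])+
  have bd: "\<exists>B. \<forall>n. \<bar>u n x\<bar> \<le> B" "\<exists>B. \<forall>n. \<bar>v n x\<bar> \<le> B" for x using bu bv by blast+
  obtain G1 U where G1: "G1 \<noteq> bot" "G1 \<le> sequentially" "\<And>x. ((\<lambda>n. u n x) \<longlongrightarrow> U x) G1"
    using pointwise_bounded_cluster[of sequentially u, OF _ bd(1)] by auto
  obtain G V where G: "G \<noteq> bot" "G \<le> G1" and V: "\<And>x. ((\<lambda>n. v n x) \<longlongrightarrow> V x) G"
    using pointwise_bounded_cluster[of G1 v, OF G1(1) bd(2)] by auto
  have U: "((\<lambda>n. u n x) \<longlongrightarrow> U x) G" for x by (rule tendsto_mono[OF G(2) G1(3)])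
  have Gs: "G \<le> sequentially" using G(2) G1(2) by (rule order_trans)
  have "(U, V) \<in> blowups f g K"
    unfolding blowups_def
  proof (clarify)
    fix E :: "'a set" and \<eta> :: real assume E: "finite E" and \<eta>: "0 < \<eta>"
    have "eventually (\<lambda>n. \<forall>h\<in>E. dist (u n h) (U h) < \<eta>) G" "eventually (\<lambda>n. \<forall>h\<in>E. dist (v n h) (V h) < \<eta>) G"
      using U V \<eta> E by (intro eventually_ball_finite ballI tendstoD; auto)+
    moreover have "eventually (\<lambda>n. r n < \<eta>) G"
      using order_tendstoD(2)[OF cr(3) \<eta>] by (rule filter_leD[OF Gs])
    ultimately have "eventually (\<lambda>n. ((\<forall>h\<in>E. dist (u n h) (U h) < \<eta>) \<and> (\<forall>h\<in>E. dist (v n h) (V h) < \<eta>)) \<and> r n < \<eta>) G"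
      by (intro eventually_conj)
    then obtain n where n: "\<And>h. h \<in> E \<Longrightarrow> \<bar>u n h - U h\<bar> < \<eta>" "\<And>h. h \<in> E \<Longrightarrow> \<bar>v n h - V h\<bar> < \<eta>" "r n < \<eta>"
      using eventually_happens'[OF G(1)] unfolding dist_real_def by blast
    show "\<exists>c r a b a' b'. 0 < r \<and> r < \<eta> \<and> (\<exists>k\<in>K. dist c k < \<eta>) \<and>
        (\<forall>h\<in>E. \<bar>f (c + r *\<^sub>R h) / r\<^sup>2 - a - b \<bullet> h - U h\<bar> < \<eta> \<and>
               \<bar>g (c + r *\<^sub>R h) / r\<^sup>2 - a' - b' \<bullet> h - V h\<bar> < \<eta>)"
    proof (rule exI[of _ "c n"], rule exI[of _ "r n"], rule exI[of _ "- a n"], rule exI[of _ "- b n"],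
        rule exI[of _ "- a' n"], rule exI[of _ "- b' n"], intro conjI ballI)
      show "\<exists>k\<in>K. dist (c n) k < \<eta>" using cr(1)[of n] \<eta> by (intro bexI[of _ "c n"]) auto
      fix h assume h: "h \<in> E"
      show "\<bar>f (c n + r n *\<^sub>R h) / (r n)\<^sup>2 - (- a n) - (- b n) \<bullet> h - U h\<bar> < \<eta>"
        using n(1)[OF h] unfolding u_def fn_def by simp
      show "\<bar>g (c n + r n *\<^sub>R h) / (r n)\<^sup>2 - (- a' n) - (- b' n) \<bullet> h - V h\<bar> < \<eta>"
        using n(2)[OF h] unfolding v_def gn_def by simp
    qed (use cr n in auto)
  qed
  moreover have "semiconvex L U" by (rule semiconvex_limit[OF G(1) scu U])
  moreover have "semiconvex L V" by (rule semiconvex_limit[OF G(1) scv V])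
  moreover have "semiconvex 0 (\<lambda>x. - (U x + V x))"
    unfolding semiconvex_iff
  proof (intro allI impI)
    fix x y :: 'a and t :: real assume t: "0 \<le> t" "t \<le> 1"
    define z where "z = (1 - t) *\<^sub>R x + t *\<^sub>R y"
    \<comment> \<open>The margin of one accommodates the shift \<open>e\<close>, whose norm is at
      most \<open>\<delta> \<le> 1\<close>.\<close>
    define R where "R = norm x + norm y + norm z + 1"
    define C where "C = 4 * L * (R + 1)\<^sup>2 + L * R"
    have R: "R \<ge> 0" "norm x + 1 \<le> R" "norm y + 1 \<le> R" "norm z + 1 \<le> R"
      using norm_ge_zero[of x] norm_ge_zero[of y] norm_ge_zero[of z] unfolding R_def by linarith+
    have C: "C \<ge> 0" unfolding C_def using L R by simp
    have lip: "\<bar>(u n p + v n p) - (u n q + v n q)\<bar> \<le> 2 * C * norm (p - q)" if "norm p \<le> R" "norm q \<le> R" for n p q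
      using semiconvex_Lipschitz[OF scu L bu R(1) that, of n] semiconvex_Lipschitz[OF scv L bv R(1) that, of n]
      unfolding C_def by linarith
    \<comment> \<open>Of the error, \<open>2 * C * \<delta>\<close> comes from shifting
      \<open>z\<close> and as much from shifting the convex combination of the values at
      \<open>x\<close> and \<open>y\<close>.\<close>
    have key: "(1 - t) * (U x + V x) + t * (U y + V y) \<le> U z + V z + 4 * C * \<delta>" if \<delta>: "0 < \<delta>" "\<delta> \<le> 1" for \<delta>
    proof (rule tendsto_le[OF G(1)])
      show "((\<lambda>n. u n z + v n z + 4 * C * \<delta>) \<longlongrightarrow> U z + V z + 4 * C * \<delta>) G" by (intro tendsto_intros U V)
      show "((\<lambda>n. (1 - t) * (u n x + v n x) + t * (u n y + v n y)) \<longlongrightarrow> (1 - t) * (U x + V x) + t * (U y + V y)) G"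
        by (intro tendsto_intros U V)
      have "eventually (\<lambda>n. \<exists>k\<in>K. norm (k - (c n + r n *\<^sub>R z)) \<le> \<delta> * r n) G"
        by (rule filter_leD[OF Gs dense[OF \<delta>(1)]])
      then show "eventually (\<lambda>n. (1 - t) * (u n x + v n x) + t * (u n y + v n y) \<le> u n z + v n z + 4 * C * \<delta>) G"
      proof eventually_elim
        case (elim n)
        then obtain k where k: "k \<in> K" "norm (k - (c n + r n *\<^sub>R z)) \<le> \<delta> * r n" by blast
        define e where "e = (1 / r n) *\<^sub>R (k - (c n + r n *\<^sub>R z))"
        have rn: "r n > 0" by (rule cr)
        have ke: "k = c n + r n *\<^sub>R (z + e)" unfolding e_def using rn by (simp add: algebra_simps)
        have ne: "norm e \<le> \<delta>" 
        proof -
          have "norm e = norm (k - (c n + r n *\<^sub>R z)) / r n" unfolding e_def using rn by simp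
          also have "\<dots> \<le> \<delta>" using k(2) rn by (simp add: pos_divide_le_eq)
          finally show ?thesis .
        qed
        obtain p where p: "\<And>x. f x + g x \<le> f k + g k + p \<bullet> (x - k)" using contact[OF k(1)] by blast
        \<comment> \<open>The touching slope in rescaled variables, corrected by the normalising
          affine functions.\<close>
        define q where "q = (1 / r n) *\<^sub>R p + (b n + b' n)"
        have w: "u n (w + e) + v n (w + e) \<le> u n (z + e) + v n (z + e) + q \<bullet> (w - z)" for w
        proof -
          have "f (c n + r n *\<^sub>R (w + e)) + g (c n + r n *\<^sub>R (w + e)) \<le> f k + g k + p \<bullet> (r n *\<^sub>R (w - z))"
            using p[of "c n + r n *\<^sub>R (w + e)"] unfolding ke by (simp add: algebra_simps)
          then have "(f (c n + r n *\<^sub>R (w + e)) + g (c n + r n *\<^sub>R (w + e))) / (r n)\<^sup>2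
              \<le> (f k + g k + p \<bullet> (r n *\<^sub>R (w - z))) / (r n)\<^sup>2"
            by (rule divide_right_mono) simp
          also have "\<dots> = fn n (z + e) + gn n (z + e) + ((1 / r n) *\<^sub>R p) \<bullet> (w - z)"
            unfolding fn_def gn_def ke[symmetric] using rn by (simp add: add_divide_distrib power2_eq_square)
          finally have "fn n (w + e) + gn n (w + e) \<le> fn n (z + e) + gn n (z + e) + ((1 / r n) *\<^sub>R p) \<bullet> (w - z)"
            by (simp add: fn_def gn_def add_divide_distrib)
          then show ?thesis unfolding u_def v_def q_def by (simp add: inner_simps)
        qed
        have "(1 - t) * (q \<bullet> (x - z)) + t * (q \<bullet> (y - z)) = 0"
          unfolding z_def by (simp add: inner_simps algebra_simps)
        moreover have "(1 - t) * (u n (x + e) + v n (x + e)) \<le> (1 - t) * (u n (z + e) + v n (z + e) + q \<bullet> (x - z))"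
          "t * (u n (y + e) + v n (y + e)) \<le> t * (u n (z + e) + v n (z + e) + q \<bullet> (y - z))"
          using t by (intro mult_left_mono w; simp)+
        ultimately have 1: "(1 - t) * (u n (x + e) + v n (x + e)) + t * (u n (y + e) + v n (y + e)) \<le> u n (z + e) + v n (z + e)"
          by (simp add: algebra_simps)
        have near: "\<bar>(u n (w + e) + v n (w + e)) - (u n w + v n w)\<bar> \<le> 2 * C * \<delta>" if "norm w + 1 \<le> R" for w
        proof -
          have "norm (w + e) \<le> R" "norm w \<le> R"
            using norm_triangle_ineq[of w e] ne \<delta> that by linarith+
          then have "\<bar>(u n (w + e) + v n (w + e)) - (u n w + v n w)\<bar> \<le> 2 * C * norm e" using lip[of "w + e" w n] by simp
          also have "\<dots> \<le> 2 * C * \<delta>" using ne C by (intro mult_left_mono) auto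
          finally show ?thesis .
        qed
        have "(1 - t) * (u n x + v n x - 2 * C * \<delta>) \<le> (1 - t) * (u n (x + e) + v n (x + e))"
          "t * (u n y + v n y - 2 * C * \<delta>) \<le> t * (u n (y + e) + v n (y + e))"
          using near[OF R(2)] near[OF R(3)] t by (intro mult_left_mono; linarith)+
        then show ?case using 1 near[OF R(4)] by (simp add: algebra_simps)
      qed
    qed
    have "(1 - t) * (U x + V x) + t * (U y + V y) \<le> U z + V z"
    proof (rule field_le_epsilon)
      fix e :: real assume e: "e > 0"
      define \<delta> where "\<delta> = min 1 (e / (4 * C + 1))"
      have \<delta>: "0 < \<delta>" "\<delta> \<le> 1" using e C by (auto simp: \<delta>_def)
      have "4 * C * \<delta> \<le> 4 * C * (e / (4 * C + 1))" using C by (intro mult_left_mono) (auto simp: \<delta>_def)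
      also have "\<dots> \<le> e" using e C by (simp add: field_simps)
      finally show "(1 - t) * (U x + V x) + t * (U y + V y) \<le> U z + V z + e" using key[OF \<delta>] by linarith
    qed
    then show "- (U ((1 - t) *\<^sub>R x + t *\<^sub>R y) + V ((1 - t) *\<^sub>R x + t *\<^sub>R y)) \<le>
        (1 - t) * - (U x + V x) + t * - (U y + V y) + 0 / 2 * (t * (1 - t) * ((x - y) \<bullet> (x - y)))"
      unfolding z_def by (simp add: algebra_simps)
  qed
  ultimately have "(U, V) \<in> tame_blowups L f g K" unfolding tame_blowups_def concave_iff_semiconvex by blast
  then show ?thesis by blast
qed

section \<open>Contact points and touching quadratics\<close>

lemma linear_le_quadratic_imp_zero:
  fixes q :: "'a::real_inner"
  assumes L: "L \<ge> 0" and q: "\<And>h. q \<bullet> h \<le> L * (h \<bullet> h)"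
  shows "q = 0"
proof (rule ccontr)
  assume "q \<noteq> 0"
  then have qq: "q \<bullet> q > 0" by simp
  define t where "t = 1 / (L + 1)"
  have t: "t > 0" "L * t < 1" using L by (auto simp: t_def field_simps)
  have "t * (q \<bullet> q) \<le> L * (t * (t * (q \<bullet> q)))" using q[of "t *\<^sub>R q"] by simp
  then have "t * (q \<bullet> q) * 1 \<le> t * (q \<bullet> q) * (L * t)" by (simp add: mult_ac)
  moreover have "t * (q \<bullet> q) > 0" using t qq by simp
  ultimately have "1 \<le> L * t" by (simp only: mult_le_cancel_left_pos)
  then show False using t by simp
qed

text \<open>The slope of a plane touching from above is also the subgradient of the semiconvex sum.\<close>

lemma contact_slope_Lipschitz:
  fixes f g :: "'a::euclidean_space \<Rightarrow> real"
  assumes f: "semiconvex L f" and g: "semiconvex L g" and L: "L \<ge> 0"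
    and p: "\<And>x. f x + g x \<le> f k + g k + p \<bullet> (x - k)"
    and p': "\<And>x. f x + g x \<le> f k' + g k' + p' \<bullet> (x - k')"
  shows "norm (p - p') \<le> 4 * L * norm (k - k')"
proof -
  obtain s1 where s1: "\<And>h. f (k + h) \<ge> f k + s1 \<bullet> h - L / 2 * (h \<bullet> h)"
    using semiconvex_subgradient[OF f, of k] by blast
  obtain s2 where s2: "\<And>h. g (k + h) \<ge> g k + s2 \<bullet> h - L / 2 * (h \<bullet> h)"
    using semiconvex_subgradient[OF g, of k] by blast
  have "(s1 + s2 - p) \<bullet> h \<le> L * (h \<bullet> h)" for h
    using s1[of h] s2[of h] p[of "k + h"] by (simp add: inner_simps)
  then have "s1 + s2 - p = 0" by (rule linear_le_quadratic_imp_zero[OF L])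
  then have ps: "p = s1 + s2" by simp
  \<comment> \<open>The paraboloid below the sum at \<open>k\<close> is compared with the plane
    above it at \<open>k'\<close>; the plane at \<open>k\<close>, evaluated at \<open>k'\<close>,
    links the two contact values.\<close>
  have main: "(p - p') \<bullet> (x - k') \<le> L * ((x - k) \<bullet> (x - k))" for x
  proof -
    have "f x + g x \<ge> f k + g k + p \<bullet> (x - k) - L * ((x - k) \<bullet> (x - k))"
      using s1[of "x - k"] s2[of "x - k"] unfolding ps by (simp add: inner_simps)
    then show ?thesis using p'[of x] p[of k'] by (simp add: inner_simps)
  qed
  show ?thesis
  proof (cases "k = k'")
    case True
    have "(p - p') \<bullet> h \<le> L * (h \<bullet> h)" for h using main[of "k + h"] True by simp
    then have "p - p' = 0" by (rule linear_le_quadratic_imp_zero[OF L])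
    then show ?thesis using True by simp
  next
    case False
    define n where "n = norm (p - p')"
    define d where "d = norm (k - k')"
    have d: "d > 0" using False by (simp add: d_def)
    show ?thesis
    proof (cases "n = 0")
      case False
      then have n: "n > 0" by (simp add: n_def)
      \<comment> \<open>A step of length \<open>d\<close> from \<open>k'\<close> in the direction of
        \<open>p - p'\<close> stays within \<open>2 * d\<close> of \<open>k\<close> and turns the
        left side of \<open>main\<close> into \<open>d * n\<close>.\<close>
      define x where "x = k' + (d / n) *\<^sub>R (p - p')"
      have "(p - p') \<bullet> (x - k') = d * n" unfolding x_def using n by (simp add: n_def dot_square_norm power2_eq_square)
      moreover have "(x - k) \<bullet> (x - k) \<le> (2 * d)\<^sup>2"
      proof -
        have "x - k = (d / n) *\<^sub>R (p - p') - (k - k')" unfolding x_def by simp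
        then have "norm (x - k) \<le> norm ((d / n) *\<^sub>R (p - p')) + d" unfolding d_def by (simp only: norm_triangle_ineq4)
        also have "norm ((d / n) *\<^sub>R (p - p')) = d" using n d by (simp add: n_def)
        finally have "norm (x - k) \<le> 2 * d" by simp
        then show ?thesis unfolding dot_square_norm by (rule power_mono) simp
      qed
      ultimately have "d * n \<le> L * (2 * d)\<^sup>2" using main[of x] mult_left_mono[OF _ L] by fastforce
      then have "d * n \<le> d * (4 * L * d)" by (simp add: power2_eq_square mult_ac)
      then have "n \<le> 4 * L * d" using d by (simp only: mult_le_cancel_left_pos)
      then show ?thesis by (simp add: n_def d_def)
    qed (use L in \<open>simp add: n_def\<close>)
  qed
qed

text \<open>The slope at a contact point is unique and Lipschitz in the point. A null set
  \<open>K\<close> would have a null image under the slope map, but that image contains a ball of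
  slopes.\<close>

lemma contact_set_not_negligible:
  fixes f g :: "'a::euclidean_space \<Rightarrow> real"
  assumes f: "semiconvex L f" and g: "semiconvex L g" and L: "L \<ge> 0" and r0: "r0 > 0"
    and ex: "\<And>p. norm p \<le> r0 \<Longrightarrow> \<exists>k\<in>K. \<forall>x. f x + g x \<le> f k + g k + p \<bullet> (x - k)"
    and K: "\<And>k. k \<in> K \<Longrightarrow> \<exists>p. \<forall>x. f x + g x \<le> f k + g k + p \<bullet> (x - k)"
  shows "\<not> negligible K"
proof
  assume neg: "negligible K"
  obtain P where P: "\<And>k x. k \<in> K \<Longrightarrow> f x + g x \<le> f k + g k + P k \<bullet> (x - k)" using K by metis
  have "negligible (P ` K)"
  proof (rule negligible_locally_Lipschitz_image[OF _ neg])
    fix x assume x: "x \<in> K"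
    show "\<exists>T B. open T \<and> x \<in> T \<and> (\<forall>y\<in>K \<inter> T. norm (P y - P x) \<le> B * norm (y - x))"
      using contact_slope_Lipschitz[OF f g L P P] x by (intro exI[of _ UNIV] exI[of _ "4 * L"]) auto
  qed simp
  moreover have "ball 0 r0 \<subseteq> P ` K"
  proof
    fix p :: 'a assume "p \<in> ball 0 r0"
    then obtain k where k: "k \<in> K" "\<And>x. f x + g x \<le> f k + g k + p \<bullet> (x - k)" using ex[of p] by auto
    have "norm (p - P k) \<le> 4 * L * norm (k - k)" by (rule contact_slope_Lipschitz[OF f g L k(2) P[OF k(1)]])
    then have "p = P k" by simp
    then show "p \<in> P ` K" using k(1) by blast
  qed
  ultimately have "negligible (ball (0::'a) r0)" by (rule negligible_subset)
  then show False using open_not_negligible[of "ball (0::'a) r0"] r0 by simp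
qed

text \<open>In the rescaled variable \<open>\<Phi>\<close> is at least \<open>- \<eta>\<close> at
  the origin and at most \<open>\<eta> - 3 * \<eta>\<close> on the unit sphere, so its maximum over
  the unit ball is interior. The quadratic scaling leaves \<open>T\<close> and \<open>\<eta>\<close>
  unchanged.\<close>

lemma touching_quadratic:
  fixes f :: "'a::euclidean_space \<Rightarrow> real"
  assumes cont: "continuous_on UNIV f" and T: "linear T" "\<And>x y. T x \<bullet> y = x \<bullet> T y"
    and r: "r > 0" and \<eta>: "\<eta> > 0"
    and up: "\<And>h. norm h \<le> 1 \<Longrightarrow> f (c + r *\<^sub>R h) / r\<^sup>2 - a - b \<bullet> h \<le> 1/2 * (T h \<bullet> h) + \<eta>"
    and low: "f c / r\<^sup>2 - a \<ge> - \<eta>"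
  shows "\<exists>x1 b'. dist x1 c < r \<and> (\<exists>e>0. \<forall>x\<in>ball x1 e.
           f x - (b' \<bullet> x + 1/2 * (T x \<bullet> x) + 3 * \<eta> * (x \<bullet> x)) \<le>
           f x1 - (b' \<bullet> x1 + 1/2 * (T x1 \<bullet> x1) + 3 * \<eta> * (x1 \<bullet> x1)))"
proof -
  define \<Phi> where "\<Phi> h = f (c + r *\<^sub>R h) / r\<^sup>2 - a - b \<bullet> h - 1/2 * (T h \<bullet> h) - 3 * \<eta> * (h \<bullet> h)" for h
  have contT: "continuous_on UNIV T" using T(1) by (simp add: linear_continuous_on linear_linear)
  have "continuous_on UNIV (\<lambda>h. f (c + r *\<^sub>R h))"
    by (rule continuous_on_compose2[OF cont]) (auto intro!: continuous_intros)
  moreover have "continuous_on UNIV (\<lambda>h. T h \<bullet> h)" by (intro continuous_on_inner contT continuous_on_id)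
  ultimately have "continuous_on UNIV \<Phi>" unfolding \<Phi>_def using r
    by (intro continuous_on_diff continuous_on_divide continuous_on_mult continuous_on_const
        continuous_on_inner continuous_on_id contT) auto
  then have "continuous_on (cball 0 1) \<Phi>" by (rule continuous_on_subset) simp
  then obtain h0 where h0: "h0 \<in> cball 0 1" "\<And>h. h \<in> cball 0 1 \<Longrightarrow> \<Phi> h \<le> \<Phi> h0"
    using continuous_attains_sup[of "cball (0::'a) 1" \<Phi>] by auto
  have "\<Phi> 0 \<ge> - \<eta>" using low linear_0[OF T(1)] unfolding \<Phi>_def by simp
  moreover have "\<Phi> h \<le> - 2 * \<eta>" if "norm h = 1" for h
    using up[of h] that unfolding \<Phi>_def by (simp add: dot_square_norm)
  ultimately have "norm h0 \<noteq> 1" using h0(2)[of 0] \<eta> by fastforce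
  then have nh0: "norm h0 < 1" using h0(1) by simp
  define x1 where "x1 = c + r *\<^sub>R h0"
  \<comment> \<open>Linear and constant terms produced by expanding the quadratics about the origin
    instead of \<open>c\<close>; the constant \<open>\<alpha>\<close> drops out of the
    comparison.\<close>
  define b' where "b' = r *\<^sub>R b - T c - (6 * \<eta>) *\<^sub>R c"
  define \<alpha> where "\<alpha> = r\<^sup>2 * a - r * (b \<bullet> c) + 1/2 * (T c \<bullet> c) + 3 * \<eta> * (c \<bullet> c)"
  have eq: "f x - (b' \<bullet> x + 1/2 * (T x \<bullet> x) + 3 * \<eta> * (x \<bullet> x)) = r\<^sup>2 * \<Phi> ((1 / r) *\<^sub>R (x - c)) + \<alpha>" for x
  proof -
    have main: "r\<^sup>2 * \<Phi> ((1 / r) *\<^sub>R y) = f (c + y) - r\<^sup>2 * a - r * (b \<bullet> y)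
        - 1/2 * (T y \<bullet> y) - 3 * \<eta> * (y \<bullet> y)" for y
    proof -
      have "\<Phi> ((1 / r) *\<^sub>R y) = f (c + y) / r\<^sup>2 - a - (b \<bullet> y) / r - 1/2 * ((T y \<bullet> y) / r\<^sup>2) - 3 * \<eta> * ((y \<bullet> y) / r\<^sup>2)"
        unfolding \<Phi>_def linear_cmul[OF T(1)] using r by (simp add: power2_eq_square)
      then show ?thesis using r by (simp add: right_diff_distrib power2_eq_square)
    qed
    have "r\<^sup>2 * \<Phi> ((1 / r) *\<^sub>R (x - c)) = f x - r\<^sup>2 * a - r * (b \<bullet> (x - c))
        - 1/2 * (T (x - c) \<bullet> (x - c)) - 3 * \<eta> * ((x - c) \<bullet> (x - c))"
      using main[of "x - c"] by simp
    also have "T (x - c) \<bullet> (x - c) = T x \<bullet> x - 2 * (T c \<bullet> x) + T c \<bullet> c"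
      using T(2)[of x c] unfolding linear_diff[OF T(1)] by (simp add: inner_simps inner_commute)
    also have "(x - c) \<bullet> (x - c) = x \<bullet> x - 2 * (c \<bullet> x) + c \<bullet> c" by (simp add: inner_simps inner_commute)
    finally show ?thesis unfolding \<alpha>_def b'_def by (simp add: inner_simps algebra_simps)
  qed
  show ?thesis
  proof (intro exI conjI ballI)
    show "dist x1 c < r" unfolding x1_def using r nh0 by (simp add: dist_norm)
    show "r * (1 - norm h0) > 0" using r nh0 by simp
    fix x assume x: "x \<in> ball x1 (r * (1 - norm h0))"
    have "norm (x - c) \<le> norm (x - x1) + norm (r *\<^sub>R h0)"
      using norm_triangle_ineq[of "x - x1" "r *\<^sub>R h0"] unfolding x1_def by simp
    also have "\<dots> < r" using x r by (simp add: dist_norm norm_minus_commute algebra_simps)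
    finally have "(1 / r) *\<^sub>R (x - c) \<in> cball 0 1" using r by simp
    then have "\<Phi> ((1 / r) *\<^sub>R (x - c)) \<le> \<Phi> ((1 / r) *\<^sub>R (x1 - c))" using h0(2) r unfolding x1_def by simp
    then show "f x - (b' \<bullet> x + 1/2 * (T x \<bullet> x) + 3 * \<eta> * (x \<bullet> x)) \<le>
           f x1 - (b' \<bullet> x1 + 1/2 * (T x1 \<bullet> x1) + 3 * \<eta> * (x1 \<bullet> x1))"
      unfolding eq using r by simp
  qed
qed

text \<open>A replacement for Jensen's lemma combined with Alexandrov's theorem.\<close>

lemma semiconvex_touching_quadratics:
  fixes f g :: "'a::euclidean_space \<Rightarrow> real"
  assumes f: "semiconvex L f" and g: "semiconvex L g" and L: "L \<ge> 0"
    and R: "R > 0" and decay: "\<And>x. R \<le> norm (x - x0) \<Longrightarrow> f x + g x \<le> f x0 + g x0 - norm (x - x0)"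
    and \<beta>: "\<beta> > 0" and \<eta>: "\<eta> > 0"
  shows "\<exists>T b1 b2 x1 x2. linear T \<and> (\<forall>x y. T x \<bullet> y = x \<bullet> T y) \<and>
     f x1 + g x1 > f x0 + g x0 - \<beta> \<and> f x2 + g x2 > f x0 + g x0 - \<beta> \<and>
     (\<exists>e>0. \<forall>x\<in>ball x1 e. f x - (b1 \<bullet> x + 1/2 * (T x \<bullet> x) + \<eta> * (x \<bullet> x)) \<le>
        f x1 - (b1 \<bullet> x1 + 1/2 * (T x1 \<bullet> x1) + \<eta> * (x1 \<bullet> x1))) \<and>
     (\<exists>e>0. \<forall>x\<in>ball x2 e. g x - (b2 \<bullet> x - 1/2 * (T x \<bullet> x) + \<eta> * (x \<bullet> x)) \<le>
        g x2 - (b2 \<bullet> x2 - 1/2 * (T x2 \<bullet> x2) + \<eta> * (x2 \<bullet> x2)))"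
proof -
  define W where "W x = f x + g x" for x
  have cf: "continuous_on UNIV f" and cg: "continuous_on UNIV g"
    using semiconvex_imp_continuous f g by blast+
  have cW: "continuous_on UNIV W" unfolding W_def by (intro continuous_on_add cf cg)
  \<comment> \<open>Slopes up to \<open>1/2\<close> are beaten by the unit rate of decay, so tilted
    maxima stay in the ball; \<open>r0 * R \<le> \<beta> / 2\<close> keeps \<open>W\<close> at
    contact points no more than \<open>\<beta> / 2\<close> below \<open>W x0\<close>.\<close>
  define r0 where "r0 = min (1/2) (\<beta> / (2 * R))"
  have r0: "r0 > 0" "r0 \<le> 1/2" "r0 * R \<le> \<beta> / 2" using \<beta> R by (auto simp: r0_def min_def field_simps)
  \<comment> \<open>Recording the slope with the contact point gives a closed condition on a compact
    product; its projection \<open>K\<close> is therefore compact.\<close>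
  define S where "S = {z \<in> cball x0 R \<times> cball 0 r0. \<forall>x. W x \<le> W (fst z) + snd z \<bullet> (x - fst z)}"
  define K where "K = fst ` S"
  have "compact S"
  proof -
    have "closed {z :: 'a \<times> 'a. \<forall>x. W x \<le> W (fst z) + snd z \<bullet> (x - fst z)}"
    proof (intro closed_Collect_all closed_Collect_le)
      show "continuous_on UNIV (\<lambda>z :: 'a \<times> 'a. W (fst z) + snd z \<bullet> (x - fst z))" for x
        by (intro continuous_intros continuous_on_compose2[OF cW]) auto
    qed (intro continuous_intros)
    then have "compact ((cball x0 R \<times> cball 0 r0) \<inter> {z. \<forall>x. W x \<le> W (fst z) + snd z \<bullet> (x - fst z)})"
      by (intro compact_Int_closed compact_Times compact_cball)
    then show ?thesis unfolding S_def by (simp add: Int_def)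
  qed
  then have K: "compact K" unfolding K_def by (intro compact_continuous_image continuous_intros)
  have Kp: "\<exists>p. norm p \<le> r0 \<and> (\<forall>x. W x \<le> W k + p \<bullet> (x - k))" and KR: "norm (k - x0) \<le> R" if "k \<in> K" for k
    using that unfolding K_def S_def by (auto simp: dist_norm norm_minus_commute)
  have ex: "\<exists>k\<in>K. \<forall>x. W x \<le> W k + p \<bullet> (x - k)" if p: "norm p \<le> r0" for p
  proof -
    have "continuous_on (cball x0 R) (\<lambda>x. W x - p \<bullet> (x - x0))"
      by (intro continuous_intros continuous_on_subset[OF cW]) auto
    then obtain k where k: "k \<in> cball x0 R" "\<And>x. x \<in> cball x0 R \<Longrightarrow> W x - p \<bullet> (x - x0) \<le> W k - p \<bullet> (k - x0)"
      using continuous_attains_sup[of "cball x0 R" "\<lambda>x. W x - p \<bullet> (x - x0)"] R by auto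
    have "W x \<le> W k + p \<bullet> (x - k)" for x
    proof (cases "x \<in> cball x0 R")
      case True
      then show ?thesis using k(2)[OF True] by (simp add: inner_diff_right)
    next
      case False
      then have "W x \<le> W x0 - norm (x - x0)" using decay[of x] unfolding W_def by (simp add: dist_norm norm_minus_commute)
      moreover have "\<bar>p \<bullet> (x - x0)\<bar> \<le> norm (x - x0)"
      proof -
        have "\<bar>p \<bullet> (x - x0)\<bar> \<le> norm p * norm (x - x0)" by (rule Cauchy_Schwarz_ineq2)
        also have "\<dots> \<le> 1 * norm (x - x0)" using p r0 by (intro mult_right_mono) auto
        finally show ?thesis by simp
      qed
      moreover have "W x0 \<le> W k - p \<bullet> (k - x0)" using k(2)[of x0] R by simp
      ultimately show ?thesis by (simp add: inner_diff_right)
    qed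
    moreover from this have "(k, p) \<in> S" unfolding S_def using k(1) p by auto
    then have "k \<in> K" unfolding K_def by force
    ultimately show ?thesis by blast
  qed
  have neg: "\<not> negligible K"
  proof (rule contact_set_not_negligible[OF f g L r0(1)])
    show "\<exists>k\<in>K. \<forall>x. f x + g x \<le> f k + g k + p \<bullet> (x - k)" if "norm p \<le> r0" for p
      using ex[OF that] unfolding W_def .
    show "\<exists>p. \<forall>x. f x + g x \<le> f k + g k + p \<bullet> (x - k)" if "k \<in> K" for k
      using Kp[OF that] unfolding W_def by blast
  qed
  have KW: "W k \<ge> W x0 - \<beta> / 2" if k: "k \<in> K" for k
  proof -
    obtain p where p: "norm p \<le> r0" "\<And>x. W x \<le> W k + p \<bullet> (x - k)" using Kp[OF k] by blast
    have "\<bar>p \<bullet> (x0 - k)\<bar> \<le> norm p * norm (x0 - k)" by (rule Cauchy_Schwarz_ineq2)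
    also have "\<dots> \<le> r0 * R" using p(1) KR[OF k] r0 by (intro mult_mono) (auto simp: norm_minus_commute)
    finally show ?thesis using p(2)[of x0] r0(3) by linarith
  qed
  have "uniformly_continuous_on (cball x0 (R + 1)) W"
    by (intro compact_uniformly_continuous continuous_on_subset[OF cW] compact_cball) simp
  then obtain \<delta> where \<delta>: "\<delta> > 0" and uc: "\<And>x x'. \<lbrakk>x \<in> cball x0 (R + 1); x' \<in> cball x0 (R + 1); dist x' x < \<delta>\<rbrakk> \<Longrightarrow> dist (W x') (W x) < \<beta> / 2"
    unfolding uniformly_continuous_on_def using \<beta> by (meson half_gt_zero)
  have near: "W x > W x0 - \<beta>" if k: "k \<in> K" and d: "dist x k < \<delta>" "dist x k < 1" for x k
  proof -
    have "k \<in> cball x0 (R + 1)" using KR[OF k] by (simp add: dist_norm norm_minus_commute)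
    moreover have "x \<in> cball x0 (R + 1)"
      using KR[OF k] d(2) norm_triangle_ineq[of "x - k" "k - x0"] by (simp add: dist_norm norm_minus_commute)
    ultimately have "dist (W x) (W k) < \<beta> / 2" using uc[of k x] d(1) by simp
    then show ?thesis using KW[OF k] by (simp add: dist_real_def abs_if split: if_splits)
  qed
  have ne: "tame_blowups L f g K \<noteq> {}"
  proof (rule tame_blowups_nonempty[OF f g L K neg])
    show "\<exists>p. \<forall>x. f x + g x \<le> f k + g k + p \<bullet> (x - k)" if "k \<in> K" for k
      using Kp[OF that] unfolding W_def by blast
  qed
  obtain U V a p T where UV: "(U, V) \<in> tame_blowups L f g K" and T: "linear T" "\<And>x y. T x \<bullet> y = x \<bullet> T y"
    and U: "\<And>x. U x = a + p \<bullet> x + 1/2 * (T x \<bullet> x)"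
    using blowup_quadratic[OF blowup_closed_tame_blowups controlled_tame_blowups ne] by blast
  have bl: "(U, V) \<in> blowups f g K" and sU: "semiconvex L U" and sV: "semiconvex L V"
    and conc: "convex_on UNIV (\<lambda>x. - (U x + V x))"
    using UV unfolding tame_blowups_def concave_on_def by blast+
  \<comment> \<open>The supporting plane of the concave sum at the origin puts \<open>V\<close>
    below an affine function minus the quadratic part of \<open>U\<close>. This is where the
    opposite Hessian comes from.\<close>
  obtain s where s: "\<And>x. - (U x + V x) \<ge> - (U 0 + V 0) + s \<bullet> (x - 0)"
    using convex_subgradient[OF conc, of 0] by blast
  define q where "q = - s - p"
  have V: "V x - V 0 - q \<bullet> x \<le> - (1/2 * (T x \<bullet> x))" for x
    using s[of x] U[of x] U[of 0] linear_0[OF T(1)] unfolding q_def by (simp add: inner_simps)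
  \<comment> \<open>One third, since the touching quadratics cost three times the uniform
    error.\<close>
  define \<eta>0 where "\<eta>0 = \<eta> / 3"
  have \<eta>0: "\<eta>0 > 0" using \<eta> by (simp add: \<eta>0_def)
  obtain E1 \<delta>1 where E1: "finite E1" "\<delta>1 > 0" "\<And>G. convex_on UNIV G \<Longrightarrow> (\<forall>x\<in>E1. \<bar>G x - (U x + L / 2 * (x \<bullet> x))\<bar> < \<delta>1) \<Longrightarrow>
      (\<forall>x. norm x \<le> 1 \<longrightarrow> \<bar>G x - (U x + L / 2 * (x \<bullet> x))\<bar> < \<eta>0)"
    using convex_close_on_finite_imp_uniformly_close[OF sU[unfolded semiconvex_def] zero_less_one \<eta>0] by metis
  obtain E2 \<delta>2 where E2: "finite E2" "\<delta>2 > 0" "\<And>G. convex_on UNIV G \<Longrightarrow> (\<forall>x\<in>E2. \<bar>G x - (V x + L / 2 * (x \<bullet> x))\<bar> < \<delta>2) \<Longrightarrow>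
      (\<forall>x. norm x \<le> 1 \<longrightarrow> \<bar>G x - (V x + L / 2 * (x \<bullet> x))\<bar> < \<eta>0)"
    using convex_close_on_finite_imp_uniformly_close[OF sV[unfolded semiconvex_def] zero_less_one \<eta>0] by metis
  define \<eta>' where "\<eta>' = min (min \<delta>1 \<delta>2) (min (\<delta> / 2) (1/2))"
  have \<eta>': "\<eta>' > 0" "\<eta>' \<le> \<delta>1" "\<eta>' \<le> \<delta>2" "\<eta>' \<le> \<delta> / 2" "\<eta>' \<le> 1/2" using E1 E2 \<delta> by (auto simp: \<eta>'_def)
  have "finite (E1 \<union> E2)" using E1 E2 by simp
  from blowupsE[OF bl this \<eta>'(1)] obtain c r a1 d1 a2 d2 k where r: "0 < r" "r < \<eta>'" and k: "k \<in> K" "dist c k < \<eta>'"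
    and cl1: "\<And>h. h \<in> E1 \<union> E2 \<Longrightarrow> \<bar>f (c + r *\<^sub>R h) / r\<^sup>2 - a1 - d1 \<bullet> h - U h\<bar> < \<eta>'"
    and cl2: "\<And>h. h \<in> E1 \<union> E2 \<Longrightarrow> \<bar>g (c + r *\<^sub>R h) / r\<^sup>2 - a2 - d2 \<bullet> h - V h\<bar> < \<eta>'" by metis
  \<comment> \<open>With the common paraboloid added, both functions are convex and closeness on
    \<open>E1\<close> spreads to the unit ball; the paraboloid cancels in the difference.\<close>
  have unif1: "\<bar>f (c + r *\<^sub>R h) / r\<^sup>2 - a1 - d1 \<bullet> h - U h\<bar> < \<eta>0" if "norm h \<le> 1" for h
  proof -
    let ?G = "\<lambda>h. (f (c + r *\<^sub>R h) / r\<^sup>2 + (- a1) + (- d1) \<bullet> h) + L / 2 * (h \<bullet> h)"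
    have "convex_on UNIV ?G"
      using semiconvex_add_affine[OF semiconvex_rescale[OF f r(1), of c], of "- a1" "- d1"] unfolding semiconvex_def .
    moreover have "\<forall>x\<in>E1. \<bar>?G x - (U x + L / 2 * (x \<bullet> x))\<bar> < \<delta>1" using cl1 \<eta>'(2) by force
    ultimately have "\<bar>?G h - (U h + L / 2 * (h \<bullet> h))\<bar> < \<eta>0" using E1(3) that by blast
    then show ?thesis by simp
  qed
  have unif2: "\<bar>g (c + r *\<^sub>R h) / r\<^sup>2 - a2 - d2 \<bullet> h - V h\<bar> < \<eta>0" if "norm h \<le> 1" for h
  proof -
    let ?G = "\<lambda>h. (g (c + r *\<^sub>R h) / r\<^sup>2 + (- a2) + (- d2) \<bullet> h) + L / 2 * (h \<bullet> h)"
    have "convex_on UNIV ?G"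
      using semiconvex_add_affine[OF semiconvex_rescale[OF g r(1), of c], of "- a2" "- d2"] unfolding semiconvex_def .
    moreover have "\<forall>x\<in>E2. \<bar>?G x - (V x + L / 2 * (x \<bullet> x))\<bar> < \<delta>2" using cl2 \<eta>'(3) by force
    ultimately have "\<bar>?G h - (V h + L / 2 * (h \<bullet> h))\<bar> < \<eta>0" using E2(3) that by blast
    then show ?thesis by simp
  qed
  have close: "W x > W x0 - \<beta>" if "dist x c < r" for x
  proof (rule near[OF k(1)])
    have "dist x k \<le> dist x c + dist c k" by (rule dist_triangle)
    then have "dist x k < 2 * \<eta>'" using that r(2) k(2) by linarith
    then show "dist x k < \<delta>" "dist x k < 1" using \<eta>'(4,5) by linarith+
  qed
  have "\<exists>x1 b1. dist x1 c < r \<and> (\<exists>e>0. \<forall>x\<in>ball x1 e.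
           f x - (b1 \<bullet> x + 1/2 * (T x \<bullet> x) + 3 * \<eta>0 * (x \<bullet> x)) \<le>
           f x1 - (b1 \<bullet> x1 + 1/2 * (T x1 \<bullet> x1) + 3 * \<eta>0 * (x1 \<bullet> x1)))"
  proof (rule touching_quadratic[OF cf T r(1) \<eta>0])
    show "f (c + r *\<^sub>R h) / r\<^sup>2 - (a1 + a) - (d1 + p) \<bullet> h \<le> 1/2 * (T h \<bullet> h) + \<eta>0" if "norm h \<le> 1" for h
      using unif1[OF that] U[of h] by (simp add: inner_add_left)
    show "f c / r\<^sup>2 - (a1 + a) \<ge> - \<eta>0"
      using unif1[of 0] U[of 0] linear_0[OF T(1)] by simp
  qed
  then obtain x1 b1 where 1: "dist x1 c < r" "\<exists>e>0. \<forall>x\<in>ball x1 e.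
           f x - (b1 \<bullet> x + 1/2 * (T x \<bullet> x) + \<eta> * (x \<bullet> x)) \<le>
           f x1 - (b1 \<bullet> x1 + 1/2 * (T x1 \<bullet> x1) + \<eta> * (x1 \<bullet> x1))"
    unfolding \<eta>0_def by auto
  have T': "linear (\<lambda>x. - T x)" using T(1) by (simp add: linear_compose_neg)
  have "\<exists>x2 b2. dist x2 c < r \<and> (\<exists>e>0. \<forall>x\<in>ball x2 e.
           g x - (b2 \<bullet> x + 1/2 * (- T x \<bullet> x) + 3 * \<eta>0 * (x \<bullet> x)) \<le>
           g x2 - (b2 \<bullet> x2 + 1/2 * (- T x2 \<bullet> x2) + 3 * \<eta>0 * (x2 \<bullet> x2)))"
  proof (rule touching_quadratic[OF cg T' _ r(1) \<eta>0])
    show "- T x \<bullet> y = x \<bullet> - T y" for x y using T(2) by simp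
    show "g (c + r *\<^sub>R h) / r\<^sup>2 - (a2 + V 0) - (d2 + q) \<bullet> h \<le> 1/2 * (- T h \<bullet> h) + \<eta>0" if "norm h \<le> 1" for h
      using unif2[OF that] V[of h] by (simp add: inner_add_left)
    show "g c / r\<^sup>2 - (a2 + V 0) \<ge> - \<eta>0"
      using unif2[of 0] by simp
  qed
  then obtain x2 b2 where 2: "dist x2 c < r" "\<exists>e>0. \<forall>x\<in>ball x2 e.
           g x - (b2 \<bullet> x - 1/2 * (T x \<bullet> x) + \<eta> * (x \<bullet> x)) \<le>
           g x2 - (b2 \<bullet> x2 - 1/2 * (T x2 \<bullet> x2) + \<eta> * (x2 \<bullet> x2))"
    unfolding \<eta>0_def by auto
  show ?thesis
    using T 1(2) 2(2) close[OF 1(1)] close[OF 2(1)] unfolding W_def by blast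
qed

section \<open>Doubling by sup-convolution\<close>

text \<open>Sup-convolution in space together with maximisation over time. Adding
  \<open>L / 2 * (x \<bullet> x)\<close> makes every competitor affine in \<open>x\<close>, so the
  maximum is semiconvex; in the proof the maximiser at the intermediate point competes at both
  endpoints.\<close>

lemma sup_convolution_exists:
  fixes w :: "'a::euclidean_space \<Rightarrow> real \<Rightarrow> real"
  assumes Y: "compact Y" "Y \<noteq> {}" and w: "continuous_on Y (\<lambda>p. w (fst p) (snd p))"
  shows "\<exists>f. semiconvex L f \<and>
    (\<forall>x. \<exists>y t. (y, t) \<in> Y \<and> f x = w y t - L / 2 * ((x - y) \<bullet> (x - y))) \<and>
    (\<forall>x y t. (y, t) \<in> Y \<longrightarrow> w y t - L / 2 * ((x - y) \<bullet> (x - y)) \<le> f x)"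
proof -
  have "\<exists>y t. (y, t) \<in> Y \<and> (\<forall>y' t'. (y', t') \<in> Y \<longrightarrow>
      w y' t' - L / 2 * ((x - y') \<bullet> (x - y')) \<le> w y t - L / 2 * ((x - y) \<bullet> (x - y)))" for x
  proof -
    have "continuous_on Y (\<lambda>p. w (fst p) (snd p) - L / 2 * ((x - fst p) \<bullet> (x - fst p)))"
      by (intro continuous_intros w)
    from continuous_attains_sup[OF Y this] obtain p where p: "p \<in> Y" "\<And>q. q \<in> Y \<Longrightarrow>
        w (fst q) (snd q) - L / 2 * ((x - fst q) \<bullet> (x - fst q)) \<le> w (fst p) (snd p) - L / 2 * ((x - fst p) \<bullet> (x - fst p))"
      by blast
    show ?thesis
    proof (intro exI conjI allI impI)
      show "(fst p, snd p) \<in> Y" using p(1) by simp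
      fix y' t' assume "(y', t') \<in> Y"
      from p(2)[OF this] show "w y' t' - L / 2 * ((x - y') \<bullet> (x - y')) \<le>
          w (fst p) (snd p) - L / 2 * ((x - fst p) \<bullet> (x - fst p))" by simp
    qed
  qed
  then obtain y t where yt: "\<And>x. (y x, t x) \<in> Y" and max: "\<And>x y' t'. (y', t') \<in> Y \<Longrightarrow>
      w y' t' - L / 2 * ((x - y') \<bullet> (x - y')) \<le> w (y x) (t x) - L / 2 * ((x - y x) \<bullet> (x - y x))"
    by metis
  define f where "f x = w (y x) (t x) - L / 2 * ((x - y x) \<bullet> (x - y x))" for x
  have ge: "w y' t' - L / 2 * ((x - y') \<bullet> (x - y')) \<le> f x" if "(y', t') \<in> Y" for x y' t'
    using max[OF that] unfolding f_def .
  have "semiconvex L f" unfolding semiconvex_iff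
  proof (intro allI impI)
    fix a b :: 'a and s :: real assume s: "0 \<le> s" "s \<le> 1"
    define z where "z = (1 - s) *\<^sub>R a + s *\<^sub>R b"
    define q where "q = y z"
    have zq: "(z - q) \<bullet> (z - q) = (1 - s) * ((a - q) \<bullet> (a - q)) + s * ((b - q) \<bullet> (b - q)) - s * (1 - s) * ((a - b) \<bullet> (a - b))"
      unfolding z_def by (simp add: inner_simps inner_commute algebra_simps)
    have "W - L / 2 * ((1 - s) * X + s * X' - s * (1 - s) * Z) = (1 - s) * (W - L / 2 * X) + s * (W - L / 2 * X')
        + L / 2 * (s * (1 - s) * Z)" for W X X' Z
      by (simp add: field_simps)
    then have "f z = (1 - s) * (w q (t z) - L / 2 * ((a - q) \<bullet> (a - q))) + s * (w q (t z) - L / 2 * ((b - q) \<bullet> (b - q)))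
        + L / 2 * (s * (1 - s) * ((a - b) \<bullet> (a - b)))"
      unfolding f_def q_def[symmetric] zq .
    also have "\<dots> \<le> (1 - s) * f a + s * f b + L / 2 * (s * (1 - s) * ((a - b) \<bullet> (a - b)))"
      using ge[OF yt[of z], of a] ge[OF yt[of z], of b] s unfolding q_def
      by (intro add_right_mono add_mono mult_left_mono) auto
    finally show "f ((1 - s) *\<^sub>R a + s *\<^sub>R b) \<le> (1 - s) * f a + s * f b + L / 2 * (s * (1 - s) * ((a - b) \<bullet> (a - b)))"
      unfolding z_def .
  qed
  moreover have "\<exists>y' t'. (y', t') \<in> Y \<and> f x = w y' t' - L / 2 * ((x - y') \<bullet> (x - y'))" for x
    using yt[of x] unfolding f_def by blast
  ultimately show ?thesis using ge by blast
qed

text \<open>With \<open>s = x1 - y1\<close> fixed,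
  \<open>w y t - L / 2 * (s \<bullet> s) \<le> f (y + s)\<close>, with equality at \<open>y1\<close>
  and \<open>t1\<close>. A quadratic above \<open>f\<close> at \<open>x1\<close>, translated by
  \<open>s\<close>, is thus above \<open>w\<close> at \<open>y1\<close>, with the same Hessian and
  uniformly in time.\<close>

lemma sup_convolution_touching:
  fixes w :: "'a::euclidean_space \<Rightarrow> real \<Rightarrow> real"
  assumes T: "linear T" "\<And>x y. T x \<bullet> y = x \<bullet> T y"
    and y1: "f x1 = w y1 t1 - L / 2 * ((x1 - y1) \<bullet> (x1 - y1))"
    and ge: "\<And>x y t. (y, t) \<in> Y \<Longrightarrow> w y t - L / 2 * ((x - y) \<bullet> (x - y)) \<le> f x"
    and e: "\<exists>e>0. \<forall>x\<in>ball x1 e. f x - (b \<bullet> x + 1/2 * (T x \<bullet> x) + \<eta> * (x \<bullet> x)) \<le>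
        f x1 - (b \<bullet> x1 + 1/2 * (T x1 \<bullet> x1) + \<eta> * (x1 \<bullet> x1))"
  shows "\<exists>b'. \<exists>e>0. \<forall>(y, t)\<in>Y. y \<in> ball y1 e \<longrightarrow>
     w y t - (b' \<bullet> y + 1/2 * (T y \<bullet> y) + \<eta> * (y \<bullet> y)) \<le>
     w y1 t1 - (b' \<bullet> y1 + 1/2 * (T y1 \<bullet> y1) + \<eta> * (y1 \<bullet> y1))"
proof -
  define s where "s = x1 - y1"
  define b' where "b' = b + T s + (2 * \<eta>) *\<^sub>R s"
  define \<alpha> where "\<alpha> = b \<bullet> s + 1/2 * (T s \<bullet> s) + \<eta> * (s \<bullet> s)"
  have shift: "b \<bullet> (y + s) + 1/2 * (T (y + s) \<bullet> (y + s)) + \<eta> * ((y + s) \<bullet> (y + s)) =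
      b' \<bullet> y + 1/2 * (T y \<bullet> y) + \<eta> * (y \<bullet> y) + \<alpha>" for y
    using T(2)[of y s] unfolding b'_def \<alpha>_def linear_add[OF T(1)]
    by (simp add: inner_simps inner_commute algebra_simps)
  obtain e where e: "e > 0" "\<And>x. x \<in> ball x1 e \<Longrightarrow> f x - (b \<bullet> x + 1/2 * (T x \<bullet> x) + \<eta> * (x \<bullet> x)) \<le>
        f x1 - (b \<bullet> x1 + 1/2 * (T x1 \<bullet> x1) + \<eta> * (x1 \<bullet> x1))" using assms(5) by blast
  show ?thesis
  proof (intro exI conjI)
    show "e > 0" by (rule e)
    show "\<forall>(y, t)\<in>Y. y \<in> ball y1 e \<longrightarrow>
     w y t - (b' \<bullet> y + 1/2 * (T y \<bullet> y) + \<eta> * (y \<bullet> y)) \<le>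
     w y1 t1 - (b' \<bullet> y1 + 1/2 * (T y1 \<bullet> y1) + \<eta> * (y1 \<bullet> y1))"
    proof (clarify)
      fix y t assume yt: "(y, t) \<in> Y" and y: "y \<in> ball y1 e"
      have "x1 - (y + s) = y1 - y" unfolding s_def by simp
      then have "y + s \<in> ball x1 e" using y unfolding mem_ball dist_norm by (simp only:)
      from e(2)[OF this] shift[of y] shift[of y1]
      have "f (y + s) - (b' \<bullet> y + 1/2 * (T y \<bullet> y) + \<eta> * (y \<bullet> y)) \<le>
          f x1 - (b' \<bullet> y1 + 1/2 * (T y1 \<bullet> y1) + \<eta> * (y1 \<bullet> y1))" by (simp add: s_def)
      moreover have "w y t - L / 2 * (s \<bullet> s) \<le> f (y + s)" using ge[OF yt, of "y + s"] by simp
      moreover have "f x1 = w y1 t1 - L / 2 * (s \<bullet> s)" using y1 unfolding s_def .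
      ultimately show "w y t - (b' \<bullet> y + 1/2 * (T y \<bullet> y) + \<eta> * (y \<bullet> y)) \<le>
          w y1 t1 - (b' \<bullet> y1 + 1/2 * (T y1 \<bullet> y1) + \<eta> * (y1 \<bullet> y1))" by linarith
    qed
  qed
qed

text \<open>Each function is touched at its own point by a quadratic independent of time. Positivity
  of the sum at both points is kept because it later forces them off the boundary and the end
  times.\<close>

lemma doubling_touching_quadratics:
  fixes u1 u2 :: "'a::euclidean_space \<Rightarrow> real \<Rightarrow> real"
  assumes C: "compact C" and c1: "continuous_on (C \<times> {0..\<tau>}) (\<lambda>p. u1 (fst p) (snd p))"
    and c2: "continuous_on (C \<times> {0..\<tau>}) (\<lambda>p. u2 (fst p) (snd p))"
    and x0: "x0 \<in> C" "t0 \<in> {0..\<tau>}" "s0 \<in> {0..\<tau>}" and pos: "u1 x0 t0 + u2 x0 s0 > 0" and \<eta>: "\<eta> > 0"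
  shows "\<exists>T b1 b2 y1 t1 s1 y2 t2 s2. linear T \<and> (\<forall>x y. T x \<bullet> y = x \<bullet> T y) \<and>
     y1 \<in> C \<and> t1 \<in> {0..\<tau>} \<and> s1 \<in> {0..\<tau>} \<and> u1 y1 t1 + u2 y1 s1 > 0 \<and>
     y2 \<in> C \<and> t2 \<in> {0..\<tau>} \<and> s2 \<in> {0..\<tau>} \<and> u1 y2 s2 + u2 y2 t2 > 0 \<and>
     (\<exists>e>0. \<forall>(y, t)\<in>C \<times> {0..\<tau>}. y \<in> ball y1 e \<longrightarrow>
       u1 y t - (b1 \<bullet> y + 1/2 * (T y \<bullet> y) + \<eta> * (y \<bullet> y)) \<le> u1 y1 t1 - (b1 \<bullet> y1 + 1/2 * (T y1 \<bullet> y1) + \<eta> * (y1 \<bullet> y1))) \<and>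
     (\<exists>e>0. \<forall>(y, t)\<in>C \<times> {0..\<tau>}. y \<in> ball y2 e \<longrightarrow>
       u2 y t - (b2 \<bullet> y - 1/2 * (T y \<bullet> y) + \<eta> * (y \<bullet> y)) \<le> u2 y2 t2 - (b2 \<bullet> y2 - 1/2 * (T y2 \<bullet> y2) + \<eta> * (y2 \<bullet> y2)))"
proof -
  let ?Y = "C \<times> {0..\<tau>}"
  have Y: "compact ?Y" "?Y \<noteq> {}" using C x0 by (auto intro: compact_Times)
  define m where "m = u1 x0 t0 + u2 x0 s0"
  have m: "m > 0" using pos by (simp add: m_def)
  have "\<exists>B. \<forall>y t. (y, t) \<in> ?Y \<longrightarrow> \<bar>w y t\<bar> \<le> B" if "continuous_on ?Y (\<lambda>p. w (fst p) (snd p))" for w :: "'a \<Rightarrow> real \<Rightarrow> real"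
  proof -
    have "bounded ((\<lambda>p. w (fst p) (snd p)) ` ?Y)"
      by (intro compact_imp_bounded compact_continuous_image that Y)
    then show ?thesis unfolding bounded_iff by force
  qed
  from this[OF c1] this[OF c2] obtain B1 B2 where
    B12: "\<And>y t. (y, t) \<in> ?Y \<Longrightarrow> \<bar>u1 y t\<bar> \<le> B1" "\<And>y t. (y, t) \<in> ?Y \<Longrightarrow> \<bar>u2 y t\<bar> \<le> B2" by blast
  define B where "B = max B1 B2 + 1"
  have B: "\<bar>u1 y t\<bar> \<le> B" "\<bar>u2 y t\<bar> \<le> B" if "(y, t) \<in> ?Y" for y t using B12[OF that] unfolding B_def by auto
  have B0: "B > 0" using B12(1)[of x0 t0] x0 unfolding B_def by auto
  obtain D where D: "D > 0" "\<And>y. y \<in> C \<Longrightarrow> norm (y - x0) \<le> D"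
  proof -
    have "bounded ((\<lambda>y. y - x0) ` C)" using C by (intro compact_imp_bounded compact_continuous_image continuous_intros)
    then show thesis using that unfolding bounded_pos by auto
  qed
  have uc: "\<exists>\<rho>>0. \<forall>y y' t. y \<in> C \<longrightarrow> y' \<in> C \<longrightarrow> t \<in> {0..\<tau>} \<longrightarrow> dist y y' < \<rho> \<longrightarrow> \<bar>w y t - w y' t\<bar> < m / 4"
    if cw: "continuous_on ?Y (\<lambda>p. w (fst p) (snd p))" for w :: "'a \<Rightarrow> real \<Rightarrow> real"
  proof -
    have "m / 4 > 0" using m by simp
    then obtain \<rho> where \<rho>: "\<rho> > 0" "\<And>p p'. p \<in> ?Y \<Longrightarrow> p' \<in> ?Y \<Longrightarrow> dist p' p < \<rho> \<Longrightarrow>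
        dist (w (fst p') (snd p')) (w (fst p) (snd p)) < m / 4"
      using compact_uniformly_continuous[OF cw Y(1)] unfolding uniformly_continuous_on_def by metis
    show ?thesis
    proof (intro exI conjI allI impI)
      fix y y' t assume "y \<in> C" "y' \<in> C" "t \<in> {0..\<tau>}" "dist y y' < \<rho>"
      then show "\<bar>w y t - w y' t\<bar> < m / 4" using \<rho>(2)[of "(y', t)" "(y, t)"] by (simp add: dist_Pair_Pair dist_real_def)
    qed (rule \<rho>)
  qed
  obtain \<rho>1 where \<rho>1: "\<rho>1 > 0" "\<And>y y' t. \<lbrakk>y \<in> C; y' \<in> C; t \<in> {0..\<tau>}; dist y y' < \<rho>1\<rbrakk> \<Longrightarrow> \<bar>u1 y t - u1 y' t\<bar> < m / 4"
    using uc[OF c1] by blast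
  obtain \<rho>2 where \<rho>2: "\<rho>2 > 0" "\<And>y y' t. \<lbrakk>y \<in> C; y' \<in> C; t \<in> {0..\<tau>}; dist y y' < \<rho>2\<rbrakk> \<Longrightarrow> \<bar>u2 y t - u2 y' t\<bar> < m / 4"
    using uc[OF c2] by blast
  define \<rho> where "\<rho> = min \<rho>1 \<rho>2"
  have \<rho>: "\<rho> > 0" "\<rho> \<le> \<rho>1" "\<rho> \<le> \<rho>2" using \<rho>1 \<rho>2 by (auto simp: \<rho>_def)
  \<comment> \<open>A displacement of \<open>\<rho> / 2\<close> would cost at least
    \<open>4 * B\<close>, while \<open>u1 + u2\<close> never exceeds \<open>2 * B\<close>;
    near-maximality of the sum thus keeps both optimisers within \<open>\<rho> / 2\<close>.\<close>
  define L where "L = max 1 (32 * B / \<rho>\<^sup>2)"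
  have L: "L \<ge> 1" "32 * B \<le> L * \<rho>\<^sup>2"
    unfolding L_def using \<rho> by (auto simp: max_def field_simps)
  obtain f where f: "semiconvex L f" and fex: "\<And>x. \<exists>y t. (y, t) \<in> ?Y \<and> f x = u1 y t - L / 2 * ((x - y) \<bullet> (x - y))"
    and fge: "\<And>x y t. (y, t) \<in> ?Y \<Longrightarrow> u1 y t - L / 2 * ((x - y) \<bullet> (x - y)) \<le> f x"
    using sup_convolution_exists[OF Y c1, of L] by blast
  obtain g where g: "semiconvex L g" and gex: "\<And>x. \<exists>y t. (y, t) \<in> ?Y \<and> g x = u2 y t - L / 2 * ((x - y) \<bullet> (x - y))"
    and gge: "\<And>x y t. (y, t) \<in> ?Y \<Longrightarrow> u2 y t - L / 2 * ((x - y) \<bullet> (x - y)) \<le> g x"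
    using sup_convolution_exists[OF Y c2, of L] by blast
  have Wx0: "f x0 + g x0 \<ge> m" using fge[of x0 t0 x0] gge[of x0 s0 x0] x0 unfolding m_def by simp
  \<comment> \<open>For \<open>d \<ge> 2 * D\<close> the distance to \<open>C\<close> is at least
    \<open>d / 2\<close>, and for \<open>d \<ge> 4 + 8 * B\<close> the two penalties of
    \<open>d\<^sup>2 / 8\<close> outweigh \<open>2 * B + d\<close>.\<close>
  define R where "R = 2 * D + 4 + 8 * B"
  have R: "R > 0" using D B0 by (simp add: R_def)
  have decay: "f x + g x \<le> f x0 + g x0 - norm (x - x0)" if x: "R \<le> norm (x - x0)" for x
  proof -
    define d where "d = norm (x - x0)"
    have d: "d \<ge> 2 * D" "d \<ge> 4 + 8 * B" using x D B0 unfolding R_def d_def by auto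
    have far: "L / 2 * ((x - y) \<bullet> (x - y)) \<ge> d\<^sup>2 / 8" if "y \<in> C" for y
    proof -
      have "norm (x - y) \<ge> d / 2"
        using norm_triangle_ineq[of "x - y" "y - x0"] D(2)[OF that] d(1) unfolding d_def by simp
      then have "(d / 2)\<^sup>2 \<le> (x - y) \<bullet> (x - y)" unfolding dot_square_norm using d D by (intro power_mono) auto
      moreover have "1 * ((x - y) \<bullet> (x - y)) \<le> L * ((x - y) \<bullet> (x - y))" using L by (intro mult_right_mono) auto
      ultimately show ?thesis by (simp add: power_divide)
    qed
    obtain y t where y: "(y, t) \<in> ?Y" "f x = u1 y t - L / 2 * ((x - y) \<bullet> (x - y))" using fex by blast
    obtain y' t' where y': "(y', t') \<in> ?Y" "g x = u2 y' t' - L / 2 * ((x - y') \<bullet> (x - y'))" using gex by blast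
    have "f x \<le> B - d\<^sup>2 / 8" using y(2) far[of y] B(1)[OF y(1)] y(1) by auto
    moreover have "g x \<le> B - d\<^sup>2 / 8" using y'(2) far[of y'] B(2)[OF y'(1)] y'(1) by auto
    moreover have "2 * B + d \<le> d\<^sup>2 / 4"
    proof -
      have "d * (4 + 8 * B) \<le> d * d" using d B0 by (intro mult_left_mono) auto
      moreover have "1 * (8 * B) \<le> d * (8 * B)" using d B0 by (intro mult_right_mono) auto
      ultimately show ?thesis by (simp add: power2_eq_square algebra_simps)
    qed
    ultimately show ?thesis using Wx0 m unfolding d_def[symmetric] by linarith
  qed
  have near: "dist y y' < \<rho> \<and> u1 y t + u2 y' t' > m / 2"
    if y: "(y, t) \<in> ?Y" "f x = u1 y t - L / 2 * ((x - y) \<bullet> (x - y))"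
      and y': "(y', t') \<in> ?Y" "g x = u2 y' t' - L / 2 * ((x - y') \<bullet> (x - y'))"
      and W: "f x + g x > f x0 + g x0 - m / 2" for x y t y' t'
  proof -
    have 1: "u1 y t + u2 y' t' - L / 2 * ((x - y) \<bullet> (x - y)) - L / 2 * ((x - y') \<bullet> (x - y')) > m / 2"
      using W Wx0 y(2) y'(2) by linarith
    have 2: "L / 2 * ((x - y) \<bullet> (x - y)) \<ge> 0" "L / 2 * ((x - y') \<bullet> (x - y')) \<ge> 0" using L by auto
    have small: "norm z < \<rho> / 2" if "L / 2 * (z \<bullet> z) < 2 * B" for z :: 'a
    proof (rule ccontr)
      assume "\<not> norm z < \<rho> / 2"
      then have "(\<rho> / 2)\<^sup>2 \<le> z \<bullet> z" unfolding dot_square_norm using \<rho> by (intro power_mono) auto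
      then have "L * (\<rho> / 2)\<^sup>2 \<le> L * (z \<bullet> z)" using L by (intro mult_left_mono) auto
      then have "L * \<rho>\<^sup>2 / 4 \<le> L * (z \<bullet> z)" by (simp add: power_divide)
      then show False using that L(2) B0 by linarith
    qed
    have "u1 y t + u2 y' t' \<le> 2 * B" using B(1)[OF y(1)] B(2)[OF y'(1)] by linarith
    then have "norm (x - y) < \<rho> / 2" "norm (x - y') < \<rho> / 2" using 1 2 m by (intro small; linarith)+
    then have "dist y y' < \<rho>" using norm_triangle_ineq4[of "x - y'" "x - y"] by (simp add: dist_norm norm_minus_commute)
    then show ?thesis using 1 2 by linarith
  qed
  have m2: "m / 2 > 0" using m by simp
  have L0: "L \<ge> 0" using L by simp
  obtain T b1 b2 x1 x2 where T: "linear T" "\<And>x y. T x \<bullet> y = x \<bullet> T y"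
    and W1: "f x1 + g x1 > f x0 + g x0 - m / 2" and W2: "f x2 + g x2 > f x0 + g x0 - m / 2"
    and t1: "\<exists>e>0. \<forall>x\<in>ball x1 e. f x - (b1 \<bullet> x + 1/2 * (T x \<bullet> x) + \<eta> * (x \<bullet> x)) \<le>
        f x1 - (b1 \<bullet> x1 + 1/2 * (T x1 \<bullet> x1) + \<eta> * (x1 \<bullet> x1))"
    and t2: "\<exists>e>0. \<forall>x\<in>ball x2 e. g x - (b2 \<bullet> x - 1/2 * (T x \<bullet> x) + \<eta> * (x \<bullet> x)) \<le>
        g x2 - (b2 \<bullet> x2 - 1/2 * (T x2 \<bullet> x2) + \<eta> * (x2 \<bullet> x2))"
    using semiconvex_touching_quadratics[OF f g L0 R decay m2 \<eta>] by blast
  obtain y1 s1 where y1: "(y1, s1) \<in> ?Y" "f x1 = u1 y1 s1 - L / 2 * ((x1 - y1) \<bullet> (x1 - y1))" using fex by blast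
  obtain y1' s1' where y1': "(y1', s1') \<in> ?Y" "g x1 = u2 y1' s1' - L / 2 * ((x1 - y1') \<bullet> (x1 - y1'))" using gex by blast
  obtain y2 s2 where y2: "(y2, s2) \<in> ?Y" "f x2 = u1 y2 s2 - L / 2 * ((x2 - y2) \<bullet> (x2 - y2))" using fex by blast
  obtain y2' s2' where y2': "(y2', s2') \<in> ?Y" "g x2 = u2 y2' s2' - L / 2 * ((x2 - y2') \<bullet> (x2 - y2'))" using gex by blast
  \<comment> \<open>The optimisers of \<open>f\<close> and \<open>g\<close> at \<open>x1\<close> may
    differ, but by less than \<open>\<rho>\<close>; moving \<open>u2\<close> to the point where
    \<open>u1\<close> is touched costs less than \<open>m / 4\<close>. For \<open>p2\<close> the
    roles are exchanged.\<close>
  have p1: "u1 y1 s1 + u2 y1 s1' > 0"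
  proof -
    have "dist y1 y1' < \<rho>" "u1 y1 s1 + u2 y1' s1' > m / 2" using near[OF y1 y1' W1] by auto
    moreover from this(1) have "\<bar>u2 y1 s1' - u2 y1' s1'\<bar> < m / 4"
      using \<rho>2(2)[of y1 y1' s1'] \<rho>(3) y1(1) y1'(1) by auto
    ultimately show ?thesis using m by linarith
  qed
  have p2: "u1 y2' s2 + u2 y2' s2' > 0"
  proof -
    have "dist y2 y2' < \<rho>" "u1 y2 s2 + u2 y2' s2' > m / 2" using near[OF y2 y2' W2] by auto
    moreover from this(1) have "\<bar>u1 y2 s2 - u1 y2' s2\<bar> < m / 4"
      using \<rho>1(2)[of y2 y2' s2] \<rho>(2) y2(1) y2'(1) by auto
    ultimately show ?thesis using m by linarith
  qed
  obtain b1' where b1': "\<exists>e>0. \<forall>(y, t)\<in>?Y. y \<in> ball y1 e \<longrightarrow>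
     u1 y t - (b1' \<bullet> y + 1/2 * (T y \<bullet> y) + \<eta> * (y \<bullet> y)) \<le>
     u1 y1 s1 - (b1' \<bullet> y1 + 1/2 * (T y1 \<bullet> y1) + \<eta> * (y1 \<bullet> y1))"
    using sup_convolution_touching[of T f x1 u1 y1 s1 L ?Y b1 \<eta>, OF T y1(2) fge t1] by auto
  have T': "linear (\<lambda>x. - T x)" "\<And>x y. - T x \<bullet> y = x \<bullet> - T y" using T by (auto simp: linear_compose_neg)
  obtain b2' where b2': "\<exists>e>0. \<forall>(y, t)\<in>?Y. y \<in> ball y2' e \<longrightarrow>
     u2 y t - (b2' \<bullet> y + 1/2 * (- T y \<bullet> y) + \<eta> * (y \<bullet> y)) \<le>
     u2 y2' s2' - (b2' \<bullet> y2' + 1/2 * (- T y2' \<bullet> y2') + \<eta> * (y2' \<bullet> y2'))"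
    using sup_convolution_touching[of "\<lambda>x. - T x" g x2 u2 y2' s2' L ?Y b2 \<eta>, OF T' y2'(2) gge] t2 by auto
  have "(\<exists>e>0. \<forall>(y, t)\<in>?Y. y \<in> ball y2' e \<longrightarrow>
       u2 y t - (b2' \<bullet> y - 1/2 * (T y \<bullet> y) + \<eta> * (y \<bullet> y)) \<le> u2 y2' s2' - (b2' \<bullet> y2' - 1/2 * (T y2' \<bullet> y2') + \<eta> * (y2' \<bullet> y2')))"
    using b2' by simp
  moreover have "y1 \<in> C" "s1 \<in> {0..\<tau>}" "s1' \<in> {0..\<tau>}" "y2' \<in> C" "s2' \<in> {0..\<tau>}" "s2 \<in> {0..\<tau>}"
    using y1(1) y1'(1) y2(1) y2'(1) by auto
  ultimately show ?thesis using T p1 p2 b1' by blast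
qed

section \<open>Viscosity test functions and the exponential bound\<close>

text \<open>Rayleigh quotients are compared subspace by subspace. Since \<open>Sup\<close> and
  \<open>Inf\<close> are those of the reals, nonemptiness and boundedness matter:
  \<open>1 \<le> j\<close> provides unit vectors, \<open>j \<le> CARD('n)\<close> provides a
  subspace of dimension \<open>j\<close>.\<close>

lemma eig_j_le:
  fixes A B :: "real^'n^'n"
  assumes j: "1 \<le> j" "j \<le> CARD('n)" and le: "\<And>v. (A *v v) \<bullet> v \<le> (B *v v) \<bullet> v + c * (v \<bullet> v)"
  shows "eig_j j A \<le> eig_j j B + c"
proof -
  let ?S = "{S :: (real^'n) set. subspace S \<and> dim S = j}"
  let ?sup = "\<lambda>A S. Sup ((\<lambda>v. (A *v v) \<bullet> v) ` {v \<in> S. norm v = 1})"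
  have bdd: "\<exists>K. \<forall>v. norm v = 1 \<longrightarrow> \<bar>(A *v v) \<bullet> v\<bar> \<le> K" for A :: "real^'n^'n"
  proof -
    obtain K where K: "\<And>v. norm (A *v v) \<le> K * norm v"
      using linear_bounded[OF matrix_vector_mul_linear[of A]] by blast
    have "\<bar>(A *v v) \<bullet> v\<bar> \<le> K" if "norm v = 1" for v
      using Cauchy_Schwarz_ineq2[of "A *v v" v] K[of v] that by simp
    then show ?thesis by blast
  qed
  have ne: "{v \<in> S. norm v = 1} \<noteq> {}" if "S \<in> ?S" for S
  proof -
    have "\<not> S \<subseteq> {0}" using that j by (metis (mono_tags, lifting) dim_eq_0 mem_Collect_eq not_one_le_zero)
    then obtain w where w: "w \<in> S" "w \<noteq> 0" by blast
    then have "(1 / norm w) *\<^sub>R w \<in> S" "norm ((1 / norm w) *\<^sub>R w) = 1"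
      using that by (auto intro: subspace_scale)
    then show ?thesis by blast
  qed
  have bda: "bdd_above ((\<lambda>v. (A *v v) \<bullet> v) ` {v \<in> S. norm v = 1})" for A and S :: "(real^'n) set"
    using bdd[of A] by (force simp: bdd_above_def abs_le_iff)
  have sup_le: "?sup A S \<le> ?sup B S + c" if "S \<in> ?S" for S
  proof (rule cSUP_least[OF ne[OF that]])
    fix v assume v: "v \<in> {v \<in> S. norm v = 1}"
    then have "(B *v v) \<bullet> v \<le> ?sup B S" by (intro cSUP_upper bda)
    moreover have "v \<bullet> v = 1" using v by (simp add: dot_square_norm)
    ultimately show "(A *v v) \<bullet> v \<le> ?sup B S + c" using le[of v] by simp
  qed
  obtain K where K: "\<And>v. norm v = 1 \<Longrightarrow> \<bar>(A *v v) \<bullet> v\<bar> \<le> K" using bdd by blast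
  have "- K \<le> ?sup A S" if S: "S \<in> ?S" for S
  proof -
    obtain v where v: "v \<in> {v \<in> S. norm v = 1}" using ne[OF S] by blast
    then have "(A *v v) \<bullet> v \<le> ?sup A S" by (intro cSUP_upper bda)
    then show ?thesis using K[of v] v by simp
  qed
  then have bdb: "bdd_below (?sup A ` ?S)" unfolding bdd_below_def by blast
  obtain S0 :: "(real^'n) set" where "subspace S0" "dim S0 = j"
    using choose_subspace_of_subspace[of j "UNIV :: (real^'n) set"] j by (auto simp: dim_UNIV)
  then have S_ne: "?S \<noteq> {}" by blast
  have "eig_j j A - c \<le> eig_j j B"
    unfolding eig_j_def
  proof (rule cINF_greatest[OF S_ne])
    fix S assume S: "S \<in> ?S"
    have "Inf (?sup A ` ?S) \<le> ?sup A S" by (rule cINF_lower[OF bdb S])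
    then show "Inf (?sup A ` ?S) - c \<le> ?sup B S" using sup_le[OF S] by linarith
  qed
  then show ?thesis by simp
qed

section \<open>Smooth test functions and their Hessians\<close>

lemma C2_fun_quadratic:
  fixes S :: "real^'n \<Rightarrow> real^'n"
  assumes S: "linear S" "\<And>x y. S x \<bullet> y = x \<bullet> S y"
  shows "C2_fun (\<lambda>x. b \<bullet> x + 1/2 * (S x \<bullet> x)) (\<lambda>x. b + S x) (\<lambda>_. S)"
  unfolding C2_fun_def
proof (intro conjI allI)
  have symm: "x \<bullet> S y = y \<bullet> S x" for x y using S(2)[of x y] inner_commute[of "S x" y] by simp
  have bl: "bounded_linear S" using S(1) by (simp add: linear_conv_bounded_linear)
  have dS: "(S has_derivative S) (at x)" for x by (rule bounded_linear_imp_has_derivative[OF bl])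
  have dq: "((\<lambda>x. 1/2 * (S x \<bullet> x)) has_derivative (\<lambda>h. S x \<bullet> h)) (at x)" for x
  proof (rule has_derivative_eq_rhs)
    show "((\<lambda>x. 1/2 * (S x \<bullet> x)) has_derivative (\<lambda>h. 1/2 * (S x \<bullet> h + S h \<bullet> x))) (at x)"
      by (intro has_derivative_mult_right has_derivative_inner dS has_derivative_ident)
    show "(\<lambda>h. 1/2 * (S x \<bullet> h + S h \<bullet> x)) = (\<lambda>h. S x \<bullet> h)"
      using S(2) symm by (auto simp: fun_eq_iff)
  qed
  show "((\<lambda>x. b \<bullet> x + 1/2 * (S x \<bullet> x)) has_derivative (\<lambda>h. (b + S x) \<bullet> h)) (at x)" for x
    unfolding inner_add_left
    by (intro has_derivative_add dq has_derivative_inner_right has_derivative_ident)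
  show "((\<lambda>x. b + S x) has_derivative S) (at x)" for x
    using has_derivative_add[OF has_derivative_const dS, of b x] by simp
qed (intro continuous_intros)

lemma C2_fun_space_time:
  fixes S :: "real^'n \<Rightarrow> real^'n"
  assumes S: "linear S" "\<And>x y. S x \<bullet> y = x \<bullet> S y"
    and A: "\<And>t. (A has_real_derivative A1 t) (at t)" "\<And>t. (A1 has_real_derivative A2 t) (at t)" "continuous_on UNIV A2"
    and k: "\<And>t. (k has_real_derivative k1 t) (at t)" "\<And>t. (k1 has_real_derivative k2 t) (at t)" "continuous_on UNIV k2"
  shows "C2_fun (\<lambda>p. b \<bullet> fst p + 1/2 * (S (fst p) \<bullet> fst p) + A (snd p) * (Q - fst p \<bullet> fst p) + k (snd p))
     (\<lambda>p. (b + S (fst p) - (2 * A (snd p)) *\<^sub>R fst p, A1 (snd p) * (Q - fst p \<bullet> fst p) + k1 (snd p)))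
     (\<lambda>p h. (S (fst h) - (2 * A (snd p)) *\<^sub>R fst h - (2 * A1 (snd p) * snd h) *\<^sub>R fst p,
        A2 (snd p) * snd h * (Q - fst p \<bullet> fst p) - 2 * A1 (snd p) * (fst p \<bullet> fst h) + k2 (snd p) * snd h))"
  unfolding C2_fun_def
proof (intro conjI allI)
  have symm: "x \<bullet> S y = y \<bullet> S x" for x y using S(2)[of x y] inner_commute[of "S x" y] by simp
  have bl: "bounded_linear S" using S(1) by (simp add: linear_conv_bounded_linear)
  have dS: "((\<lambda>p. S (fst p)) has_derivative (\<lambda>h. S (fst h))) (at p)" for p :: "(real^'n) \<times> real"
    by (rule bounded_linear.has_derivative[OF bl has_derivative_fst[OF has_derivative_ident]])
  have d: "((\<lambda>p. F (snd p)) has_derivative (\<lambda>h. snd h * F1 (snd p))) (at p)"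
    if "\<And>t. (F has_real_derivative F1 t) (at t)" for F F1 and p :: "(real^'n) \<times> real"
    by (rule DERIV_compose_FDERIV[OF that has_derivative_snd[OF has_derivative_ident]])
  have dq: "((\<lambda>p. 1/2 * (S (fst p) \<bullet> fst p)) has_derivative (\<lambda>h. S (fst p) \<bullet> fst h)) (at p)" for p :: "(real^'n) \<times> real"
  proof (rule has_derivative_eq_rhs)
    show "((\<lambda>p. 1/2 * (S (fst p) \<bullet> fst p)) has_derivative (\<lambda>h. 1/2 * (S (fst p) \<bullet> fst h + S (fst h) \<bullet> fst p))) (at p)"
      by (intro has_derivative_mult_right has_derivative_inner dS has_derivative_fst has_derivative_ident)
    show "(\<lambda>h. 1/2 * (S (fst p) \<bullet> fst h + S (fst h) \<bullet> fst p)) = (\<lambda>h. S (fst p) \<bullet> fst h)"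
      using S(2) symm by (auto simp: fun_eq_iff)
  qed
  note ds = dS dq d[OF A(1)] d[OF A(2)] d[OF k(1)] d[OF k(2)]
  show "((\<lambda>p. b \<bullet> fst p + 1/2 * (S (fst p) \<bullet> fst p) + A (snd p) * (Q - fst p \<bullet> fst p) + k (snd p)) has_derivative
      (\<lambda>h. (b + S (fst p) - (2 * A (snd p)) *\<^sub>R fst p, A1 (snd p) * (Q - fst p \<bullet> fst p) + k1 (snd p)) \<bullet> h)) (at p)" for p
    by (rule has_derivative_eq_rhs, (rule ds | rule derivative_intros)+)
      (auto simp: fun_eq_iff inner_prod_def inner_simps inner_commute algebra_simps)
  show "((\<lambda>p. (b + S (fst p) - (2 * A (snd p)) *\<^sub>R fst p, A1 (snd p) * (Q - fst p \<bullet> fst p) + k1 (snd p))) has_derivative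
      (\<lambda>h. (S (fst h) - (2 * A (snd p)) *\<^sub>R fst h - (2 * A1 (snd p) * snd h) *\<^sub>R fst p,
        A2 (snd p) * snd h * (Q - fst p \<bullet> fst p) - 2 * A1 (snd p) * (fst p \<bullet> fst h) + k2 (snd p) * snd h))) (at p)" for p
    by (rule has_derivative_eq_rhs, (rule ds | rule derivative_intros)+)
      (auto simp: fun_eq_iff inner_simps inner_commute algebra_simps)
  have cont: "continuous_on UNIV (\<lambda>p::(real^'n) \<times> real. F (snd p))" if "continuous_on UNIV F" for F :: "real \<Rightarrow> real"
    by (rule continuous_on_compose2[OF that]) (auto intro!: continuous_intros)
  have cA: "continuous_on UNIV A" "continuous_on UNIV A1"
    using DERIV_isCont[OF A(1)] DERIV_isCont[OF A(2)] by (simp_all add: continuous_at_imp_continuous_on)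
  show "continuous_on UNIV (\<lambda>p. (S (fst h) - (2 * A (snd p)) *\<^sub>R fst h - (2 * A1 (snd p) * snd h) *\<^sub>R fst p,
        A2 (snd p) * snd h * (Q - fst p \<bullet> fst p) - 2 * A1 (snd p) * (fst p \<bullet> fst h) + k2 (snd p) * snd h))"
    for h :: "(real^'n) \<times> real"
    by (intro continuous_intros cont cA A(3) k(3))
qed

lemma hess_mat_linear:
  assumes "linear G" "\<And>k. f'' x (axis k 1) = G (axis k 1)"
  shows "hess_mat f'' x *v v = G v"
proof -
  have "hess_mat f'' x = matrix G" unfolding hess_mat_def matrix_def assms(2) ..
  then show ?thesis using matrix_works[of G v] assms(1) by simp
qed

lemma hess_x_linear:
  assumes "linear G" "\<And>k. fst (f'' p (axis k 1, 0)) = G (axis k 1)"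
  shows "hess_x f'' p *v v = G v"
proof -
  have "hess_x f'' p = matrix G" unfolding hess_x_def matrix_def assms(2) ..
  then show ?thesis using matrix_works[of G v] assms(1) by simp
qed

lemma visc_sol_ell_quadratic_test:
  fixes z :: "real^'n \<Rightarrow> real"
  assumes z: "visc_sol_ell j \<Omega> g z" and x0: "x0 \<in> \<Omega>" and S: "linear S" "\<And>x y. S x \<bullet> y = x \<bullet> S y"
  shows "\<exists>H. (\<forall>v. H *v v = S v) \<and>
     ((\<exists>e>0. \<forall>x\<in>ball x0 e. z x - (b \<bullet> x + 1/2 * (S x \<bullet> x)) \<ge> z x0 - (b \<bullet> x0 + 1/2 * (S x0 \<bullet> x0))) \<longrightarrow> eig_j j H \<le> 0) \<and>
     ((\<exists>e>0. \<forall>x\<in>ball x0 e. z x - (b \<bullet> x + 1/2 * (S x \<bullet> x)) \<le> z x0 - (b \<bullet> x0 + 1/2 * (S x0 \<bullet> x0))) \<longrightarrow> eig_j j H \<ge> 0)"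
proof (rule exI[of _ "hess_mat (\<lambda>_. S) x0"], rule conjI)
  show "\<forall>v. hess_mat (\<lambda>_. S) x0 *v v = S v" by (intro allI hess_mat_linear S) simp
  show "((\<exists>e>0. \<forall>x\<in>ball x0 e. z x - (b \<bullet> x + 1/2 * (S x \<bullet> x)) \<ge> z x0 - (b \<bullet> x0 + 1/2 * (S x0 \<bullet> x0))) \<longrightarrow> eig_j j (hess_mat (\<lambda>_. S) x0) \<le> 0) \<and>
     ((\<exists>e>0. \<forall>x\<in>ball x0 e. z x - (b \<bullet> x + 1/2 * (S x \<bullet> x)) \<le> z x0 - (b \<bullet> x0 + 1/2 * (S x0 \<bullet> x0))) \<longrightarrow> eig_j j (hess_mat (\<lambda>_. S) x0) \<ge> 0)"
    using z[unfolded visc_sol_ell_def, THEN conjunct2, THEN conjunct2, rule_format, OF x0 C2_fun_quadratic[OF S, of b]]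
    by simp
qed

text \<open>The barrier and the penalty in time belong to the test function, so a quadratic in space
  touching \<open>u\<close> minus these terms tests \<open>u\<close> itself. The barrier shifts the
  spatial Hessian by \<open>- 2 * A t0\<close> times the identity.\<close>

lemma visc_sol_par_test:
  fixes u :: "real^'n \<Rightarrow> real \<Rightarrow> real" and b :: "real^'n" and Q :: real
  assumes u: "visc_sol_par j \<Omega> g u0 u" and x0: "x0 \<in> \<Omega>" and t0: "t0 > 0"
    and S: "linear S" "\<And>x y. S x \<bullet> y = x \<bullet> S y"
    and A: "\<And>t. (A has_real_derivative A1 t) (at t)" "\<And>t. (A1 has_real_derivative A2 t) (at t)" "continuous_on UNIV A2"
    and k: "\<And>t. (k has_real_derivative k1 t) (at t)" "\<And>t. (k1 has_real_derivative k2 t) (at t)" "continuous_on UNIV k2"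
  defines "\<phi> \<equiv> (\<lambda>x t. b \<bullet> x + 1/2 * (S x \<bullet> x) + A t * (Q - x \<bullet> x) + k t)"
  shows "\<exists>H. (\<forall>v. H *v v = S v - (2 * A t0) *\<^sub>R v) \<and>
     ((\<exists>e>0. \<forall>x t. (x, t) \<in> ball (x0, t0) e \<longrightarrow> u x t - \<phi> x t \<ge> u x0 t0 - \<phi> x0 t0) \<longrightarrow>
        A1 t0 * (Q - x0 \<bullet> x0) + k1 t0 \<ge> eig_j j H) \<and>
     ((\<exists>e>0. \<forall>x t. (x, t) \<in> ball (x0, t0) e \<longrightarrow> u x t - \<phi> x t \<le> u x0 t0 - \<phi> x0 t0) \<longrightarrow>
        A1 t0 * (Q - x0 \<bullet> x0) + k1 t0 \<le> eig_j j H)"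
proof -
  define f'' where "f'' = (\<lambda>(p::(real^'n) \<times> real) h. (S (fst h) - (2 * A (snd p)) *\<^sub>R fst h - (2 * A1 (snd p) * snd h) *\<^sub>R fst p,
        A2 (snd p) * snd h * (Q - fst p \<bullet> fst p) - 2 * A1 (snd p) * (fst p \<bullet> fst h) + k2 (snd p) * snd h))"
  note C2 = C2_fun_space_time[where b = b and Q = Q, OF S A k, folded f''_def]
  note test = u[unfolded visc_sol_par_def, THEN conjunct2, THEN conjunct2, THEN conjunct2, rule_format, OF x0 t0 C2]
  have "linear (\<lambda>v. S v - (2 * A t0) *\<^sub>R v)"
    using S(1) by (intro linear_compose_sub linear_compose_scale_right linear_ident)
  then have H: "hess_x f'' (x0, t0) *v v = S v - (2 * A t0) *\<^sub>R v" for v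
    by (rule hess_x_linear[where G = "\<lambda>v. S v - (2 * A t0) *\<^sub>R v"]) (simp add: f''_def)
  show ?thesis
  proof (rule exI[of _ "hess_x f'' (x0, t0)"], intro conjI allI impI H)
    assume "\<exists>e>0. \<forall>x t. (x, t) \<in> ball (x0, t0) e \<longrightarrow> u x t - \<phi> x t \<ge> u x0 t0 - \<phi> x0 t0"
    then obtain e where e: "e > 0" "\<And>x t. (x, t) \<in> ball (x0, t0) e \<Longrightarrow> u x t - \<phi> x t \<ge> u x0 t0 - \<phi> x0 t0" by blast
    have "\<forall>p\<in>ball (x0, t0) e. u (fst p) (snd p) - \<phi> (fst p) (snd p) \<ge> u x0 t0 - \<phi> x0 t0"
      using e(2) by (metis prod.collapse)
    with e(1) test show "eig_j j (hess_x f'' (x0, t0)) \<le> A1 t0 * (Q - x0 \<bullet> x0) + k1 t0"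
      unfolding \<phi>_def by fastforce
  next
    assume "\<exists>e>0. \<forall>x t. (x, t) \<in> ball (x0, t0) e \<longrightarrow> u x t - \<phi> x t \<le> u x0 t0 - \<phi> x0 t0"
    then obtain e where e: "e > 0" "\<And>x t. (x, t) \<in> ball (x0, t0) e \<Longrightarrow> u x t - \<phi> x t \<le> u x0 t0 - \<phi> x0 t0" by blast
    have "\<forall>p\<in>ball (x0, t0) e. u (fst p) (snd p) - \<phi> (fst p) (snd p) \<le> u x0 t0 - \<phi> x0 t0"
      using e(2) by (metis prod.collapse)
    with e(1) test show "A1 t0 * (Q - x0 \<bullet> x0) + k1 t0 \<le> eig_j j (hess_x f'' (x0, t0))"
      unfolding \<phi>_def by fastforce
  qed
qed

section \<open>Comparison with the exponential barrier\<close>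

lemma eventually_inside_box:
  fixes y1 :: "'a::metric_space" and t1 \<tau> e :: real
  assumes "open \<Omega>" "y1 \<in> \<Omega>" "0 < t1" "t1 < \<tau>" "0 < e"
  shows "\<exists>d>0. \<forall>x t. (x, t) \<in> ball (y1, t1) d \<longrightarrow> x \<in> \<Omega> \<and> 0 < t \<and> t < \<tau> \<and> x \<in> ball y1 e"
proof -
  obtain e2 where e2: "e2 > 0" "ball y1 e2 \<subseteq> \<Omega>" using assms openE by blast
  define d where "d = min (min e e2) (min t1 (\<tau> - t1))"
  have d: "d > 0" "d \<le> e" "d \<le> e2" "d \<le> t1" "d \<le> \<tau> - t1" using assms e2 by (auto simp: d_def)
  have "x \<in> \<Omega> \<and> 0 < t \<and> t < \<tau> \<and> x \<in> ball y1 e" if "(x, t) \<in> ball (y1, t1) d" for x t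
  proof -
    have "dist y1 x < d" "dist t1 t < d"
      using that dist_fst_le[of "(y1, t1)" "(x, t)"] dist_snd_le[of "(y1, t1)" "(x, t)"] by auto
    then have "x \<in> ball y1 e2" "x \<in> ball y1 e" "\<bar>t1 - t\<bar> < d" using d by (auto simp: dist_real_def)
    then show ?thesis using e2(2) d by auto
  qed
  then show ?thesis using d(1) by blast
qed

text \<open>With \<open>\<psi> x = Q - x \<bullet> x\<close>, the function \<open>z + M exp (- t / Q) \<psi>\<close> is a supersolution because
  \<open>D\<^sup>2\<psi> = - 2\<close> while \<open>\<psi> / Q \<le> 1\<close>. The term \<open>\<kappa> exp (\<lambda> (t - t0))\<close> is small at time \<open>t0\<close> and forces
  the maximum over the time interval \<open>[0, 2 t0]\<close> to be attained before its end.\<close>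

lemma one_sided_bound:
  fixes \<Omega> :: "(real^'n) set" and \<sigma> :: real
  assumes \<Omega>: "open \<Omega>" "bounded \<Omega>" and j: "1 \<le> j" "j \<le> CARD('n)"
    and u: "visc_sol_par j \<Omega> u0 u0 u" and z: "visc_sol_ell j \<Omega> u0 z"
    and Q: "\<And>x. x \<in> closure \<Omega> \<Longrightarrow> 1 \<le> Q - x \<bullet> x" and Q0: "Q > 0"
    and M0: "M > 0" and M: "\<And>x. x \<in> closure \<Omega> \<Longrightarrow> \<bar>u x 0\<bar> + \<bar>z x\<bar> < M"
    and \<sigma>: "\<sigma> = 1 \<or> \<sigma> = -1" and t0: "t0 > 0" and x0: "x0 \<in> \<Omega>"
  shows "\<sigma> * (u x0 t0 - z x0) \<le> M * exp (- (1/Q) * t0) * (Q - x0 \<bullet> x0)"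
proof (rule ccontr)
  assume neg: "\<not> ?thesis"
  define \<mu> where "\<mu> = 1 / Q"
  have \<mu>: "\<mu> > 0" using Q0 by (simp add: \<mu>_def)
  define A where "A t = M * exp (- \<mu> * t)" for t
  have Apos: "A t > 0" for t using M0 by (simp add: A_def)
  define \<tau> where "\<tau> = 2 * t0"
  \<comment> \<open>Half of the assumed excess: after the penalty \<open>k t0 = \<kappa>\<close> is
    subtracted, \<open>\<kappa> > 0\<close> is left at the starting point.\<close>
  define \<kappa> where "\<kappa> = (\<sigma> * (u x0 t0 - z x0) - A t0 * (Q - x0 \<bullet> x0)) / 2"
  have \<kappa>: "\<kappa> > 0" using neg unfolding \<kappa>_def A_def \<mu>_def by simp
  have C: "compact (closure \<Omega>)" using \<Omega>(2) by simp
  have frontier: "x \<in> frontier \<Omega>" if "x \<in> closure \<Omega>" "x \<notin> \<Omega>" for x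
    using that \<Omega>(1) by (simp add: frontier_def interior_open)
  have cu: "continuous_on (closure \<Omega> \<times> {0..\<tau>}) (\<lambda>p. u (fst p) (snd p))"
    by (rule continuous_on_subset[OF u[unfolded visc_sol_par_def, THEN conjunct1]]) auto
  have cz: "continuous_on (closure \<Omega>) z" by (rule z[unfolded visc_sol_ell_def, THEN conjunct1])
  have "bounded ((\<lambda>p. u (fst p) (snd p)) ` (closure \<Omega> \<times> {0..\<tau>}))"
    by (intro compact_imp_bounded compact_continuous_image cu compact_Times C compact_Icc)
  then obtain Bu where Bu: "Bu > 0" "\<And>x t. x \<in> closure \<Omega> \<Longrightarrow> t \<in> {0..\<tau>} \<Longrightarrow> \<bar>u x t\<bar> \<le> Bu"
    unfolding bounded_pos by force
  have "bounded (z ` closure \<Omega>)" by (intro compact_imp_bounded compact_continuous_image cz C)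
  then obtain Bz where Bz: "Bz > 0" "\<And>x. x \<in> closure \<Omega> \<Longrightarrow> \<bar>z x\<bar> \<le> Bz"
    unfolding bounded_pos by force
  \<comment> \<open>By \<open>exp s \<ge> s\<close>, this rate lifts the penalty at
    \<open>\<tau> = 2 * t0\<close> to at least \<open>Bu + Bz\<close>, a bound for the difference of
    \<open>u\<close> and \<open>z\<close>.\<close>
  define l where "l = (Bu + Bz) / (\<kappa> * t0)"
  have l: "l > 0" using Bu Bz \<kappa> t0 by (simp add: l_def)
  define k where "k t = \<kappa> * exp (l * (t - t0))" for t
  have kpos: "k t > 0" for t using \<kappa> by (simp add: k_def)
  have k\<tau>: "k \<tau> \<ge> Bu + Bz"
  proof -
    have "\<kappa> * (l * t0) \<le> \<kappa> * exp (l * t0)" using \<kappa> exp_ge_add_one_self[of "l * t0"] by (intro mult_left_mono) linarith+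
    moreover have "\<kappa> * (l * t0) = Bu + Bz" unfolding l_def using \<kappa> t0 by simp
    ultimately show ?thesis unfolding k_def \<tau>_def by simp
  qed
  define u1 where "u1 y t = \<sigma> * u y t - A t * (Q - y \<bullet> y) - k t" for y t
  define u2 where "u2 y s = - \<sigma> * z y" for y and s :: real
  \<comment> \<open>Time \<open>0\<close> is excluded by the size of \<open>M\<close>, time
    \<open>\<tau>\<close> by the penalty, and the lateral boundary by the common boundary
    data.\<close>
  have inside: "y \<in> \<Omega> \<and> 0 < t \<and> t < \<tau>" if y: "y \<in> closure \<Omega>" "t \<in> {0..\<tau>}" and p: "u1 y t + u2 y s > 0" for y t s
  proof -
    have p': "\<sigma> * (u y t - z y) > A t * (Q - y \<bullet> y) + k t" using p unfolding u1_def u2_def by (simp add: algebra_simps)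
    have abs: "\<sigma> * (u y t - z y) \<le> \<bar>u y t\<bar> + \<bar>z y\<bar>" using \<sigma> by auto
    have A\<psi>: "A t * (Q - y \<bullet> y) \<ge> A t" using Q[OF y(1)] Apos[of t] by simp
    have "t \<noteq> 0"
    proof
      assume "t = 0"
      then show False using p' abs A\<psi> kpos[of t] M[OF y(1)] by (simp add: A_def)
    qed
    then have tpos: "t > 0" using y by simp
    moreover have "t \<noteq> \<tau>"
    proof
      assume "t = \<tau>"
      then have "k t \<ge> Bu + Bz" using k\<tau> by simp
      then show False using p' abs A\<psi> Apos[of t] Bu(2)[OF y] Bz(2)[OF y(1)] by linarith
    qed
    moreover have "y \<in> \<Omega>"
    proof (rule ccontr)
      assume "y \<notin> \<Omega>"
      then have "y \<in> frontier \<Omega>" using frontier y by blast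
      then have "u y t = z y"
        using u[unfolded visc_sol_par_def, THEN conjunct2, THEN conjunct1] tpos
          z[unfolded visc_sol_ell_def, THEN conjunct2, THEN conjunct1] by simp
      then show False using p' A\<psi> Apos[of t] kpos[of t] by simp
    qed
    ultimately show ?thesis using y by simp
  qed
  have cA: "continuous_on S A" "continuous_on S k" for S
    unfolding A_def k_def by (intro continuous_intros)+
  have c1: "continuous_on (closure \<Omega> \<times> {0..\<tau>}) (\<lambda>p. u1 (fst p) (snd p))"
    unfolding u1_def
    by (intro continuous_intros cu continuous_on_compose2[OF cA(1)[of UNIV]] continuous_on_compose2[OF cA(2)[of UNIV]]) auto
  have c2: "continuous_on (closure \<Omega> \<times> {0..\<tau>}) (\<lambda>p. u2 (fst p) (snd p))"
    unfolding u2_def by (intro continuous_intros continuous_on_compose2[OF cz]) auto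
  have start: "u1 x0 t0 + u2 x0 t0 > 0"
  proof -
    have "u1 x0 t0 + u2 x0 t0 = 2 * \<kappa> - k t0" unfolding u1_def u2_def \<kappa>_def by (simp add: algebra_simps)
    then show ?thesis using \<kappa> unfolding k_def by simp
  qed
  \<comment> \<open>The equations will give \<open>A t1 \<le> 4 * \<eta>\<close>, while
    \<open>4 * \<eta>\<close> is half of \<open>A \<tau> \<le> A t1\<close>.\<close>
  define \<eta> where "\<eta> = A \<tau> / 8"
  have \<eta>: "\<eta> > 0" using Apos by (simp add: \<eta>_def)
  have x0C: "x0 \<in> closure \<Omega>" using x0 closure_subset by blast
  have t0\<tau>: "t0 \<in> {0..\<tau>}" using t0 by (simp add: \<tau>_def)
  obtain T b1 b2 y1 t1 s1 y2 t2 s2 where T: "linear T" "\<And>x y. T x \<bullet> y = x \<bullet> T y"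
    and y1: "y1 \<in> closure \<Omega>" "t1 \<in> {0..\<tau>}" "u1 y1 t1 + u2 y1 s1 > 0"
    and y2: "y2 \<in> closure \<Omega>" "s2 \<in> {0..\<tau>}" "t2 \<in> {0..\<tau>}" "u1 y2 s2 + u2 y2 t2 > 0"
    and touch1: "\<exists>e>0. \<forall>(y, t)\<in>closure \<Omega> \<times> {0..\<tau>}. y \<in> ball y1 e \<longrightarrow>
       u1 y t - (b1 \<bullet> y + 1/2 * (T y \<bullet> y) + \<eta> * (y \<bullet> y)) \<le> u1 y1 t1 - (b1 \<bullet> y1 + 1/2 * (T y1 \<bullet> y1) + \<eta> * (y1 \<bullet> y1))"
    and touch2: "\<exists>e>0. \<forall>(y, t)\<in>closure \<Omega> \<times> {0..\<tau>}. y \<in> ball y2 e \<longrightarrow>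
       u2 y t - (b2 \<bullet> y - 1/2 * (T y \<bullet> y) + \<eta> * (y \<bullet> y)) \<le> u2 y2 t2 - (b2 \<bullet> y2 - 1/2 * (T y2 \<bullet> y2) + \<eta> * (y2 \<bullet> y2))"
    using doubling_touching_quadratics[OF C c1 c2 x0C t0\<tau> t0\<tau> start \<eta>] by blast
  have in1: "y1 \<in> \<Omega>" "0 < t1" "t1 < \<tau>" using inside[OF y1] by auto
  have in2: "y2 \<in> \<Omega>" using inside[OF y2(1,2,4)] by auto
  obtain e1 where e1: "e1 > 0" "\<And>y t. y \<in> closure \<Omega> \<Longrightarrow> t \<in> {0..\<tau>} \<Longrightarrow> y \<in> ball y1 e1 \<Longrightarrow>
       u1 y t - (b1 \<bullet> y + 1/2 * (T y \<bullet> y) + \<eta> * (y \<bullet> y)) \<le> u1 y1 t1 - (b1 \<bullet> y1 + 1/2 * (T y1 \<bullet> y1) + \<eta> * (y1 \<bullet> y1))"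
    using touch1 by blast
  obtain d1 where d1: "d1 > 0" "\<And>x t. (x, t) \<in> ball (y1, t1) d1 \<Longrightarrow> x \<in> \<Omega> \<and> 0 < t \<and> t < \<tau> \<and> x \<in> ball y1 e1"
    using eventually_inside_box[OF \<Omega>(1) in1 e1(1)] by blast
  have par: "u1 x t - (b1 \<bullet> x + 1/2 * (T x \<bullet> x) + \<eta> * (x \<bullet> x)) \<le> u1 y1 t1 - (b1 \<bullet> y1 + 1/2 * (T y1 \<bullet> y1) + \<eta> * (y1 \<bullet> y1))"
    if "(x, t) \<in> ball (y1, t1) d1" for x t
    using e1(2)[of x t] d1(2)[OF that] closure_subset[of \<Omega>] by auto
  obtain e2 where e2: "e2 > 0" "\<And>y t. y \<in> closure \<Omega> \<Longrightarrow> t \<in> {0..\<tau>} \<Longrightarrow> y \<in> ball y2 e2 \<Longrightarrow>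
       u2 y t - (b2 \<bullet> y - 1/2 * (T y \<bullet> y) + \<eta> * (y \<bullet> y)) \<le> u2 y2 t2 - (b2 \<bullet> y2 - 1/2 * (T y2 \<bullet> y2) + \<eta> * (y2 \<bullet> y2))"
    using touch2 by blast
  obtain e3 where e3: "e3 > 0" "ball y2 e3 \<subseteq> \<Omega>" using \<Omega>(1) in2 openE by blast
  define d2 where "d2 = min e2 e3"
  have d2: "d2 > 0" using e2 e3 by (simp add: d2_def)
  have ell: "- \<sigma> * z y - (b2 \<bullet> y - 1/2 * (T y \<bullet> y) + \<eta> * (y \<bullet> y)) \<le> - \<sigma> * z y2 - (b2 \<bullet> y2 - 1/2 * (T y2 \<bullet> y2) + \<eta> * (y2 \<bullet> y2))"
    if "y \<in> ball y2 d2" for y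
  proof -
    have "y \<in> \<Omega>" "y \<in> ball y2 e2" using that e3(2) unfolding d2_def by auto
    then show ?thesis using e2(2)[of y t0] t0\<tau> closure_subset[of \<Omega>] unfolding u2_def by auto
  qed
  have S1: "linear (\<lambda>x. m *\<^sub>R T x + n *\<^sub>R x)" for m n
    by (rule linearI) (simp_all add: linear_add[OF T(1)] linear_cmul[OF T(1)] algebra_simps)
  have S2: "(m *\<^sub>R T x + n *\<^sub>R x) \<bullet> y = x \<bullet> (m *\<^sub>R T y + n *\<^sub>R y)" for m n x y
    by (simp add: inner_simps T(2))
  have dA: "((\<lambda>t. s * A t) has_real_derivative s * (- \<mu> * A t)) (at t)"
    "((\<lambda>t. s * (- \<mu> * A t)) has_real_derivative s * (\<mu> * \<mu> * A t)) (at t)"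
    "((\<lambda>t. s * k t) has_real_derivative s * (l * k t)) (at t)"
    "((\<lambda>t. s * (l * k t)) has_real_derivative s * (l * l * k t)) (at t)" for s t
    unfolding A_def k_def by (auto intro!: derivative_eq_intros simp: algebra_simps)
  have cc: "continuous_on UNIV (\<lambda>t. s * (\<mu> * \<mu> * A t))" "continuous_on UNIV (\<lambda>t. s * (l * l * k t))" for s
    by (intro continuous_intros cA)+
  have \<psi>: "\<mu> * A t1 * (Q - y1 \<bullet> y1) \<le> A t1"
  proof -
    have "\<mu> * (Q - y1 \<bullet> y1) \<le> 1" unfolding \<mu>_def using Q0 by (simp add: field_simps)
    then have "A t1 * (\<mu> * (Q - y1 \<bullet> y1)) \<le> A t1 * 1" using Apos[of t1] by (intro mult_left_mono) auto
    then show ?thesis by (simp add: mult_ac)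
  qed
  have "A t1 \<le> 4 * \<eta>"
    using \<sigma>
  proof
    assume s: "\<sigma> = 1"
    note test = visc_sol_par_test[where b = b1 and Q = Q, OF u in1(1,2) S1[where m = 1 and n = "2 * \<eta>"] S2[where m = 1 and n = "2 * \<eta>"] dA(1)[where s = 1] dA(2)[where s = 1] cc(1)[where s = 1] dA(3)[where s = 1] dA(4)[where s = 1] cc(2)[where s = 1]]
    from test obtain H where H: "\<And>v. H *v v = 1 *\<^sub>R T v + (2 * \<eta>) *\<^sub>R v - (2 * (1 * A t1)) *\<^sub>R v"
      and Htest: "(\<exists>e>0. \<forall>x t. (x, t) \<in> ball (y1, t1) e \<longrightarrow>
         u x t - (b1 \<bullet> x + 1/2 * ((1 *\<^sub>R T x + (2 * \<eta>) *\<^sub>R x) \<bullet> x) + 1 * A t * (Q - x \<bullet> x) + 1 * k t) \<le>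
         u y1 t1 - (b1 \<bullet> y1 + 1/2 * ((1 *\<^sub>R T y1 + (2 * \<eta>) *\<^sub>R y1) \<bullet> y1) + 1 * A t1 * (Q - y1 \<bullet> y1) + 1 * k t1)) \<Longrightarrow>
         1 * (- \<mu> * A t1) * (Q - y1 \<bullet> y1) + 1 * (l * k t1) \<le> eig_j j H" by blast
    have 1: "- \<mu> * A t1 * (Q - y1 \<bullet> y1) + l * k t1 \<le> eig_j j H"
    proof -
      have eq: "u x t - (b1 \<bullet> x + 1/2 * ((1 *\<^sub>R T x + (2 * \<eta>) *\<^sub>R x) \<bullet> x) + 1 * A t * (Q - x \<bullet> x) + 1 * k t)
          = u1 x t - (b1 \<bullet> x + 1/2 * (T x \<bullet> x) + \<eta> * (x \<bullet> x))" for x t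
        unfolding u1_def s by (simp add: inner_simps field_simps)
      have "1 * (- \<mu> * A t1) * (Q - y1 \<bullet> y1) + 1 * (l * k t1) \<le> eig_j j H"
      proof (rule Htest, intro exI conjI allI impI)
        show "d1 > 0" by (rule d1(1))
      next
        fix x t assume "(x, t) \<in> ball (y1, t1) d1"
        from par[OF this] show "u x t - (b1 \<bullet> x + 1/2 * ((1 *\<^sub>R T x + (2 * \<eta>) *\<^sub>R x) \<bullet> x) + 1 * A t * (Q - x \<bullet> x) + 1 * k t) \<le>
          u y1 t1 - (b1 \<bullet> y1 + 1/2 * ((1 *\<^sub>R T y1 + (2 * \<eta>) *\<^sub>R y1) \<bullet> y1) + 1 * A t1 * (Q - y1 \<bullet> y1) + 1 * k t1)"
          unfolding eq .
      qed
      then show ?thesis by simp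
    qed
    obtain H' where H': "\<And>v. H' *v v = 1 *\<^sub>R T v + (- 2 * \<eta>) *\<^sub>R v"
      and Htest': "(\<exists>e>0. \<forall>x\<in>ball y2 e. z x - (- b2 \<bullet> x + 1/2 * ((1 *\<^sub>R T x + (- 2 * \<eta>) *\<^sub>R x) \<bullet> x)) \<ge>
         z y2 - (- b2 \<bullet> y2 + 1/2 * ((1 *\<^sub>R T y2 + (- 2 * \<eta>) *\<^sub>R y2) \<bullet> y2))) \<Longrightarrow> eig_j j H' \<le> 0"
      using visc_sol_ell_quadratic_test[where b = "- b2", OF z in2 S1[where m = 1 and n = "- 2 * \<eta>"] S2[where m = 1 and n = "- 2 * \<eta>"]] by blast
    have 2: "eig_j j H' \<le> 0"
    proof (rule Htest', intro exI conjI ballI)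
      show "d2 > 0" by (rule d2)
    next
      fix x assume "x \<in> ball y2 d2"
      from ell[OF this] show "z y2 - (- b2 \<bullet> y2 + 1/2 * ((1 *\<^sub>R T y2 + (- 2 * \<eta>) *\<^sub>R y2) \<bullet> y2)) \<le>
         z x - (- b2 \<bullet> x + 1/2 * ((1 *\<^sub>R T x + (- 2 * \<eta>) *\<^sub>R x) \<bullet> x))" unfolding s by (simp add: inner_simps field_simps)
    qed
    \<comment> \<open>The Hessians are \<open>T + 2 * \<eta> - 2 * A t1\<close> for \<open>u\<close>
      and \<open>T - 2 * \<eta>\<close> for \<open>z\<close>, scalars standing for multiples of the
      identity. The time derivative of the barrier costs at most \<open>A t1\<close> by
      \<open>\<psi>\<close>, so \<open>A t1\<close> of the gap survives.\<close>
    have "eig_j j H \<le> eig_j j H' + (4 * \<eta> - 2 * A t1)"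
      by (rule eig_j_le[OF j]) (simp add: H H' inner_simps algebra_simps)
    moreover have "l * k t1 > 0" using l kpos by simp
    ultimately show ?thesis using 1 2 \<psi> by simp
  next
    \<comment> \<open>All signs flip: \<open>u\<close> is touched from below and \<open>z\<close>
      from above, so the eigenvalue comparison runs in the opposite direction.\<close>
    assume s: "\<sigma> = -1"
    note test = visc_sol_par_test[where b = "- b1" and Q = Q, OF u in1(1,2) S1[where m = "-1" and n = "- 2 * \<eta>"] S2[where m = "-1" and n = "- 2 * \<eta>"] dA(1)[where s = "-1"] dA(2)[where s = "-1"] cc(1)[where s = "-1"] dA(3)[where s = "-1"] dA(4)[where s = "-1"] cc(2)[where s = "-1"]]
    from test obtain H where H: "\<And>v. H *v v = (-1) *\<^sub>R T v + (- 2 * \<eta>) *\<^sub>R v - (2 * (-1 * A t1)) *\<^sub>R v"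
      and Htest: "(\<exists>e>0. \<forall>x t. (x, t) \<in> ball (y1, t1) e \<longrightarrow>
         u x t - (- b1 \<bullet> x + 1/2 * (((-1) *\<^sub>R T x + (- 2 * \<eta>) *\<^sub>R x) \<bullet> x) + -1 * A t * (Q - x \<bullet> x) + -1 * k t) \<ge>
         u y1 t1 - (- b1 \<bullet> y1 + 1/2 * (((-1) *\<^sub>R T y1 + (- 2 * \<eta>) *\<^sub>R y1) \<bullet> y1) + -1 * A t1 * (Q - y1 \<bullet> y1) + -1 * k t1)) \<Longrightarrow>
         -1 * (- \<mu> * A t1) * (Q - y1 \<bullet> y1) + -1 * (l * k t1) \<ge> eig_j j H" by blast
    have 1: "\<mu> * A t1 * (Q - y1 \<bullet> y1) - l * k t1 \<ge> eig_j j H"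
    proof -
      have eq: "u x t - (- b1 \<bullet> x + 1/2 * (((-1) *\<^sub>R T x + (- 2 * \<eta>) *\<^sub>R x) \<bullet> x) + -1 * A t * (Q - x \<bullet> x) + -1 * k t)
          = - (u1 x t - (b1 \<bullet> x + 1/2 * (T x \<bullet> x) + \<eta> * (x \<bullet> x)))" for x t
        unfolding u1_def s by (simp add: inner_simps field_simps)
      have "-1 * (- \<mu> * A t1) * (Q - y1 \<bullet> y1) + -1 * (l * k t1) \<ge> eig_j j H"
      proof (rule Htest, intro exI conjI allI impI)
        show "d1 > 0" by (rule d1(1))
      next
        fix x t assume "(x, t) \<in> ball (y1, t1) d1"
        from par[OF this] show "u x t - (- b1 \<bullet> x + 1/2 * (((-1) *\<^sub>R T x + (- 2 * \<eta>) *\<^sub>R x) \<bullet> x) + -1 * A t * (Q - x \<bullet> x) + -1 * k t) \<ge>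
          u y1 t1 - (- b1 \<bullet> y1 + 1/2 * (((-1) *\<^sub>R T y1 + (- 2 * \<eta>) *\<^sub>R y1) \<bullet> y1) + -1 * A t1 * (Q - y1 \<bullet> y1) + -1 * k t1)"
          unfolding eq by (simp only: neg_le_iff_le)
      qed
      then show ?thesis by simp
    qed
    obtain H' where H': "\<And>v. H' *v v = (-1) *\<^sub>R T v + (2 * \<eta>) *\<^sub>R v"
      and Htest': "(\<exists>e>0. \<forall>x\<in>ball y2 e. z x - (b2 \<bullet> x + 1/2 * (((-1) *\<^sub>R T x + (2 * \<eta>) *\<^sub>R x) \<bullet> x)) \<le>
         z y2 - (b2 \<bullet> y2 + 1/2 * (((-1) *\<^sub>R T y2 + (2 * \<eta>) *\<^sub>R y2) \<bullet> y2))) \<Longrightarrow> eig_j j H' \<ge> 0"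
      using visc_sol_ell_quadratic_test[where b = b2, OF z in2 S1[where m = "-1" and n = "2 * \<eta>"] S2[where m = "-1" and n = "2 * \<eta>"]] by blast
    have 2: "eig_j j H' \<ge> 0"
    proof (rule Htest', intro exI conjI ballI)
      show "d2 > 0" by (rule d2)
    next
      fix x assume "x \<in> ball y2 d2"
      from ell[OF this] show "z x - (b2 \<bullet> x + 1/2 * (((-1) *\<^sub>R T x + (2 * \<eta>) *\<^sub>R x) \<bullet> x)) \<le>
         z y2 - (b2 \<bullet> y2 + 1/2 * (((-1) *\<^sub>R T y2 + (2 * \<eta>) *\<^sub>R y2) \<bullet> y2))" unfolding s by (simp add: inner_simps field_simps)
    qed
    have "eig_j j H' \<le> eig_j j H + (4 * \<eta> - 2 * A t1)"
      by (rule eig_j_le[OF j]) (simp add: H H' inner_simps algebra_simps)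
    moreover have "l * k t1 > 0" using l kpos by simp
    ultimately show ?thesis using 1 2 \<psi> by simp
  qed
  moreover have "A \<tau> \<le> A t1" unfolding A_def using M0 \<mu> in1 by simp
  ultimately show False using \<eta> unfolding \<eta>_def by simp
qed

theorem theorem1p2:
  fixes \<Omega> :: "(real^'n) set"
  assumes "open \<Omega>" and "bounded \<Omega>"
  shows "\<exists>\<mu>>0. \<forall>j u0 u z.
           1 \<le> j \<and> j \<le> CARD('n) \<and> continuous_on (closure \<Omega>) u0 \<and>
           visc_sol_par j \<Omega> u0 u0 u \<and> visc_sol_ell j \<Omega> u0 z \<longrightarrow>
           (\<exists>C>0. \<forall>t>0. \<forall>x\<in>\<Omega>. \<bar>u x t - z x\<bar> \<le> C * exp (- \<mu> * t))"
proof -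
  have "bounded (closure \<Omega>)" using assms(2) by (rule bounded_closure)
  then obtain r where r: "\<And>x. x \<in> closure \<Omega> \<Longrightarrow> norm x \<le> r" unfolding bounded_iff by blast
  \<comment> \<open>With this choice \<open>Q - x \<bullet> x\<close> lies between \<open>1\<close>
    and \<open>Q\<close> on the closure, and the rate \<open>1 / Q\<close> depends on the domain
    alone.\<close>
  define Q where "Q = r\<^sup>2 + 1"
  have Q0: "Q > 0" unfolding Q_def by (simp add: add_nonneg_pos)
  have Q: "1 \<le> Q - x \<bullet> x" if "x \<in> closure \<Omega>" for x
    using power_mono[OF r[OF that], of 2] by (simp add: Q_def dot_square_norm)
  show ?thesis
  proof (rule exI[of _ "1 / Q"], intro conjI allI impI)
    show "1 / Q > 0" using Q0 by simp
    fix j and u0 :: "real^'n \<Rightarrow> real" and u z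
    assume H: "1 \<le> j \<and> j \<le> CARD('n) \<and> continuous_on (closure \<Omega>) u0 \<and>
           visc_sol_par j \<Omega> u0 u0 u \<and> visc_sol_ell j \<Omega> u0 z"
    have cu: "continuous_on (closure \<Omega> \<times> {0..}) (\<lambda>p. u (fst p) (snd p))" and cz: "continuous_on (closure \<Omega>) z"
      using H unfolding visc_sol_par_def visc_sol_ell_def by (simp_all only: simp_thms)
    \<comment> \<open>The bound must cover the frontier at time \<open>0\<close>, where no value of
      \<open>u\<close> is prescribed; continuity up to the boundary supplies it.\<close>
    have "continuous_on (closure \<Omega>) (\<lambda>x. u (fst (x, 0::real)) (snd (x, 0::real)))"
      by (rule continuous_on_compose2[OF cu, where f = "\<lambda>x. (x, 0)"]) (auto intro!: continuous_intros)
    then have "continuous_on (closure \<Omega>) (\<lambda>x. \<bar>u x 0\<bar> + \<bar>z x\<bar>)" using cz by (simp add: continuous_intros)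
    then have "bounded ((\<lambda>x. \<bar>u x 0\<bar> + \<bar>z x\<bar>) ` closure \<Omega>)"
      using assms(2) by (intro compact_imp_bounded compact_continuous_image) auto
    then obtain M' where M': "M' > 0" "\<And>x. x \<in> closure \<Omega> \<Longrightarrow> \<bar>u x 0\<bar> + \<bar>z x\<bar> \<le> M'"
      unfolding bounded_pos by fastforce
    define M where "M = M' + 1"
    have M: "M > 0" "\<And>x. x \<in> closure \<Omega> \<Longrightarrow> \<bar>u x 0\<bar> + \<bar>z x\<bar> < M" using M' by (force simp: M_def)+
    show "\<exists>C>0. \<forall>t>0. \<forall>x\<in>\<Omega>. \<bar>u x t - z x\<bar> \<le> C * exp (- (1 / Q) * t)"
    \<comment> \<open>The factor \<open>Q\<close> bounds the spatial part
      \<open>Q - x \<bullet> x\<close> of the barrier.\<close>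
    proof (intro exI[of _ "M * Q"] conjI allI impI ballI)
      show "M * Q > 0" using M Q0 by simp
      fix t :: real and x assume t: "t > 0" and x: "x \<in> \<Omega>"
      have b: "\<sigma> * (u x t - z x) \<le> M * exp (- (1/Q) * t) * (Q - x \<bullet> x)" if "\<sigma> = 1 \<or> \<sigma> = -1" for \<sigma>
      proof (rule one_sided_bound[where \<Omega> = \<Omega> and j = j and ?u0.0 = u0])
        show "1 \<le> Q - x \<bullet> x" if "x \<in> closure \<Omega>" for x by (rule Q[OF that])
        show "\<bar>u x 0\<bar> + \<bar>z x\<bar> < M" if "x \<in> closure \<Omega>" for x by (rule M(2)[OF that])
      qed (use assms Q0 M(1) H that t x in blast)+
      have "M * exp (- (1/Q) * t) * (Q - x \<bullet> x) \<le> M * exp (- (1/Q) * t) * Q"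
        using M by (intro mult_left_mono) auto
      then show "\<bar>u x t - z x\<bar> \<le> M * Q * exp (- (1 / Q) * t)"
        using b[of 1] b[of "-1"] by (simp add: mult_ac)
    qed
  qed
qed

end
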